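(* Let $A$ be a Nakayama algebra and let $n\ge1$ be an integer. If $A$ is $2n$-Gorenstein, then $A$ is also $(2n+1)$-Gorenstein.
   Context: A Nakayama algebra is a finite-dimensional algebra $A=kQ/I$ over a field $k$, where $I$ is an admissible ideal and $Q$ is either the linearly oriented line $1\to2\to\cdots\to N$ or the linearly oriented cycle $1\to2\to\cdots\to N\to1$. Modules are finite-dimensional right $A$-modules. Let $0\to A_A\to I^0\to I^1\to\cdots$ be a minimal injective resolution of the regular module. For $m\ge 1$, $A$ is $m$-Gorenstein if $\operatorname{pdim} I^i\le i$ for all $0\le i<m$. *)

theory Defs
  imports
    "HOL-Algebra.Module"
    "HOL-Algebra.QuotRing"
    "HOL-Algebra.Ideal_Product"
    "HOL-Library.Extended_Nat"
    "Graph_Theory.Arc_Walk"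
begin

section \<open>Path algebras and admissible quotients\<close>

text \<open>
  A quiver is a \<open>pre_digraph\<close> (loops and multiple arrows are allowed). A path is a triple
  (source, list of arrows, target); the trivial path at \<open>v\<close> is \<open>(v, [], v)\<close>.
\<close>

type_synonym ('v, 'e) path = "'v \<times> 'e list \<times> 'v"

definition paths :: "('v, 'e) pre_digraph \<Rightarrow> ('v, 'e) path set" where
  "paths Q = {(u, p, v). pre_digraph.awalk Q u p v}"

text \<open>
  An algebra over a field \<open>'k\<close> is represented by a \<open>module\<close> record: its ring operations together
  with \<open>smult\<close> as the action of the scalars. The product of paths \<open>p q\<close> is \<open>p\<close> followed by \<open>q\<close>.
\<close>

definition path_algebra ::
  "('v, 'e) pre_digraph \<Rightarrow> ('k::field, ('v, 'e) path \<Rightarrow> 'k) module" where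
  "path_algebra Q =
    \<lparr>carrier = {f. finite {p. f p \<noteq> 0} \<and> {p. f p \<noteq> 0} \<subseteq> paths Q},
     mult = (\<lambda>f g (u, r, w).
       \<Sum>(v, p, q) \<in> {(v, p, q). (u, p, v) \<in> paths Q \<and> (v, q, w) \<in> paths Q \<and> r = p @ q}.
         f (u, p, v) * g (v, q, w)),
     one = (\<lambda>p. if p \<in> {(v, [], v) | v. v \<in> verts Q} then 1 else 0),
     zero = (\<lambda>p. 0),
     add = (\<lambda>f g p. f p + g p),
     smult = (\<lambda>c f p. c * f p)\<rparr>"

definition path_elem :: "('v, 'e) path \<Rightarrow> ('v, 'e) path \<Rightarrow> 'k::field" where
  "path_elem p = (\<lambda>q. if q = p then 1 else 0)"

definition arrow_ideal :: "('v, 'e) pre_digraph \<Rightarrow> (('v, 'e) path \<Rightarrow> 'k::field) set" where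
  "arrow_ideal Q =
    genideal (path_algebra Q) {path_elem (tail Q e, [e], head Q e) | e. e \<in> arcs Q}"

definition admissible_ideal ::
  "('v, 'e) pre_digraph \<Rightarrow> (('v, 'e) path \<Rightarrow> 'k::field) set \<Rightarrow> bool" where
  "admissible_ideal Q I \<longleftrightarrow>
    ideal I (path_algebra Q) \<and>
    (\<exists>m\<ge>2. arrow_ideal Q [^]\<^bsub>ideals_set (path_algebra Q)\<^esub> (m::nat) \<subseteq> I) \<and>
    I \<subseteq> arrow_ideal Q [^]\<^bsub>ideals_set (path_algebra Q)\<^esub> (2::nat)"

text \<open>The ring \<open>A Quot I\<close> with the induced scalar action (\<open>Quot\<close> itself drops the scalars).\<close>

definition quotient_algebra :: "('k, 'a) module \<Rightarrow> 'a set \<Rightarrow> ('k, 'a set) module" where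
  "quotient_algebra A I =
    ring.extend (A Quot I)
      (module.fields (\<lambda>c X. \<Union>x\<in>X. I +>\<^bsub>A\<^esub> (c \<odot>\<^bsub>A\<^esub> x)))"


section \<open>Right modules\<close>

text \<open>
  A right module is also a \<open>module\<close> record, where \<open>a \<odot>\<^bsub>M\<^esub> x\<close> stands for \<open>x a\<close>; hence the
  order of the factors in \<open>smult_assoc\<close>. The fields \<open>mult\<close> and \<open>one\<close> of \<open>M\<close> are not used.
\<close>

locale right_module = A?: ring A + M?: abelian_group M for A (structure) and M (structure) +
  assumes smult_closed:
      "\<lbrakk>a \<in> carrier A; x \<in> carrier M\<rbrakk> \<Longrightarrow> a \<odot>\<^bsub>M\<^esub> x \<in> carrier M"
    and smult_l_distr:
      "\<lbrakk>a \<in> carrier A; b \<in> carrier A; x \<in> carrier M\<rbrakk> \<Longrightarrow>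
        (a \<oplus>\<^bsub>A\<^esub> b) \<odot>\<^bsub>M\<^esub> x = a \<odot>\<^bsub>M\<^esub> x \<oplus>\<^bsub>M\<^esub> b \<odot>\<^bsub>M\<^esub> x"
    and smult_r_distr:
      "\<lbrakk>a \<in> carrier A; x \<in> carrier M; y \<in> carrier M\<rbrakk> \<Longrightarrow>
        a \<odot>\<^bsub>M\<^esub> (x \<oplus>\<^bsub>M\<^esub> y) = a \<odot>\<^bsub>M\<^esub> x \<oplus>\<^bsub>M\<^esub> a \<odot>\<^bsub>M\<^esub> y"
    and smult_assoc:
      "\<lbrakk>a \<in> carrier A; b \<in> carrier A; x \<in> carrier M\<rbrakk> \<Longrightarrow>
        (a \<otimes>\<^bsub>A\<^esub> b) \<odot>\<^bsub>M\<^esub> x = b \<odot>\<^bsub>M\<^esub> (a \<odot>\<^bsub>M\<^esub> x)"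
    and smult_one: "x \<in> carrier M \<Longrightarrow> \<one>\<^bsub>A\<^esub> \<odot>\<^bsub>M\<^esub> x = x"

text \<open>A scalar \<open>c\<close> acts on a module over the algebra \<open>A\<close> as the element \<open>c 1\<close> of \<open>A\<close>.\<close>

definition fd_module :: "('k, 'a) module \<Rightarrow> ('a, 'b) module \<Rightarrow> bool" where
  "fd_module A M \<longleftrightarrow>
    right_module A M \<and>
    (\<exists>B. finite B \<and> B \<subseteq> carrier M \<and>
      (\<forall>x\<in>carrier M. \<exists>c. x = (\<Oplus>\<^bsub>M\<^esub>b\<in>B. (c b \<odot>\<^bsub>A\<^esub> \<one>\<^bsub>A\<^esub>) \<odot>\<^bsub>M\<^esub> b)))"

definition regular_module :: "('k, 'a) module \<Rightarrow> ('a, 'a) module" where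
  "regular_module A =
    \<lparr>carrier = carrier A, mult = mult A, one = one A, zero = zero A, add = add A,
     smult = (\<lambda>a x. x \<otimes>\<^bsub>A\<^esub> a)\<rparr>"

definition module_homs ::
  "('k, 'a) module \<Rightarrow> ('a, 'b) module \<Rightarrow> ('a, 'c) module \<Rightarrow> ('b \<Rightarrow> 'c) set" where
  "module_homs A M N =
    {f \<in> hom (add_monoid M) (add_monoid N).
      \<forall>a\<in>carrier A. \<forall>x\<in>carrier M. f (a \<odot>\<^bsub>M\<^esub> x) = a \<odot>\<^bsub>N\<^esub> f x}"

definition exact_at ::
  "('a, 'b) module \<Rightarrow> ('b \<Rightarrow> 'c) \<Rightarrow> ('a, 'c) module \<Rightarrow> ('c \<Rightarrow> 'd) \<Rightarrow> ('a, 'd) module \<Rightarrow> bool" where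
  "exact_at L f M g N \<longleftrightarrow> f ` carrier L = a_kernel M N g"

definition essential_submodule :: "('k, 'a) module \<Rightarrow> 'b set \<Rightarrow> ('a, 'b) module \<Rightarrow> bool" where
  "essential_submodule A S M \<longleftrightarrow>
    submodule S A M \<and>
    (\<forall>T. submodule T A M \<and> T \<inter> S = {\<zero>\<^bsub>M\<^esub>} \<longrightarrow> T = {\<zero>\<^bsub>M\<^esub>})"


section \<open>Projective and injective modules\<close>

text \<open>
  Quantification over all finite-dimensional \<open>A\<close>-modules is rendered by quantification over
  those whose elements have type \<open>nat \<Rightarrow> 'k\<close>. The carrier and the operations are arbitrary,
  and as every \<open>'k ^ d\<close> embeds in \<open>nat \<Rightarrow> 'k\<close>, each isomorphism class of finite-dimensional modules
  is represented.
\<close>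

definition projective_module :: "('k, 'a) module \<Rightarrow> ('a, nat \<Rightarrow> 'k) module \<Rightarrow> bool" where
  "projective_module A P \<longleftrightarrow>
    fd_module A P \<and>
    (\<forall>(X :: ('a, nat \<Rightarrow> 'k) module) (Y :: ('a, nat \<Rightarrow> 'k) module).
      \<forall>g \<in> module_homs A X Y. \<forall>f \<in> module_homs A P Y.
        fd_module A X \<and> fd_module A Y \<and> g ` carrier X = carrier Y \<longrightarrow>
        (\<exists>h \<in> module_homs A P X. \<forall>x\<in>carrier P. g (h x) = f x))"

definition injective_module :: "('k, 'a) module \<Rightarrow> ('a, nat \<Rightarrow> 'k) module \<Rightarrow> bool" where
  "injective_module A E \<longleftrightarrow>
    fd_module A E \<and>
    (\<forall>(X :: ('a, nat \<Rightarrow> 'k) module) (Y :: ('a, nat \<Rightarrow> 'k) module).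
      \<forall>g \<in> module_homs A X Y. \<forall>f \<in> module_homs A X E.
        fd_module A X \<and> fd_module A Y \<and> inj_on g (carrier X) \<longrightarrow>
        (\<exists>h \<in> module_homs A Y E. \<forall>x\<in>carrier X. h (g x) = f x))"


section \<open>Resolutions and the Gorenstein condition\<close>

text \<open>
  A resolution \<open>0 \<rightarrow> P n \<rightarrow> \<dots> \<rightarrow> P 0 \<rightarrow> M \<rightarrow> 0\<close>, extended by zero modules. The map \<open>d 0\<close> is the
  augmentation \<open>P 0 \<rightarrow> M\<close> and \<open>d (Suc j)\<close> goes from \<open>P (Suc j)\<close> to \<open>P j\<close>.
\<close>

definition projective_resolution ::
  "('k, 'a) module \<Rightarrow> ('a, nat \<Rightarrow> 'k) module \<Rightarrow> nat \<Rightarrow>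
   (nat \<Rightarrow> ('a, nat \<Rightarrow> 'k) module) \<Rightarrow> (nat \<Rightarrow> (nat \<Rightarrow> 'k) \<Rightarrow> (nat \<Rightarrow> 'k)) \<Rightarrow> bool" where
  "projective_resolution A M n P d \<longleftrightarrow>
    (\<forall>j. projective_module A (P j)) \<and>
    (\<forall>j>n. carrier (P j) = {\<zero>\<^bsub>P j\<^esub>}) \<and>
    d 0 \<in> module_homs A (P 0) M \<and>
    (\<forall>j. d (Suc j) \<in> module_homs A (P (Suc j)) (P j)) \<and>
    d 0 ` carrier (P 0) = carrier M \<and>
    exact_at (P 1) (d 1) (P 0) (d 0) M \<and>
    (\<forall>j. exact_at (P (Suc (Suc j))) (d (Suc (Suc j))) (P (Suc j)) (d (Suc j)) (P j))"

definition proj_dim :: "('k, 'a) module \<Rightarrow> ('a, nat \<Rightarrow> 'k) module \<Rightarrow> enat" where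
  "proj_dim A M = Inf {enat n | n. \<exists>P d. projective_resolution A M n P d}"

text \<open>
  A resolution \<open>0 \<rightarrow> M \<rightarrow> E 0 \<rightarrow> E 1 \<rightarrow> \<dots>\<close> with augmentation \<open>\<epsilon>\<close> and \<open>d i : E i \<rightarrow> E (Suc i)\<close>.
  Minimality means that \<open>E 0\<close> is an injective envelope of \<open>M\<close> and \<open>E (Suc i)\<close> is one of the image
  of \<open>d i\<close>.
\<close>

definition minimal_injective_resolution ::
  "('k, 'a) module \<Rightarrow> ('a, 'b) module \<Rightarrow> (nat \<Rightarrow> ('a, nat \<Rightarrow> 'k) module) \<Rightarrow>
   ('b \<Rightarrow> (nat \<Rightarrow> 'k)) \<Rightarrow> (nat \<Rightarrow> (nat \<Rightarrow> 'k) \<Rightarrow> (nat \<Rightarrow> 'k)) \<Rightarrow> bool" where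
  "minimal_injective_resolution A M E \<epsilon> d \<longleftrightarrow>
    (\<forall>i. injective_module A (E i)) \<and>
    \<epsilon> \<in> module_homs A M (E 0) \<and>
    (\<forall>i. d i \<in> module_homs A (E i) (E (Suc i))) \<and>
    inj_on \<epsilon> (carrier M) \<and>
    exact_at M \<epsilon> (E 0) (d 0) (E 1) \<and>
    (\<forall>i. exact_at (E i) (d i) (E (Suc i)) (d (Suc i)) (E (Suc (Suc i)))) \<and>
    essential_submodule A (\<epsilon> ` carrier M) (E 0) \<and>
    (\<forall>i. essential_submodule A (d i ` carrier (E i)) (E (Suc i)))"

text \<open>
  Minimal injective resolutions are unique up to isomorphism, so it does not matter which one is
  taken; the existential form is never satisfied vacuously.
\<close>

definition gorenstein :: "nat \<Rightarrow> ('k, 'a) module \<Rightarrow> bool" where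
  "gorenstein m A \<longleftrightarrow>
    (\<exists>E \<epsilon> d. minimal_injective_resolution A (regular_module A) E \<epsilon> d \<and>
      (\<forall>i<m. proj_dim A (E i) \<le> enat i))"


section \<open>Nakayama algebras\<close>

definition linear_quiver :: "nat \<Rightarrow> (nat, nat) pre_digraph" where
  "linear_quiver N = \<lparr>verts = {1..N}, arcs = {1..<N}, tail = (\<lambda>i. i), head = Suc\<rparr>"

definition cyclic_quiver :: "nat \<Rightarrow> (nat, nat) pre_digraph" where
  "cyclic_quiver N =
    \<lparr>verts = {1..N}, arcs = {1..N}, tail = (\<lambda>i. i), head = (\<lambda>i. if i = N then 1 else Suc i)\<rparr>"

definition nakayama_algebra :: "('k::field, ((nat, nat) path \<Rightarrow> 'k) set) module \<Rightarrow> bool" where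
  "nakayama_algebra A \<longleftrightarrow>
    fd_module A (regular_module A) \<and>
    (\<exists>N\<ge>1. \<exists>Q \<in> {linear_quiver N, cyclic_quiver N}. \<exists>I.
      admissible_ideal Q I \<and> A = quotient_algebra (path_algebra Q) I)"

end

theory Submission
  imports Defs "HOL-Library.Function_Algebras"
begin

text \<open>
  Over a Nakayama algebra, write a uniserial module as an interval \<open>[a, b)\<close> of vertices from its top to
  its socle, and let \<open>M\<close> be the cosyzygy of degree \<open>2 n\<close> of the regular module, so that \<open>I\<^sup>2\<^sup>n\<close> is the injective
  envelope of \<open>M\<close>. Shifting along the injective resolution, the assumption on \<open>I\<^sup>0, \<dots>\<close> below degree
  \<open>2 n\<close> shows that \<open>M\<close> has projective dimension at most \<open>2 n\<close>. No nonzero submodule \<open>X\<close> of \<open>M\<close> has smaller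
  projective dimension: otherwise the inclusion of \<open>X\<close> into \<open>M\<close> would lift to the preceding injective
  module, and the image of the lift would meet an essential submodule trivially.

  Every uniserial summand \<open>[c, b)\<close> of \<open>I\<^sup>2\<^sup>n\<close> has its socle in \<open>M\<close>, and a vector of \<open>M\<close> of maximal height over
  this socle generates a summand \<open>[a, b)\<close> of \<open>M\<close> with \<open>c \<le> a\<close>. It has projective dimension exactly \<open>2 n\<close>.
  The syzygies of intervals are intervals which are computed by a monotone function, and
  comparing those of \<open>[a, b)\<close> and \<open>[c, b)\<close> gives projective dimension at most \<open>2 n\<close> for \<open>[c, b)\<close>.
\<close>

section \<open>Right modules over an algebra\<close>

text \<open>The even degree is decisive. Let f be \<open>proj_end\<close>. The syzygy of degree 2j
  of [a,b) is [f^j(a), f^j(b)), so [a,b) and [c,b) have even syzygies with the same right end.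
  Projective dimension exactly 2n forces f^(n+1)(a) = f^n(b), and f^n(b) <= f^(n+1)(c) <= f^(n+1)(a)
  then makes the syzygy of [c,b) projective too. The analogous odd condition f^(n+1)(a) = f^(n+1)(b)
  says nothing about a smaller c. Ext is replaced by lifting problems along an injective
  coresolution, and projective dimension by a recursion over syzygies. The way back from vanishing
  Ext to projective dimension tests against the syzygy itself, so it needs a coresolution of that
  syzygy; this is built explicitly for uniserial modules. Therefore uniserial summands are split off
  one at a time, each by a linear functional that is 1 on the socle. Intervals live in the natural
  numbers; adding multiples of \<open>N\<close> leaves room for subtraction.\<close>

locale kalgebra = A?: ring A for A :: "('k::field, 'a) module" (structure) +
  assumes sc_closed [simp]: "c \<odot> \<one> \<in> carrier A"
    and sc_add: "(c + d) \<odot> \<one> = c \<odot> \<one> \<oplus> d \<odot> \<one>"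
    and sc_mult: "(c * d) \<odot> \<one> = (c \<odot> \<one>) \<otimes> (d \<odot> \<one>)"
    and sc_one [simp]: "1 \<odot> \<one> = \<one>"
    and sc_comm: "a \<in> carrier A \<Longrightarrow> (c \<odot> \<one>) \<otimes> a = a \<otimes> (c \<odot> \<one>)"
begin

text \<open>Scalars act on modules through these central elements, the same convention as in
  \<open>fd_module\<close>.\<close>

definition sc :: "'k \<Rightarrow> 'a" where "sc c = c \<odot> \<one>"

lemma sc_cl [simp]: "sc c \<in> carrier A" by (simp add: sc_def)

abbreviation rmod :: "('a, 'b) module \<Rightarrow> bool" where "rmod M \<equiv> right_module A M"
abbreviation homs :: "('a, 'b) module \<Rightarrow> ('a, 'c) module \<Rightarrow> ('b \<Rightarrow> 'c) set"
  where "homs M N \<equiv> module_homs A M N"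
abbreviation fd :: "('a, 'b) module \<Rightarrow> bool" where "fd M \<equiv> fd_module A M"
abbreviation smod :: "'b set \<Rightarrow> ('a, 'b) module \<Rightarrow> bool" where "smod T M \<equiv> submodule T A M"

lemma fd_rmod [simp]: "fd M \<Longrightarrow> rmod M" by (simp add: fd_module_def)

lemma rmod_ab: "rmod M \<Longrightarrow> abelian_group M"
  by (simp add: right_module_def)

lemma rmod_abm: "rmod M \<Longrightarrow> abelian_monoid M"
  by (simp add: rmod_ab abelian_group.axioms)

context
  fixes M :: "('a, 'b) module"
  assumes M: "rmod M"
begin

lemma madd_cl [simp]: "x \<in> carrier M \<Longrightarrow> y \<in> carrier M \<Longrightarrow> x \<oplus>\<^bsub>M\<^esub> y \<in> carrier M"
  using abelian_monoid.a_closed[OF rmod_abm[OF M]] .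
lemma mzero_cl [simp]: "\<zero>\<^bsub>M\<^esub> \<in> carrier M"
  using abelian_monoid.zero_closed[OF rmod_abm[OF M]] .
lemma mneg_cl [simp]: "x \<in> carrier M \<Longrightarrow> \<ominus>\<^bsub>M\<^esub> x \<in> carrier M"
  using abelian_group.a_inv_closed[OF rmod_ab[OF M]] .
lemma mminus_cl [simp]: "x \<in> carrier M \<Longrightarrow> y \<in> carrier M \<Longrightarrow> x \<ominus>\<^bsub>M\<^esub> y \<in> carrier M"
  using abelian_group.minus_closed[OF rmod_ab[OF M]] .
lemma ml_zero [simp]: "x \<in> carrier M \<Longrightarrow> \<zero>\<^bsub>M\<^esub> \<oplus>\<^bsub>M\<^esub> x = x"
  using abelian_monoid.l_zero[OF rmod_abm[OF M]] .
lemma mr_zero [simp]: "x \<in> carrier M \<Longrightarrow> x \<oplus>\<^bsub>M\<^esub> \<zero>\<^bsub>M\<^esub> = x"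
  using abelian_monoid.r_zero[OF rmod_abm[OF M]] .
lemma madd_assoc: "x \<in> carrier M \<Longrightarrow> y \<in> carrier M \<Longrightarrow> z \<in> carrier M \<Longrightarrow>
    (x \<oplus>\<^bsub>M\<^esub> y) \<oplus>\<^bsub>M\<^esub> z = x \<oplus>\<^bsub>M\<^esub> (y \<oplus>\<^bsub>M\<^esub> z)"
  using abelian_monoid.a_assoc[OF rmod_abm[OF M]] .
lemma madd_comm: "x \<in> carrier M \<Longrightarrow> y \<in> carrier M \<Longrightarrow> x \<oplus>\<^bsub>M\<^esub> y = y \<oplus>\<^bsub>M\<^esub> x"
  using abelian_monoid.a_comm[OF rmod_abm[OF M]] .
lemma madd_lcomm: "x \<in> carrier M \<Longrightarrow> y \<in> carrier M \<Longrightarrow> z \<in> carrier M \<Longrightarrow>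
    x \<oplus>\<^bsub>M\<^esub> (y \<oplus>\<^bsub>M\<^esub> z) = y \<oplus>\<^bsub>M\<^esub> (x \<oplus>\<^bsub>M\<^esub> z)"
  using abelian_monoid.a_lcomm[OF rmod_abm[OF M]] .
lemmas madd_ac = madd_assoc madd_comm madd_lcomm
lemma mr_neg [simp]: "x \<in> carrier M \<Longrightarrow> x \<oplus>\<^bsub>M\<^esub> \<ominus>\<^bsub>M\<^esub> x = \<zero>\<^bsub>M\<^esub>"
  using abelian_group.r_neg[OF rmod_ab[OF M]] .
lemma ml_neg [simp]: "x \<in> carrier M \<Longrightarrow> \<ominus>\<^bsub>M\<^esub> x \<oplus>\<^bsub>M\<^esub> x = \<zero>\<^bsub>M\<^esub>"
  using abelian_group.l_neg[OF rmod_ab[OF M]] .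
lemma mneg_add: "x \<in> carrier M \<Longrightarrow> y \<in> carrier M \<Longrightarrow> \<ominus>\<^bsub>M\<^esub> (x \<oplus>\<^bsub>M\<^esub> y) = \<ominus>\<^bsub>M\<^esub> x \<oplus>\<^bsub>M\<^esub> \<ominus>\<^bsub>M\<^esub> y"
  using abelian_group.minus_add[OF rmod_ab[OF M]] .
lemma mneg_neg [simp]: "x \<in> carrier M \<Longrightarrow> \<ominus>\<^bsub>M\<^esub> (\<ominus>\<^bsub>M\<^esub> x) = x"
  using abelian_group.minus_minus[OF rmod_ab[OF M]] .
lemma mneg_zero [simp]: "\<ominus>\<^bsub>M\<^esub> \<zero>\<^bsub>M\<^esub> = \<zero>\<^bsub>M\<^esub>"
  by (metis ml_zero mneg_cl mr_neg mzero_cl)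
lemma mminus_eq: "x \<ominus>\<^bsub>M\<^esub> y = x \<oplus>\<^bsub>M\<^esub> \<ominus>\<^bsub>M\<^esub> y"
  by (simp add: a_minus_def)
lemma mminus_self [simp]: "x \<in> carrier M \<Longrightarrow> x \<ominus>\<^bsub>M\<^esub> x = \<zero>\<^bsub>M\<^esub>"
  by (simp add: mminus_eq)
lemma mminus_zero [simp]: "x \<in> carrier M \<Longrightarrow> x \<ominus>\<^bsub>M\<^esub> \<zero>\<^bsub>M\<^esub> = x"
  by (simp add: mminus_eq)
lemma mr_neg2: "x \<in> carrier M \<Longrightarrow> y \<in> carrier M \<Longrightarrow> \<ominus>\<^bsub>M\<^esub> x \<oplus>\<^bsub>M\<^esub> (x \<oplus>\<^bsub>M\<^esub> y) = y"
  by (simp add: madd_assoc[symmetric])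
lemma mminus_add_cancel [simp]: "x \<in> carrier M \<Longrightarrow> y \<in> carrier M \<Longrightarrow> (x \<ominus>\<^bsub>M\<^esub> y) \<oplus>\<^bsub>M\<^esub> y = x"
  by (simp add: mminus_eq madd_assoc)
lemma madd_minus_cancel [simp]: "x \<in> carrier M \<Longrightarrow> y \<in> carrier M \<Longrightarrow> y \<oplus>\<^bsub>M\<^esub> (x \<ominus>\<^bsub>M\<^esub> y) = x"
  by (metis madd_comm mminus_add_cancel mminus_cl)
lemma mminus_0_iff: "x \<in> carrier M \<Longrightarrow> y \<in> carrier M \<Longrightarrow> x \<ominus>\<^bsub>M\<^esub> y = \<zero>\<^bsub>M\<^esub> \<longleftrightarrow> x = y"
  by (metis mminus_add_cancel mminus_self ml_zero)
lemma madd_cancel: "x \<in> carrier M \<Longrightarrow> y \<in> carrier M \<Longrightarrow> z \<in> carrier M \<Longrightarrow>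
    x \<oplus>\<^bsub>M\<^esub> y = x \<oplus>\<^bsub>M\<^esub> z \<longleftrightarrow> y = z"
  by (metis mr_neg2)
lemma mneg_unique: "x \<oplus>\<^bsub>M\<^esub> y = \<zero>\<^bsub>M\<^esub> \<Longrightarrow> x \<in> carrier M \<Longrightarrow> y \<in> carrier M \<Longrightarrow> y = \<ominus>\<^bsub>M\<^esub> x"
  by (metis mneg_cl mr_neg madd_cancel)
lemma mminus_add_add: "x \<in> carrier M \<Longrightarrow> y \<in> carrier M \<Longrightarrow> z \<in> carrier M \<Longrightarrow> w \<in> carrier M \<Longrightarrow>
    (x \<oplus>\<^bsub>M\<^esub> y) \<ominus>\<^bsub>M\<^esub> (z \<oplus>\<^bsub>M\<^esub> w) = (x \<ominus>\<^bsub>M\<^esub> z) \<oplus>\<^bsub>M\<^esub> (y \<ominus>\<^bsub>M\<^esub> w)"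
  by (simp add: mminus_eq mneg_add madd_ac)
lemma madd_add_add: "x \<in> carrier M \<Longrightarrow> y \<in> carrier M \<Longrightarrow> z \<in> carrier M \<Longrightarrow> w \<in> carrier M \<Longrightarrow>
    (x \<oplus>\<^bsub>M\<^esub> y) \<oplus>\<^bsub>M\<^esub> (z \<oplus>\<^bsub>M\<^esub> w) = (x \<oplus>\<^bsub>M\<^esub> z) \<oplus>\<^bsub>M\<^esub> (y \<oplus>\<^bsub>M\<^esub> w)"
  by (simp add: madd_ac)

lemma sm_cl [simp]: "a \<in> carrier A \<Longrightarrow> x \<in> carrier M \<Longrightarrow> a \<odot>\<^bsub>M\<^esub> x \<in> carrier M"
  using right_module.smult_closed[OF M] .
lemma sm_addl: "a \<in> carrier A \<Longrightarrow> b \<in> carrier A \<Longrightarrow> x \<in> carrier M \<Longrightarrow>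
    (a \<oplus> b) \<odot>\<^bsub>M\<^esub> x = a \<odot>\<^bsub>M\<^esub> x \<oplus>\<^bsub>M\<^esub> b \<odot>\<^bsub>M\<^esub> x"
  using right_module.smult_l_distr[OF M] .
lemma sm_addr: "a \<in> carrier A \<Longrightarrow> x \<in> carrier M \<Longrightarrow> y \<in> carrier M \<Longrightarrow>
    a \<odot>\<^bsub>M\<^esub> (x \<oplus>\<^bsub>M\<^esub> y) = a \<odot>\<^bsub>M\<^esub> x \<oplus>\<^bsub>M\<^esub> a \<odot>\<^bsub>M\<^esub> y"
  using right_module.smult_r_distr[OF M] .
lemma sm_mult: "a \<in> carrier A \<Longrightarrow> b \<in> carrier A \<Longrightarrow> x \<in> carrier M \<Longrightarrow>
    (a \<otimes> b) \<odot>\<^bsub>M\<^esub> x = b \<odot>\<^bsub>M\<^esub> (a \<odot>\<^bsub>M\<^esub> x)"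
  using right_module.smult_assoc[OF M] .
lemma sm_one [simp]: "x \<in> carrier M \<Longrightarrow> \<one> \<odot>\<^bsub>M\<^esub> x = x"
  using right_module.smult_one[OF M] .
lemma sm_zeror [simp]: "a \<in> carrier A \<Longrightarrow> a \<odot>\<^bsub>M\<^esub> \<zero>\<^bsub>M\<^esub> = \<zero>\<^bsub>M\<^esub>"
  by (metis madd_cancel mr_zero mzero_cl sm_addr sm_cl)
lemma sm_zerol [simp]: "x \<in> carrier M \<Longrightarrow> \<zero> \<odot>\<^bsub>M\<^esub> x = \<zero>\<^bsub>M\<^esub>"
  by (metis A.r_zero A.zero_closed madd_cancel mr_zero mzero_cl sm_addl sm_cl)
lemma sm_negr: "a \<in> carrier A \<Longrightarrow> x \<in> carrier M \<Longrightarrow> a \<odot>\<^bsub>M\<^esub> (\<ominus>\<^bsub>M\<^esub> x) = \<ominus>\<^bsub>M\<^esub> (a \<odot>\<^bsub>M\<^esub> x)"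
  by (rule mneg_unique) (simp_all add: sm_addr[symmetric])
lemma sm_negl: "a \<in> carrier A \<Longrightarrow> x \<in> carrier M \<Longrightarrow> (\<ominus> a) \<odot>\<^bsub>M\<^esub> x = \<ominus>\<^bsub>M\<^esub> (a \<odot>\<^bsub>M\<^esub> x)"
  by (rule mneg_unique) (simp_all add: sm_addl[symmetric] A.r_neg)
lemma sm_minusr: "a \<in> carrier A \<Longrightarrow> x \<in> carrier M \<Longrightarrow> y \<in> carrier M \<Longrightarrow>
    a \<odot>\<^bsub>M\<^esub> (x \<ominus>\<^bsub>M\<^esub> y) = a \<odot>\<^bsub>M\<^esub> x \<ominus>\<^bsub>M\<^esub> a \<odot>\<^bsub>M\<^esub> y"
  by (simp add: mminus_eq sm_addr sm_negr)
lemma sm_neg1: "x \<in> carrier M \<Longrightarrow> (\<ominus> \<one>) \<odot>\<^bsub>M\<^esub> x = \<ominus>\<^bsub>M\<^esub> x"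
  by (simp add: sm_negl)
lemma sc_sm_comm: "a \<in> carrier A \<Longrightarrow> x \<in> carrier M \<Longrightarrow> a \<odot>\<^bsub>M\<^esub> (sc c \<odot>\<^bsub>M\<^esub> x) = sc c \<odot>\<^bsub>M\<^esub> (a \<odot>\<^bsub>M\<^esub> x)"
  by (metis sc_cl sc_def sc_comm sm_mult)

end

lemma sc_plus: "sc (c + d) = sc c \<oplus> sc d" by (simp add: sc_def sc_add)
lemma sc_times: "sc (c * d) = sc c \<otimes> sc d" by (simp add: sc_def sc_mult)
lemma sc_1 [simp]: "sc 1 = \<one>" by (simp add: sc_def)
lemma sc_0 [simp]: "sc 0 = \<zero>"
  by (metis A.add.r_cancel_one' add.right_neutral sc_cl sc_plus)
lemma sc_sm_plus: "rmod M \<Longrightarrow> x \<in> carrier M \<Longrightarrow> sc (c + d) \<odot>\<^bsub>M\<^esub> x = sc c \<odot>\<^bsub>M\<^esub> x \<oplus>\<^bsub>M\<^esub> sc d \<odot>\<^bsub>M\<^esub> x"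
  by (simp add: sc_plus sm_addl)
lemma sc_sm_times: "rmod M \<Longrightarrow> x \<in> carrier M \<Longrightarrow> sc (c * d) \<odot>\<^bsub>M\<^esub> x = sc c \<odot>\<^bsub>M\<^esub> (sc d \<odot>\<^bsub>M\<^esub> x)"
  by (metis sc_times sm_mult sc_cl sc_sm_comm)
lemma sc_sm_eq_0: "rmod M \<Longrightarrow> x \<in> carrier M \<Longrightarrow> sc c \<odot>\<^bsub>M\<^esub> x = \<zero>\<^bsub>M\<^esub> \<Longrightarrow> c \<noteq> 0 \<Longrightarrow> x = \<zero>\<^bsub>M\<^esub>"
  by (metis left_inverse sc_1 sc_cl sc_sm_times sm_one sm_zeror)

lemma rmodI:
  assumes "abelian_group M"
    and "\<And>a x. a \<in> carrier A \<Longrightarrow> x \<in> carrier M \<Longrightarrow> a \<odot>\<^bsub>M\<^esub> x \<in> carrier M"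
    and "\<And>a b x. a \<in> carrier A \<Longrightarrow> b \<in> carrier A \<Longrightarrow> x \<in> carrier M \<Longrightarrow>
        (a \<oplus> b) \<odot>\<^bsub>M\<^esub> x = a \<odot>\<^bsub>M\<^esub> x \<oplus>\<^bsub>M\<^esub> b \<odot>\<^bsub>M\<^esub> x"
    and "\<And>a x y. a \<in> carrier A \<Longrightarrow> x \<in> carrier M \<Longrightarrow> y \<in> carrier M \<Longrightarrow>
        a \<odot>\<^bsub>M\<^esub> (x \<oplus>\<^bsub>M\<^esub> y) = a \<odot>\<^bsub>M\<^esub> x \<oplus>\<^bsub>M\<^esub> a \<odot>\<^bsub>M\<^esub> y"
    and "\<And>a b x. a \<in> carrier A \<Longrightarrow> b \<in> carrier A \<Longrightarrow> x \<in> carrier M \<Longrightarrow>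
        (a \<otimes> b) \<odot>\<^bsub>M\<^esub> x = b \<odot>\<^bsub>M\<^esub> (a \<odot>\<^bsub>M\<^esub> x)"
    and "\<And>x. x \<in> carrier M \<Longrightarrow> \<one> \<odot>\<^bsub>M\<^esub> x = x"
  shows "rmod M"
  unfolding right_module_def right_module_axioms_def using assms A.ring_axioms by blast

section \<open>Homomorphisms\<close>

lemma homsI:
  assumes "\<And>x. x \<in> carrier M \<Longrightarrow> f x \<in> carrier N"
    and "\<And>x y. x \<in> carrier M \<Longrightarrow> y \<in> carrier M \<Longrightarrow> f (x \<oplus>\<^bsub>M\<^esub> y) = f x \<oplus>\<^bsub>N\<^esub> f y"
    and "\<And>a x. a \<in> carrier A \<Longrightarrow> x \<in> carrier M \<Longrightarrow> f (a \<odot>\<^bsub>M\<^esub> x) = a \<odot>\<^bsub>N\<^esub> f x"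
  shows "f \<in> homs M N"
  using assms by (auto simp: module_homs_def hom_def)

lemma homs_cl [simp]: "f \<in> homs M N \<Longrightarrow> x \<in> carrier M \<Longrightarrow> f x \<in> carrier N"
  by (auto simp: module_homs_def hom_def)
lemma homs_add: "f \<in> homs M N \<Longrightarrow> x \<in> carrier M \<Longrightarrow> y \<in> carrier M \<Longrightarrow> f (x \<oplus>\<^bsub>M\<^esub> y) = f x \<oplus>\<^bsub>N\<^esub> f y"
  by (auto simp: module_homs_def hom_def simp del: homs_cl)
lemma homs_sm: "f \<in> homs M N \<Longrightarrow> a \<in> carrier A \<Longrightarrow> x \<in> carrier M \<Longrightarrow> f (a \<odot>\<^bsub>M\<^esub> x) = a \<odot>\<^bsub>N\<^esub> f x"
  by (auto simp: module_homs_def hom_def simp del: homs_cl)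
lemma homs_zero: "rmod M \<Longrightarrow> rmod N \<Longrightarrow> f \<in> homs M N \<Longrightarrow> f \<zero>\<^bsub>M\<^esub> = \<zero>\<^bsub>N\<^esub>"
  by (metis A.zero_closed homs_cl homs_sm mzero_cl sm_zerol)
lemma homs_neg: "rmod M \<Longrightarrow> rmod N \<Longrightarrow> f \<in> homs M N \<Longrightarrow> x \<in> carrier M \<Longrightarrow> f (\<ominus>\<^bsub>M\<^esub> x) = \<ominus>\<^bsub>N\<^esub> f x"
  using homs_sm[of f M N "\<ominus> \<one>" x] by (simp add: sm_neg1 homs_cl)
lemma homs_minus: "rmod M \<Longrightarrow> rmod N \<Longrightarrow> f \<in> homs M N \<Longrightarrow> x \<in> carrier M \<Longrightarrow> y \<in> carrier M \<Longrightarrow>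
    f (x \<ominus>\<^bsub>M\<^esub> y) = f x \<ominus>\<^bsub>N\<^esub> f y"
  by (simp add: mminus_eq homs_cl homs_add homs_neg)
lemma homs_comp: "f \<in> homs M N \<Longrightarrow> g \<in> homs N P \<Longrightarrow> (\<lambda>x. g (f x)) \<in> homs M P"
  by (rule homsI) (simp_all add: homs_cl homs_add homs_sm)
lemma homs_diff: "rmod N \<Longrightarrow> f \<in> homs M N \<Longrightarrow> g \<in> homs M N \<Longrightarrow> (\<lambda>x. f x \<ominus>\<^bsub>N\<^esub> g x) \<in> homs M N"
  by (rule homsI) (simp_all add: homs_cl homs_add homs_sm mminus_add_add sm_minusr)
lemma homs_sum: "rmod N \<Longrightarrow> f \<in> homs M N \<Longrightarrow> g \<in> homs M N \<Longrightarrow> (\<lambda>x. f x \<oplus>\<^bsub>N\<^esub> g x) \<in> homs M N"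
  by (rule homsI) (simp_all add: homs_cl homs_add homs_sm madd_add_add sm_addr)
lemma homs_id [simp]: "(\<lambda>x. x) \<in> homs M M"
  by (rule homsI) auto
lemma homs_0: "rmod N \<Longrightarrow> (\<lambda>x. \<zero>\<^bsub>N\<^esub>) \<in> homs M N"
  by (rule homsI) auto
lemma homs_inj_iff: "rmod M \<Longrightarrow> rmod N \<Longrightarrow> f \<in> homs M N \<Longrightarrow>
    inj_on f (carrier M) \<longleftrightarrow> (\<forall>x\<in>carrier M. f x = \<zero>\<^bsub>N\<^esub> \<longrightarrow> x = \<zero>\<^bsub>M\<^esub>)"
  by (smt (verit, best) homs_cl homs_minus homs_zero inj_on_def mminus_0_iff mminus_cl mzero_cl)
section \<open>Submodules\<close>

lemma smodI:
  assumes M: "rmod M" and T: "T \<subseteq> carrier M" "\<zero>\<^bsub>M\<^esub> \<in> T"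
    "\<And>x y. x \<in> T \<Longrightarrow> y \<in> T \<Longrightarrow> x \<oplus>\<^bsub>M\<^esub> y \<in> T"
    "\<And>a x. a \<in> carrier A \<Longrightarrow> x \<in> T \<Longrightarrow> a \<odot>\<^bsub>M\<^esub> x \<in> T"
  shows "smod T M"
proof -
  have "\<ominus>\<^bsub>M\<^esub> x \<in> T" if "x \<in> T" for x
    using T that by (metis A.a_inv_closed A.one_closed M sm_neg1 subsetD)
  then show ?thesis
    using T by (auto intro!: submodule.intro subgroup.intro simp: submodule_axioms_def a_inv_def)
qed

lemma smod_sub: "smod T M \<Longrightarrow> T \<subseteq> carrier M"
  by (simp add: submodule_def subgroup_def)
lemma smod_in: "smod T M \<Longrightarrow> x \<in> T \<Longrightarrow> x \<in> carrier M"
  using smod_sub by blast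
lemma smod_zero [simp]: "smod T M \<Longrightarrow> \<zero>\<^bsub>M\<^esub> \<in> T"
  by (simp add: submodule_def subgroup_def)
lemma smod_add [simp]: "smod T M \<Longrightarrow> x \<in> T \<Longrightarrow> y \<in> T \<Longrightarrow> x \<oplus>\<^bsub>M\<^esub> y \<in> T"
  using subgroup.m_closed[OF submodule.axioms(1), of T A M x y] by simp
lemma smod_sm [simp]: "smod T M \<Longrightarrow> a \<in> carrier A \<Longrightarrow> x \<in> T \<Longrightarrow> a \<odot>\<^bsub>M\<^esub> x \<in> T"
  using submodule.smult_closed[of T A M a x] by simp
lemma smod_neg [simp]: "smod T M \<Longrightarrow> x \<in> T \<Longrightarrow> \<ominus>\<^bsub>M\<^esub> x \<in> T"
  unfolding a_inv_def by (metis subgroup.m_inv_closed submodule.axioms(1))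
lemma smod_minus [simp]: "smod T M \<Longrightarrow> x \<in> T \<Longrightarrow> y \<in> T \<Longrightarrow> x \<ominus>\<^bsub>M\<^esub> y \<in> T"
  by (simp add: a_minus_def)
lemma smod_carrier [simp]: "rmod M \<Longrightarrow> smod (carrier M) M"
  by (rule smodI) auto
lemma smod_0 [simp]: "rmod M \<Longrightarrow> smod {\<zero>\<^bsub>M\<^esub>} M"
  by (rule smodI) auto

text \<open>Only the carrier shrinks, so inclusions are the identity function and chains of
  submodules stay inside one type.\<close>

definition restr :: "('a, 'b) module \<Rightarrow> 'b set \<Rightarrow> ('a, 'b) module"
  where "restr M T = M\<lparr>carrier := T\<rparr>"

lemma restr_simps [simp]: "carrier (restr M T) = T" "zero (restr M T) = zero M" "add (restr M T) = add M"
    "smult (restr M T) = smult M" "restr (restr M T) U = restr M U" "restr M (carrier M) = M"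
  by (simp_all add: restr_def)

lemma restr_rmod [simp]:
  assumes M: "rmod M" and S: "smod T M" shows "rmod (restr M T)"
proof (rule rmodI)
  have T: "x \<in> carrier M" if "x \<in> T" for x using S that by (rule smod_in)
  show "abelian_group (restr M T)"
  proof (rule abelian_groupI)
    fix x assume x: "x \<in> carrier (restr M T)"
    show "\<exists>y\<in>carrier (restr M T). y \<oplus>\<^bsub>restr M T\<^esub> x = \<zero>\<^bsub>restr M T\<^esub>"
      using x M S T by (intro bexI[of _ "\<ominus>\<^bsub>M\<^esub> x"]) auto
  qed (use M S T in \<open>simp_all add: madd_ac\<close>)
qed (use M S in \<open>auto simp: sm_addl sm_addr sm_mult smod_in\<close>)

lemma restr_neg [simp]: "rmod M \<Longrightarrow> smod T M \<Longrightarrow> x \<in> T \<Longrightarrow> \<ominus>\<^bsub>restr M T\<^esub> x = \<ominus>\<^bsub>M\<^esub> x"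
  using sm_neg1[of "restr M T" x] sm_neg1[of M x] by (simp add: smod_in)
lemma restr_minus [simp]: "rmod M \<Longrightarrow> smod T M \<Longrightarrow> y \<in> T \<Longrightarrow> x \<ominus>\<^bsub>restr M T\<^esub> y = x \<ominus>\<^bsub>M\<^esub> y"
  by (simp add: a_minus_def)

lemma homs_restr_incl: "smod T M \<Longrightarrow> (\<lambda>x. x) \<in> homs (restr M T) M"
  by (rule homsI) (auto simp: smod_in)
lemma homs_restr_dom: "f \<in> homs M N \<Longrightarrow> smod T M \<Longrightarrow> f \<in> homs (restr M T) N"
  by (rule homsI) (auto simp: homs_cl homs_add homs_sm smod_in)
lemma homs_restr_cod: "f \<in> homs M N \<Longrightarrow> (\<And>x. x \<in> carrier M \<Longrightarrow> f x \<in> T) \<Longrightarrow> f \<in> homs M (restr N T)"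
  by (rule homsI) (auto simp: homs_cl homs_add homs_sm)
lemma homs_restr_cod_incl:
  assumes "f \<in> homs M (restr N T)" "T \<subseteq> carrier N" shows "f \<in> homs M N"
proof (rule homsI)
  fix x assume "x \<in> carrier M"
  then have "f x \<in> carrier (restr N T)" by (rule homs_cl[OF assms(1)])
  then show "f x \<in> carrier N" using assms(2) by auto
qed (use homs_add[OF assms(1)] homs_sm[OF assms(1)] in auto)

lemma smod_restr_iff:
  assumes "smod T M" "rmod M" shows "smod U (restr M T) \<longleftrightarrow> smod U M \<and> U \<subseteq> T"
proof
  assume U: "smod U (restr M T)"
  have "smod U M"
    by (rule smodI) (use assms U smod_sub[OF U] smod_zero[OF U] smod_add[OF U] smod_sm[OF U] in \<open>auto simp: smod_in\<close>)
  then show "smod U M \<and> U \<subseteq> T" using smod_sub[OF U] by simp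
next
  assume "smod U M \<and> U \<subseteq> T"
  then show "smod U (restr M T)" by (intro smodI) (use assms in auto)
qed

definition ker :: "('a, 'b) module \<Rightarrow> ('a, 'c) module \<Rightarrow> ('b \<Rightarrow> 'c) \<Rightarrow> 'b set"
  where "ker M N f = {x \<in> carrier M. f x = \<zero>\<^bsub>N\<^esub>}"

lemma a_kernel_ker: "a_kernel M N f = ker M N f"
  by (simp add: ker_def a_kernel_def')

lemma ker_smod [simp]: "rmod M \<Longrightarrow> rmod N \<Longrightarrow> f \<in> homs M N \<Longrightarrow> smod (ker M N f) M"
  by (rule smodI) (auto simp: ker_def homs_zero homs_add homs_sm)
lemma ker_restr [simp]: "ker M (restr N T) f = ker M N f"
  by (simp add: ker_def)

lemma img_smod [simp]:
  assumes "rmod M" "rmod N" "f \<in> homs M N" shows "smod (f ` carrier M) N"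
proof (rule smodI)
  show "\<zero>\<^bsub>N\<^esub> \<in> f ` carrier M" using assms by (auto intro: image_eqI[OF homs_zero[symmetric]])
next
  fix x y assume "x \<in> f ` carrier M" "y \<in> f ` carrier M"
  then show "x \<oplus>\<^bsub>N\<^esub> y \<in> f ` carrier M"
    using assms by (auto simp: homs_add[OF assms(3), symmetric])
next
  fix a x assume "a \<in> carrier A" "x \<in> f ` carrier M"
  then show "a \<odot>\<^bsub>N\<^esub> x \<in> f ` carrier M"
    using assms by (auto simp: homs_sm[OF assms(3), symmetric])
qed (use assms in auto)

lemma factor_through:
  assumes M: "rmod M" and N: "rmod N" and X: "rmod X"
    and p: "p \<in> homs M N" "p ` carrier M = carrier N" and f: "f \<in> homs M X"
    and k: "\<And>x. x \<in> carrier M \<Longrightarrow> p x = \<zero>\<^bsub>N\<^esub> \<Longrightarrow> f x = \<zero>\<^bsub>X\<^esub>"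
  obtains g where "g \<in> homs N X" "\<And>x. x \<in> carrier M \<Longrightarrow> g (p x) = f x"
proof -
  define g where "g y = f (inv_into (carrier M) p y)" for y
  have g: "g (p x) = f x" if x: "x \<in> carrier M" for x
  proof -
    define z where "z = inv_into (carrier M) p (p x)"
    have z: "z \<in> carrier M" "p z = p x"
      using x by (auto simp: z_def inv_into_into f_inv_into_f)
    then have "p (z \<ominus>\<^bsub>M\<^esub> x) = \<zero>\<^bsub>N\<^esub>" using x M N p(1) by (simp add: homs_minus)
    then have "f (z \<ominus>\<^bsub>M\<^esub> x) = \<zero>\<^bsub>X\<^esub>" using x z M by (intro k) auto
    then have "f z = f x" using f x z M X by (simp add: homs_minus mminus_0_iff)
    then show ?thesis by (simp add: g_def z_def)
  qed
  have "g \<in> homs N X"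
  proof (rule homsI)
    fix y assume "y \<in> carrier N"
    then obtain x where "x \<in> carrier M" "y = p x" using p by blast
    then show "g y \<in> carrier X" using g f by simp
  next
    fix y y' assume "y \<in> carrier N" "y' \<in> carrier N"
    then obtain x x' where "x \<in> carrier M" "y = p x" "x' \<in> carrier M" "y' = p x'" using p by blast
    then show "g (y \<oplus>\<^bsub>N\<^esub> y') = g y \<oplus>\<^bsub>X\<^esub> g y'" using g f M by (simp add: homs_add[symmetric, OF p(1)] homs_add)
  next
    fix a y assume "a \<in> carrier A" "y \<in> carrier N"
    then obtain x where "a \<in> carrier A" "x \<in> carrier M" "y = p x" using p by blast
    then show "g (a \<odot>\<^bsub>N\<^esub> y) = a \<odot>\<^bsub>X\<^esub> g y" using g f M by (simp add: homs_sm[symmetric, OF p(1)] homs_sm)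
  qed
  then show ?thesis using g that by blast
qed

text \<open>
  The quotient \<open>M / T\<close> realised on the range of \<open>r\<close>; for \<open>T = 0\<close> this is a copy of \<open>M\<close> in another type.
\<close>

lemma transport_quotient:
  fixes M :: "('a, 'b) module" and r :: "'b \<Rightarrow> 'c"
  assumes M: "rmod M" and T: "smod T M"
    and r: "\<And>x y. x \<in> carrier M \<Longrightarrow> y \<in> carrier M \<Longrightarrow> r x = r y \<longleftrightarrow> x \<ominus>\<^bsub>M\<^esub> y \<in> T"
  obtains Q :: "('a, 'c) module" where "rmod Q" "r \<in> homs M Q" "carrier Q = r ` carrier M" "ker M Q r = T"
proof -
  define i where "i = inv_into (carrier M) r"
  define Q :: "('a, 'c) module" where "Q = \<lparr>carrier = r ` carrier M, mult = undefined, one = undefined,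
    zero = r \<zero>\<^bsub>M\<^esub>, add = (\<lambda>u v. r (i u \<oplus>\<^bsub>M\<^esub> i v)), smult = (\<lambda>a u. r (a \<odot>\<^bsub>M\<^esub> i u))\<rparr>"
  have i: "i (r x) \<in> carrier M" "i (r x) \<ominus>\<^bsub>M\<^esub> x \<in> T" if "x \<in> carrier M" for x
    using that r[of "i (r x)" x] by (auto simp: i_def inv_into_into f_inv_into_f)
  have add: "r x \<oplus>\<^bsub>Q\<^esub> r y = r (x \<oplus>\<^bsub>M\<^esub> y)" if "x \<in> carrier M" "y \<in> carrier M" for x y
    using that i[of x] i[of y] M T by (simp add: Q_def r mminus_add_add)
  have sm: "a \<odot>\<^bsub>Q\<^esub> r x = r (a \<odot>\<^bsub>M\<^esub> x)" if "x \<in> carrier M" "a \<in> carrier A" for a x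
    using that i[of x] M T by (simp add: Q_def r sm_minusr[symmetric])
  have c: "carrier Q = r ` carrier M" and z: "\<zero>\<^bsub>Q\<^esub> = r \<zero>\<^bsub>M\<^esub>" by (auto simp: Q_def)
  have "abelian_group Q"
  proof (rule abelian_groupI)
    fix u assume "u \<in> carrier Q"
    then obtain x where "x \<in> carrier M" "u = r x" using c by blast
    then show "\<exists>y\<in>carrier Q. y \<oplus>\<^bsub>Q\<^esub> u = \<zero>\<^bsub>Q\<^esub>"
      using M c z by (intro bexI[of _ "r (\<ominus>\<^bsub>M\<^esub> x)"]) (auto simp: add)
  qed (use M in \<open>auto simp: c z add madd_ac\<close>)
  then have Q: "rmod Q"
    by (rule rmodI) (use M in \<open>auto simp: c z add sm sm_addl sm_addr sm_mult\<close>)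
  have "r \<in> homs M Q" by (rule homsI) (auto simp: c add sm)
  moreover have "ker M Q r = T"
    using M T by (auto simp: ker_def z r dest: smod_in)
  ultimately show ?thesis using that Q c by blast
qed

text \<open>Chosen representatives realise the quotient inside the element type of \<open>M\<close>.
  A quotient of a module over \<open>nat \<Rightarrow> 'k\<close> thus stays in the type over which
  projectivity and injectivity quantify.\<close>

lemma quotient_module:
  fixes M :: "('a, 'b) module"
  assumes M: "rmod M" and T: "smod T M"
  obtains Q :: "('a, 'b) module" and p where "rmod Q" "p \<in> homs M Q" "p ` carrier M = carrier Q" "ker M Q p = T"
proof -
  define r where "r x = (SOME y. y \<in> carrier M \<and> y \<ominus>\<^bsub>M\<^esub> x \<in> T)" for x
  have rr: "r x \<in> carrier M \<and> r x \<ominus>\<^bsub>M\<^esub> x \<in> T" if "x \<in> carrier M" for x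
    unfolding r_def by (rule someI[of _ x]) (use that M T in auto)
  have tr: "x \<ominus>\<^bsub>M\<^esub> z \<in> T" if "x \<ominus>\<^bsub>M\<^esub> y \<in> T" "y \<ominus>\<^bsub>M\<^esub> z \<in> T" "x \<in> carrier M" "y \<in> carrier M" "z \<in> carrier M" for x y z
  proof -
    have "x \<ominus>\<^bsub>M\<^esub> z = (x \<ominus>\<^bsub>M\<^esub> y) \<oplus>\<^bsub>M\<^esub> (y \<ominus>\<^bsub>M\<^esub> z)"
      using that M by (simp add: mminus_eq madd_assoc mr_neg2)
    then show ?thesis using that T by simp
  qed
  have sy: "y \<ominus>\<^bsub>M\<^esub> x \<in> T" if "x \<ominus>\<^bsub>M\<^esub> y \<in> T" "x \<in> carrier M" "y \<in> carrier M" for x y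
  proof -
    have "y \<ominus>\<^bsub>M\<^esub> x = \<ominus>\<^bsub>M\<^esub> (x \<ominus>\<^bsub>M\<^esub> y)"
      using that M by (simp add: mminus_eq mneg_add madd_comm)
    then show ?thesis using that T by simp
  qed
  have "r x = r y \<longleftrightarrow> x \<ominus>\<^bsub>M\<^esub> y \<in> T" if "x \<in> carrier M" "y \<in> carrier M" for x y
  proof
    assume "r x = r y"
    then show "x \<ominus>\<^bsub>M\<^esub> y \<in> T" using rr[of x] rr[of y] that sy[of "r x" x] tr[of x "r x" y] by auto
  next
    assume "x \<ominus>\<^bsub>M\<^esub> y \<in> T"
    \<comment> \<open>Congruent elements have the same set of admissible representatives, so the
      choice operator returns the same one.\<close>
    then have "(\<lambda>z. z \<in> carrier M \<and> z \<ominus>\<^bsub>M\<^esub> x \<in> T) = (\<lambda>z. z \<in> carrier M \<and> z \<ominus>\<^bsub>M\<^esub> y \<in> T)"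
      using tr sy that by (intro ext) blast
    then show "r x = r y" by (simp add: r_def)
  qed
  from transport_quotient[OF M T this] obtain Q where "rmod Q" "r \<in> homs M Q" "carrier Q = r ` carrier M" "ker M Q r = T"
    by blast
  then show ?thesis using that by metis
qed

end

section \<open>Linear algebra\<close>

text \<open>Linear algebra takes place on coefficient functions and is carried to the record-based
  modules along \<open>lin_eval\<close>.\<close>

interpretation fvs: vector_space "\<lambda>(c::'k::field) (f::'b \<Rightarrow> 'k) x. c * f x"
  by unfold_locales (auto simp: fun_eq_iff algebra_simps)

lemma sum_app: "(\<Sum>b\<in>B. f b) x = (\<Sum>b\<in>B. f b (x :: 'c) :: 'd :: comm_monoid_add)"
  by (induction B rule: infinite_finite_induct) auto

text \<open>A basis of \<open>S'\<close> together with a vector of \<open>S\<close> outside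
  \<open>S'\<close> is still independent. The finite set \<open>U\<close> makes bases of
  \<open>S\<close> finite, so their size bounds this enlarged set.\<close>

lemma (in vector_space) dim_less:
  assumes S: "subspace S" "subspace S'" "S' \<subset> S" and U: "S \<subseteq> span U" "finite U"
  shows "dim S' < dim S"
proof -
  obtain C' where C': "C' \<subseteq> S'" "independent C'" "S' \<subseteq> span C'" "card C' = dim S'"
    using basis_exists by blast
  obtain C where C: "C \<subseteq> S" "independent C" "S \<subseteq> span C" "card C = dim S"
    using basis_exists by blast
  obtain w where w: "w \<in> S" "w \<notin> S'" using S by blast
  have "span C' \<subseteq> S'" using C' S by (simp add: span_minimal)
  then have "independent (insert w C')" using w C' by (intro independent_insertI) auto
  moreover have fin: "finite C"
    using independent_span_bound[OF U(2) C(2)] C U by blast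
  moreover have "insert w C' \<subseteq> span C" using w C C' S by blast
  ultimately have "finite (insert w C')" "card (insert w C') \<le> card C"
    using independent_span_bound[of C "insert w C'"] by simp_all
  moreover have "w \<notin> C'" using C' w by blast
  ultimately show ?thesis using C C' by simp
qed

context kalgebra
begin

text \<open>Closure under scalars only: the space on which the functional of
  \<open>socle_functional\<close> has to vanish is in general not stable under \<xi>.\<close>

definition ksub :: "('a, 'b) module \<Rightarrow> 'b set \<Rightarrow> bool" where
  "ksub M W \<longleftrightarrow> W \<subseteq> carrier M \<and> \<zero>\<^bsub>M\<^esub> \<in> W \<and> (\<forall>x\<in>W. \<forall>y\<in>W. x \<oplus>\<^bsub>M\<^esub> y \<in> W) \<and>
    (\<forall>c. \<forall>x\<in>W. sc c \<odot>\<^bsub>M\<^esub> x \<in> W)"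

lemma smod_ksub: "smod W M \<Longrightarrow> ksub M W"
  by (auto simp: ksub_def smod_in)

lemma ksub_vimage:
  assumes "ksub N W" "f \<in> homs M N" "rmod M" "rmod N"
  shows "ksub M {x \<in> carrier M. f x \<in> W}"
  using assms by (auto simp: ksub_def homs_add homs_sm homs_zero)

definition lin_eval :: "('a, 'b) module \<Rightarrow> 'b set \<Rightarrow> ('b \<Rightarrow> 'k) \<Rightarrow> 'b" where
  "lin_eval M B c = (\<Oplus>\<^bsub>M\<^esub>b\<in>B. sc (c b) \<odot>\<^bsub>M\<^esub> b)"

lemma lin_eval_empty: "rmod M \<Longrightarrow> lin_eval M {} c = \<zero>\<^bsub>M\<^esub>"
  by (simp add: lin_eval_def abelian_monoid.finsum_empty[OF rmod_abm])

lemma lin_eval_insert: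
  assumes "rmod M" "finite B" "insert b B \<subseteq> carrier M" "b \<notin> B"
  shows "lin_eval M (insert b B) c = sc (c b) \<odot>\<^bsub>M\<^esub> b \<oplus>\<^bsub>M\<^esub> lin_eval M B c"
  unfolding lin_eval_def
  by (rule abelian_monoid.finsum_insert[OF rmod_abm]) (use assms in auto)

lemma lin_eval_ksub:
  assumes M: "rmod M" and W: "ksub M W" and B: "finite B" "B \<subseteq> W"
  shows "lin_eval M B c \<in> W"
  using B
proof (induction B)
  case empty then show ?case using W M by (simp add: lin_eval_empty ksub_def)
next
  case (insert b B)
  then have "insert b B \<subseteq> carrier M" using W by (auto simp: ksub_def)
  then show ?case using insert W M by (auto simp: lin_eval_insert ksub_def)
qed

lemma ksub_carrier: "rmod M \<Longrightarrow> ksub M (carrier M)"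
  by (simp add: ksub_def)

lemma lin_eval_cl: "rmod M \<Longrightarrow> finite B \<Longrightarrow> B \<subseteq> carrier M \<Longrightarrow> lin_eval M B c \<in> carrier M"
  by (rule lin_eval_ksub) (auto simp: ksub_carrier)

lemma lin_eval_add:
  assumes "rmod M" "finite B" "B \<subseteq> carrier M"
  shows "lin_eval M B (c + d) = lin_eval M B c \<oplus>\<^bsub>M\<^esub> lin_eval M B d"
  using assms(2,3)
proof (induction B)
  case empty then show ?case using assms(1) by (simp add: lin_eval_empty)
next
  case (insert b B)
  then show ?case using assms(1) by (simp add: lin_eval_insert sc_sm_plus lin_eval_cl madd_ac)
qed

lemma lin_eval_scale:
  assumes "rmod M" "finite B" "B \<subseteq> carrier M"
  shows "lin_eval M B (\<lambda>b. k * c b) = sc k \<odot>\<^bsub>M\<^esub> lin_eval M B c"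
  using assms(2,3)
proof (induction B)
  case empty then show ?case using assms(1) by (simp add: lin_eval_empty)
next
  case (insert b B)
  then show ?case using assms(1) by (simp add: lin_eval_insert sc_sm_times lin_eval_cl sm_addr)
qed

lemma lin_eval_cong:
  assumes "rmod M" "finite B" "B \<subseteq> carrier M" "\<And>b. b \<in> B \<Longrightarrow> c b = d b"
  shows "lin_eval M B c = lin_eval M B d"
  using assms(2,3,4)
proof (induction B)
  case (insert b B)
  then show ?case using assms(1) by (simp add: lin_eval_insert)
qed (simp add: assms(1) lin_eval_empty)

lemma lin_eval_zero:
  assumes "rmod M" "finite B" "B \<subseteq> carrier M" shows "lin_eval M B 0 = \<zero>\<^bsub>M\<^esub>"
  using assms(2,3)
proof (induction B)
  case (insert b B)
  then show ?case using assms(1) by (simp add: lin_eval_insert)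
qed (simp add: assms(1) lin_eval_empty)

lemma lin_eval_unit:
  assumes "rmod M" "finite B" "B \<subseteq> carrier M" "b \<in> B"
  shows "lin_eval M B (\<lambda>x. if x = b then 1 else 0) = b"
proof -
  have *: "lin_eval M (B - {b}) (\<lambda>x. if x = b then 1 else 0) = \<zero>\<^bsub>M\<^esub>"
    using lin_eval_cong[of M "B - {b}" "\<lambda>x. if x = b then 1 else 0" 0] assms lin_eval_zero[of M "B - {b}"] by auto
  have "lin_eval M (insert b (B - {b})) (\<lambda>x. if x = b then 1 else 0) = b"
    by (subst lin_eval_insert) (use assms * in auto)
  then show ?thesis using assms by (simp add: insert_absorb)
qed

lemma fd_lin_eval: "fd M \<longleftrightarrow> rmod M \<and> (\<exists>B. finite B \<and> B \<subseteq> carrier M \<and> carrier M \<subseteq> range (lin_eval M B))"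
  unfolding fd_module_def lin_eval_def sc_def by (auto simp: subset_iff image_iff)

lemma fdE:
  assumes "fd M"
  obtains B where "finite B" "B \<subseteq> carrier M" "carrier M \<subseteq> range (lin_eval M B)"
  using assms by (auto simp: fd_lin_eval)

text \<open>The range of \<open>lin_eval\<close> is itself a subspace that contains
  \<open>B\<close>, so a test on all subspaces replaces explicit coefficients.\<close>

lemma fdI:
  assumes M: "rmod M" and B: "finite B" "B \<subseteq> carrier M"
    and W: "\<And>W. ksub M W \<Longrightarrow> B \<subseteq> W \<Longrightarrow> carrier M \<subseteq> W"
  shows "fd M"
proof -
  have "ksub M (range (lin_eval M B))"
    unfolding ksub_def
  proof (intro conjI ballI allI)
    show "\<zero>\<^bsub>M\<^esub> \<in> range (lin_eval M B)" using lin_eval_zero[OF M B] by (metis rangeI)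
    fix x assume "x \<in> range (lin_eval M B)"
    then obtain c where c: "x = lin_eval M B c" by blast
    show "sc k \<odot>\<^bsub>M\<^esub> x \<in> range (lin_eval M B)" for k
      using lin_eval_scale[OF M B] c by (metis rangeI)
    fix y assume "y \<in> range (lin_eval M B)"
    then obtain d where d: "y = lin_eval M B d" by blast
    show "x \<oplus>\<^bsub>M\<^esub> y \<in> range (lin_eval M B)"
      using lin_eval_add[OF M B] c d by (metis rangeI)
  qed (use lin_eval_cl[OF M B] in auto)
  moreover have "B \<subseteq> range (lin_eval M B)" using lin_eval_unit[OF M B] by (metis rangeI subsetI)
  ultimately have "carrier M \<subseteq> range (lin_eval M B)" by (rule W)
  then show ?thesis using M B by (auto simp: fd_lin_eval)
qed

lemma img_fd:
  assumes "fd M" "rmod N" "f \<in> homs M N" "f ` carrier M = carrier N"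
  shows "fd N"
proof -
  obtain B where B: "finite B" "B \<subseteq> carrier M" "carrier M \<subseteq> range (lin_eval M B)"
    using assms(1) by (rule fdE)
  show ?thesis
  proof (rule fdI[of _ "f ` B"])
    fix W assume W: "ksub N W" "f ` B \<subseteq> W"
    have "ksub M {x \<in> carrier M. f x \<in> W}" using W assms by (intro ksub_vimage) auto
    then have "lin_eval M B c \<in> {x \<in> carrier M. f x \<in> W}" for c
      by (rule lin_eval_ksub[rotated]) (use W B assms in auto)
    then have "range (lin_eval M B) \<subseteq> {x \<in> carrier M. f x \<in> W}" by blast
    then have "f ` carrier M \<subseteq> W" using B(3) by auto
    then show "carrier N \<subseteq> W" by (simp only: assms(4))
  qed (use B assms in auto)
qed

text \<open>Coefficients outside \<open>B\<close> do not influence \<open>lin_eval\<close>; setting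
  them to zero keeps the space inside a finite-dimensional one.\<close>

definition coeff_space :: "('a, 'b) module \<Rightarrow> 'b set \<Rightarrow> 'b set \<Rightarrow> ('b \<Rightarrow> 'k) set" where
  "coeff_space M B T = {c. (\<forall>b. b \<notin> B \<longrightarrow> c b = 0) \<and> lin_eval M B c \<in> T}"

lemma subspace_lin_eval:
  assumes "rmod M" "finite B" "B \<subseteq> carrier M" "ksub M T"
  shows "fvs.subspace {c. lin_eval M B c \<in> T}"
  unfolding fvs.subspace_def
  using assms by (auto simp: lin_eval_add lin_eval_scale lin_eval_zero ksub_def)

lemma subspace_coeff_space:
  assumes "rmod M" "finite B" "B \<subseteq> carrier M" "ksub M T"
  shows "fvs.subspace (coeff_space M B T)"
  unfolding fvs.subspace_def coeff_space_def
  using assms by (auto simp: lin_eval_add lin_eval_scale lin_eval_zero ksub_def)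

lemma coeff_space_span:
  assumes "finite B"
  shows "coeff_space M B T \<subseteq> fvs.span ((\<lambda>b x. if x = b then 1 else 0) ` B)"
proof
  fix c assume "c \<in> coeff_space M B T"
  then have "c = (\<Sum>b\<in>B. (\<lambda>x. c b * (if x = b then 1 else 0)))"
    using assms by (auto simp: coeff_space_def fun_eq_iff sum_app if_distrib sum.delta cong: if_cong)
  moreover have "\<dots> \<in> fvs.span ((\<lambda>b x. if x = b then 1 else 0) ` B)"
    by (intro fvs.span_sum fvs.span_scale fvs.span_base) auto
  ultimately show "c \<in> fvs.span ((\<lambda>b x. if x = b then 1 else 0) ` B)" by simp
qed

lemma lin_eval_coeff_space:
  assumes M: "rmod M" and B: "finite B" "B \<subseteq> carrier M" "carrier M \<subseteq> range (lin_eval M B)"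
    and T: "T \<subseteq> carrier M"
  shows "T = lin_eval M B ` coeff_space M B T"
proof
  show "T \<subseteq> lin_eval M B ` coeff_space M B T"
  proof
    fix x assume x: "x \<in> T"
    then obtain c where c: "x = lin_eval M B c" using B T by blast
    have "lin_eval M B (\<lambda>b. if b \<in> B then c b else 0) = x"
      unfolding c by (rule lin_eval_cong) (use M B in auto)
    then show "x \<in> lin_eval M B ` coeff_space M B T"
      using x by (intro image_eqI[of _ _ "\<lambda>b. if b \<in> B then c b else 0"]) (auto simp: coeff_space_def)
  qed
qed (auto simp: coeff_space_def)

text \<open>Serves as the termination measure when summands are split off; for that, strict
  monotonicity on subspaces is enough.\<close>

lemma fd_measure:
  assumes "fd M"
  obtains \<mu> :: "'b set \<Rightarrow> nat" where "\<And>T T'. ksub M T \<Longrightarrow> ksub M T' \<Longrightarrow> T' \<subset> T \<Longrightarrow> \<mu> T' < \<mu> T"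
proof -
  obtain B where B: "finite B" "B \<subseteq> carrier M" "carrier M \<subseteq> range (lin_eval M B)"
    using assms(1) by (rule fdE)
  have M: "rmod M" using assms by simp
  have "fvs.dim (coeff_space M B T') < fvs.dim (coeff_space M B T)" if "ksub M T" "ksub M T'" "T' \<subset> T" for T T'
  proof (rule fvs.dim_less[OF subspace_coeff_space[OF M B(1,2)] subspace_coeff_space[OF M B(1,2)] _ coeff_space_span[OF B(1)]])
    have "coeff_space M B T' \<noteq> coeff_space M B T"
      using lin_eval_coeff_space[OF M B, of T] lin_eval_coeff_space[OF M B, of T'] that by (auto simp: ksub_def)
    moreover have "coeff_space M B T' \<subseteq> coeff_space M B T" using that(3) by (auto simp: coeff_space_def)
    ultimately show "coeff_space M B T' \<subset> coeff_space M B T" by blast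
  qed (use that B in auto)
  then show ?thesis by (rule that)
qed

text \<open>A basis of the coefficient space of \<open>T\<close> is finite, because it lies in the
  span of finitely many unit vectors; its image spans \<open>T\<close>.\<close>

lemma sub_fd:
  assumes "fd M" and T: "smod T M" shows "fd (restr M T)"
proof -
  obtain B where B: "finite B" "B \<subseteq> carrier M" "carrier M \<subseteq> range (lin_eval M B)"
    using assms(1) by (rule fdE)
  have M: "rmod M" using assms by simp
  obtain C where C: "C \<subseteq> coeff_space M B T" "fvs.independent C" "coeff_space M B T \<subseteq> fvs.span C" "card C = fvs.dim (coeff_space M B T)"
    by (rule fvs.basis_exists)
  have "finite C"
    using fvs.independent_span_bound[OF _ C(2)] C(1) coeff_space_span[OF B(1)] B(1)
    by (meson finite_imageI subset_trans)
  moreover have "T \<subseteq> W" if W: "ksub (restr M T) W" "lin_eval M B ` C \<subseteq> W" for W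
  proof -
    have "ksub M W" using W smod_sub[OF T] by (auto simp: ksub_def)
    then have "fvs.span C \<subseteq> {c. lin_eval M B c \<in> W}"
      using W M B by (intro fvs.span_minimal subspace_lin_eval) auto
    then have "lin_eval M B ` coeff_space M B T \<subseteq> W" using C(3) by blast
    then show ?thesis using lin_eval_coeff_space[OF M B smod_sub[OF T]] by simp
  qed
  ultimately show ?thesis
    using C by (intro fdI[of _ "lin_eval M B ` C"]) (use M T in \<open>auto simp: coeff_space_def\<close>)
qed

section \<open>Linear functionals, and copies of modules in the type of sequences\<close>

definition lfun :: "('a, 'b) module \<Rightarrow> ('b \<Rightarrow> 'k) \<Rightarrow> bool" where
  "lfun M \<phi> \<longleftrightarrow> (\<forall>x\<in>carrier M. \<forall>y\<in>carrier M. \<phi> (x \<oplus>\<^bsub>M\<^esub> y) = \<phi> x + \<phi> y) \<and>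
    (\<forall>c. \<forall>x\<in>carrier M. \<phi> (sc c \<odot>\<^bsub>M\<^esub> x) = c * \<phi> x)"

lemma lfun_0: "lfun M \<phi> \<Longrightarrow> rmod M \<Longrightarrow> \<phi> \<zero>\<^bsub>M\<^esub> = 0"
  unfolding lfun_def by (metis mult_zero_left mzero_cl sc_0 sm_zerol)

text \<open>Pulled back along \<open>lin_eval\<close>, \<open>W\<close> becomes a subspace
  \<open>V\<close> of coefficient functions and \<open>s\<close> a vector \<open>d\<close> outside
  it. Extend a basis of \<open>V\<close> and \<open>d\<close> to a basis of all functions: the
  coordinate at \<open>d\<close> vanishes on \<open>V\<close>, hence on the kernel of
  \<open>lin_eval\<close>, and so descends to \<open>M\<close>.\<close>

lemma separating_functional:
  assumes "fd M" and W: "ksub M W" and s: "s \<in> carrier M" "s \<notin> W"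
  obtains \<phi> where "lfun M \<phi>" "\<And>w. w \<in> W \<Longrightarrow> \<phi> w = 0" "\<phi> s = 1"
proof -
  obtain B where B: "finite B" "B \<subseteq> carrier M" "carrier M \<subseteq> range (lin_eval M B)"
    using assms(1) by (rule fdE)
  have M: "rmod M" using assms by simp
  define V where "V = {c. lin_eval M B c \<in> W}"
  have V: "fvs.subspace V" unfolding V_def using M B W by (intro subspace_lin_eval)
  obtain C where C: "C \<subseteq> V" "fvs.independent C" "V \<subseteq> fvs.span C" "card C = fvs.dim V"
    by (rule fvs.basis_exists)
  obtain d where d: "s = lin_eval M B d" using B s by blast
  have "fvs.span C \<subseteq> V" using C V by (simp add: fvs.span_minimal)
  moreover have "d \<notin> V" using s d by (simp add: V_def)
  ultimately have ind: "fvs.independent (insert d C)"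
    using C by (intro fvs.independent_insertI) auto
  define E where "E = fvs.extend_basis (insert d C)"
  have E: "fvs.independent E" "fvs.span E = UNIV" "insert d C \<subseteq> E"
    using fvs.independent_extend_basis[OF ind] fvs.span_extend_basis[OF ind]
      fvs.extend_basis_superset[OF ind] by (auto simp: E_def)
  define \<psi> where "\<psi> c = fvs.representation E c d" for c
  have \<psi>: "\<psi> (c + c') = \<psi> c + \<psi> c'" "\<psi> (\<lambda>x. k * c x) = k * \<psi> c" for c c' k
    using E fvs.representation_add[of E c' c] fvs.representation_scale[of E c k] by (auto simp: \<psi>_def)
  have "fvs.subspace {c. \<psi> c = 0}"
    using \<psi> \<psi>(2)[of 0 0] by (auto simp: fvs.subspace_def zero_fun_def)
  moreover have "C \<subseteq> {c. \<psi> c = 0}"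
  proof
    fix c assume c: "c \<in> C"
    then have "c \<noteq> d" using C \<open>d \<notin> V\<close> by blast
    then show "c \<in> {c. \<psi> c = 0}"
      using E c fvs.representation_basis[of E c] by (auto simp: \<psi>_def)
  qed
  ultimately have \<psi>V: "\<psi> c = 0" if "c \<in> V" for c
    using that C fvs.span_minimal by blast
  have \<psi>d: "\<psi> d = 1" using E fvs.representation_basis[of E d] by (auto simp: \<psi>_def)
  define \<phi> where "\<phi> x = \<psi> (SOME c. lin_eval M B c = x)" for x
  have \<phi>: "\<phi> (lin_eval M B c) = \<psi> c" for c
  proof -
    define c' where "c' = (SOME c'. lin_eval M B c' = lin_eval M B c)"
    have c': "lin_eval M B c' = lin_eval M B c" unfolding c'_def by (rule someI[of _ c]) simp
    \<comment> \<open>Both coefficient functions represent the same element, so their difference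
      evaluates to zero, lies in \<open>V\<close> and is killed by \<psi>.\<close>
    have "lin_eval M B (c' + (\<lambda>b. (-1) * c b)) = sc 1 \<odot>\<^bsub>M\<^esub> lin_eval M B c \<oplus>\<^bsub>M\<^esub> sc (-1) \<odot>\<^bsub>M\<^esub> lin_eval M B c"
      using M B c' by (simp only: lin_eval_add lin_eval_scale) (simp add: lin_eval_cl)
    also have "\<dots> = sc (1 + (-1)) \<odot>\<^bsub>M\<^esub> lin_eval M B c"
      using M B by (simp only: sc_sm_plus lin_eval_cl)
    also have "\<dots> = \<zero>\<^bsub>M\<^esub>" using M B by (simp add: lin_eval_cl)
    finally have "\<psi> (c' + (\<lambda>b. (-1) * c b)) = 0" using W by (intro \<psi>V) (simp add: V_def ksub_def)
    then show ?thesis by (simp only: \<psi>) (simp add: \<phi>_def c'_def)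
  qed
  have "lfun M \<phi>"
    unfolding lfun_def
  proof (intro conjI ballI allI)
    fix x y k assume "x \<in> carrier M" "y \<in> carrier M"
    then obtain c c' where "x = lin_eval M B c" "y = lin_eval M B c'" using B by blast
    then show "\<phi> (x \<oplus>\<^bsub>M\<^esub> y) = \<phi> x + \<phi> y"
      by (simp only: lin_eval_add[OF M B(1,2), symmetric] \<phi> \<psi>)
  next
    fix x k assume "x \<in> carrier M"
    then obtain c where "x = lin_eval M B c" using B by blast
    then show "\<phi> (sc k \<odot>\<^bsub>M\<^esub> x) = k * \<phi> x"
      by (simp only: lin_eval_scale[OF M B(1,2), symmetric] \<phi> \<psi>)
  qed
  moreover have "\<phi> w = 0" if "w \<in> W" for w
  proof -
    have "w \<in> range (lin_eval M B)" using that W B(3) by (auto simp: ksub_def)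
    then obtain c where "w = lin_eval M B c" by blast
    then show ?thesis using that \<psi>V \<phi> by (simp add: V_def)
  qed
  moreover have "\<phi> s = 1" by (simp add: d \<phi> \<psi>d)
  ultimately show ?thesis using that by blast
qed

text \<open>A functional that kills the kernel of \<open>\<phi>0\<close> and is 1 at a vector
  \<open>s\<close> with \<open>\<phi>0 s = 1\<close> agrees with \<open>\<phi>0\<close>, since every
  x in \<open>X\<close> is a multiple of \<open>s\<close> modulo that kernel.\<close>

lemma lfun_extend:
  assumes Y: "fd Y" and X: "ksub Y X"
    and add: "\<And>x y. x \<in> X \<Longrightarrow> y \<in> X \<Longrightarrow> \<phi>0 (x \<oplus>\<^bsub>Y\<^esub> y) = \<phi>0 x + \<phi>0 y"
    and scl: "\<And>c x. x \<in> X \<Longrightarrow> \<phi>0 (sc c \<odot>\<^bsub>Y\<^esub> x) = c * \<phi>0 x"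
  obtains \<phi> where "lfun Y \<phi>" "\<And>x. x \<in> X \<Longrightarrow> \<phi> x = \<phi>0 x"
proof (cases "\<forall>x\<in>X. \<phi>0 x = 0")
  case True
  have "lfun Y (\<lambda>_. 0)" by (simp add: lfun_def)
  then show ?thesis using that True by metis
next
  case False
  then obtain t where t: "t \<in> X" "\<phi>0 t \<noteq> 0" by blast
  have R: "rmod Y" using Y by simp
  define s where "s = sc (1 / \<phi>0 t) \<odot>\<^bsub>Y\<^esub> t"
  have s: "s \<in> X" "\<phi>0 s = 1" using t X by (auto simp: s_def scl ksub_def)
  define W where "W = {x \<in> X. \<phi>0 x = 0}"
  have z: "\<phi>0 \<zero>\<^bsub>Y\<^esub> = 0" using scl[of "\<zero>\<^bsub>Y\<^esub>" 0] X R by (simp add: ksub_def)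
  have "ksub Y W" using X z by (auto simp: ksub_def W_def add scl)
  moreover have "s \<notin> W" "s \<in> carrier Y" using s X by (auto simp: W_def ksub_def)
  ultimately obtain \<phi> where \<phi>: "lfun Y \<phi>" "\<And>w. w \<in> W \<Longrightarrow> \<phi> w = 0" "\<phi> s = 1"
    using separating_functional[OF Y] by metis
  have "\<phi> x = \<phi>0 x" if x: "x \<in> X" for x
  proof -
    have c: "x \<in> carrier Y" "sc (- \<phi>0 x) \<odot>\<^bsub>Y\<^esub> s \<in> X" "sc (- \<phi>0 x) \<odot>\<^bsub>Y\<^esub> s \<in> carrier Y" "s \<in> carrier Y"
      using x s X by (auto simp: ksub_def)
    have "x \<oplus>\<^bsub>Y\<^esub> sc (- \<phi>0 x) \<odot>\<^bsub>Y\<^esub> s \<in> W"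
      using x s X c by (auto simp: W_def add scl ksub_def)
    then have "\<phi> (x \<oplus>\<^bsub>Y\<^esub> sc (- \<phi>0 x) \<odot>\<^bsub>Y\<^esub> s) = 0" by (rule \<phi>)
    then have "\<phi> x + (- \<phi>0 x) * \<phi> s = 0" using \<phi>(1) c unfolding lfun_def by metis
    then show ?thesis using \<phi>(3) by simp
  qed
  then show ?thesis using that \<phi> by blast
qed

text \<open>Brings modules of other element types, such as the regular module, into the type for
  which projectivity and injectivity are defined. An element is encoded by chosen coefficients with
  respect to an enumerated spanning set.\<close>

lemma fd_copy:
  fixes M :: "('a, 'b) module"
  assumes "fd M"
  obtains Q :: "('a, nat \<Rightarrow> 'k) module" and r where "fd Q" "r \<in> homs M Q" "r ` carrier M = carrier Q"
    "inj_on r (carrier M)"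
proof -
  obtain B where B: "finite B" "B \<subseteq> carrier M" "carrier M \<subseteq> range (lin_eval M B)"
    using assms(1) by (rule fdE)
  have M: "rmod M" using assms by simp
  obtain f n where f: "f ` {i::nat. i < n} = B"
    using B(1) finite_imp_nat_seg_image_inj_on by metis
  define co where "co x = (SOME c. lin_eval M B c = x)" for x
  have co: "lin_eval M B (co x) = x" if "x \<in> carrier M" for x
  proof -
    have "\<exists>c. lin_eval M B c = x" using that B(3) by auto
    then show ?thesis unfolding co_def by (rule someI_ex)
  qed
  define r where "r x = (\<lambda>i. if i < n then co x (f i) else 0)" for x
  have "x = y" if "x \<in> carrier M" "y \<in> carrier M" "r x = r y" for x y
  proof -
    have "co x b = co y b" if "b \<in> B" for b
    proof -
      have "b \<in> f ` {i. i < n}" using f that by simp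
      then obtain i where "i < n" "b = f i" by blast
      then show ?thesis using fun_cong[OF \<open>r x = r y\<close>, of i] by (simp add: r_def)
    qed
    then show ?thesis using co that lin_eval_cong[OF M B(1,2)] by metis
  qed
  then have injective: "inj_on r (carrier M)" by (auto simp: inj_on_def)
  have "r x = r y \<longleftrightarrow> x \<ominus>\<^bsub>M\<^esub> y \<in> {\<zero>\<^bsub>M\<^esub>}" if "x \<in> carrier M" "y \<in> carrier M" for x y
    using injective that M by (auto simp: mminus_0_iff inj_on_def)
  then obtain Q :: "('a, nat \<Rightarrow> 'k) module" where
    Q: "rmod Q" "r \<in> homs M Q" "carrier Q = r ` carrier M"
    by (rule transport_quotient[OF M smod_0[OF M]])
  show ?thesis by (rule that[OF img_fd[OF assms Q(1,2)] Q(2) _ injective]) (simp_all add: Q(3))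
qed


section \<open>Projective dimension\<close>

abbreviation projective :: "('a, nat \<Rightarrow> 'k) module \<Rightarrow> bool" where "projective P \<equiv> projective_module A P"
abbreviation injective :: "('a, nat \<Rightarrow> 'k) module \<Rightarrow> bool" where "injective E \<equiv> injective_module A E"

lemma proj_fd [simp]: "projective P \<Longrightarrow> fd P" by (simp add: projective_module_def)
lemma inj_fd [simp]: "injective E \<Longrightarrow> fd E" by (simp add: injective_module_def)

lemma surjE:
  assumes "f ` carrier M = carrier N" "y \<in> carrier N"
  obtains x where "x \<in> carrier M" "y = f x"
  using assms by (metis imageE)

lemma proj_lift:
  fixes X Y :: "('a, nat \<Rightarrow> 'k) module"
  assumes "projective P" "fd X" "fd Y" "g \<in> homs X Y" "g ` carrier X = carrier Y" "f \<in> homs P Y"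
  obtains h where "h \<in> homs P X" "\<And>x. x \<in> carrier P \<Longrightarrow> g (h x) = f x"
proof -
  have "\<forall>g\<in>homs X Y. \<forall>f\<in>homs P Y. fd X \<and> fd Y \<and> g ` carrier X = carrier Y \<longrightarrow>
      (\<exists>h\<in>homs P X. \<forall>x\<in>carrier P. g (h x) = f x)"
    using assms(1) unfolding projective_module_def by blast
  from this[rule_format, OF assms(4,6)] assms have "\<exists>h\<in>homs P X. \<forall>x\<in>carrier P. g (h x) = f x"
    by simp
  then show ?thesis using that by blast
qed

lemma projectiveI:
  assumes "fd P"
    and "\<And>(X :: ('a, nat \<Rightarrow> 'k) module) (Y :: ('a, nat \<Rightarrow> 'k) module) g f.
      fd X \<Longrightarrow> fd Y \<Longrightarrow> g \<in> homs X Y \<Longrightarrow> g ` carrier X = carrier Y \<Longrightarrow> f \<in> homs P Y \<Longrightarrow>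
      \<exists>h\<in>homs P X. \<forall>x\<in>carrier P. g (h x) = f x"
  shows "projective P"
  using assms unfolding projective_module_def by blast

lemma injectiveI:
  assumes "fd E"
    and "\<And>(X :: ('a, nat \<Rightarrow> 'k) module) (Y :: ('a, nat \<Rightarrow> 'k) module) g f.
      fd X \<Longrightarrow> fd Y \<Longrightarrow> g \<in> homs X Y \<Longrightarrow> inj_on g (carrier X) \<Longrightarrow> f \<in> homs X E \<Longrightarrow>
      \<exists>h\<in>homs Y E. \<forall>x\<in>carrier X. h (g x) = f x"
  shows "injective E"
  using assms unfolding injective_module_def by blast

lemma inj_extend:
  fixes Y :: "('a, nat \<Rightarrow> 'k) module"
  assumes "injective E" "fd Y" "smod T Y" "f \<in> homs (restr Y T) E"
  obtains h where "h \<in> homs Y E" "\<And>x. x \<in> T \<Longrightarrow> h x = f x"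
proof -
  have "\<forall>g\<in>homs (restr Y T) Y. \<forall>f\<in>homs (restr Y T) E. fd (restr Y T) \<and> fd Y \<and> inj_on g (carrier (restr Y T)) \<longrightarrow>
      (\<exists>h\<in>homs Y E. \<forall>x\<in>carrier (restr Y T). h (g x) = f x)"
    using assms(1) unfolding injective_module_def by blast
  from this[rule_format, OF homs_restr_incl[OF assms(3)] assms(4)]
  have "\<exists>h \<in> homs Y E. \<forall>x\<in>carrier (restr Y T). h x = f x"
    using assms sub_fd[OF assms(2,3)] by simp
  then show ?thesis using that by auto
qed

lemma homs_inverse:
  assumes "rmod M" "rmod N" "f \<in> homs M N" "inj_on f (carrier M)" "f ` carrier M = carrier N"
  obtains g where "g \<in> homs N M" "\<And>x. x \<in> carrier M \<Longrightarrow> g (f x) = x" "\<And>y. y \<in> carrier N \<Longrightarrow> f (g y) = y"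
proof -
  obtain g where g: "g \<in> homs N M" "\<And>x. x \<in> carrier M \<Longrightarrow> g (f x) = x"
    by (rule factor_through[OF assms(1,2,1,3,5) homs_id]) (use assms homs_inj_iff[OF assms(1-3)] in auto)
  moreover have "f (g y) = y" if y: "y \<in> carrier N" for y
  proof -
    obtain x where "x \<in> carrier M" "y = f x" by (rule surjE[OF assms(5) y])
    then show ?thesis using g(2) by simp
  qed
  ultimately show ?thesis by (rule that)
qed

lemma proj_retract:
  assumes P: "projective P" and M: "fd M" and i: "i \<in> homs M P" and r: "r \<in> homs P M"
    and ri: "\<And>x. x \<in> carrier M \<Longrightarrow> r (i x) = x"
  shows "projective M"
proof (rule projectiveI[OF M])
  fix X Y :: "('a, nat \<Rightarrow> 'k) module" and g f
  assume a: "fd X" "fd Y" "g \<in> homs X Y" "g ` carrier X = carrier Y" "f \<in> homs M Y"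
  obtain h where h: "h \<in> homs P X" "\<And>x. x \<in> carrier P \<Longrightarrow> g (h x) = f (r x)"
    using proj_lift[OF P a(1-4) homs_comp[OF r a(5)]] by blast
  show "\<exists>h\<in>homs M X. \<forall>x\<in>carrier M. g (h x) = f x"
    by (rule bexI[OF _ homs_comp[OF i h(1)]]) (use h i ri in simp)
qed

text \<open>A recursion over syzygies that asks for one suitable presentation at each stage, which
  makes projective dimension accessible to induction; \<open>proj_dim_le_iff\<close> is the
  link.\<close>

primrec pd_le :: "nat \<Rightarrow> ('a, nat \<Rightarrow> 'k) module \<Rightarrow> bool" where
  "pd_le 0 = (\<lambda>M. projective M)"
| "pd_le (Suc m) = (\<lambda>M. fd M \<and> (\<exists>P \<pi>. projective P \<and> \<pi> \<in> homs P M \<and> \<pi> ` carrier P = carrier M \<and>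
      pd_le m (restr P (ker P M \<pi>))))"

lemma proj_zero:
  assumes "fd M" "carrier M = {\<zero>\<^bsub>M\<^esub>}" shows "projective M"
proof (rule projectiveI[OF assms(1)])
  fix X Y :: "('a, nat \<Rightarrow> 'k) module" and g f
  assume a: "fd X" "fd Y" "g \<in> homs X Y" "g ` carrier X = carrier Y" "f \<in> homs M Y"
  show "\<exists>h\<in>homs M X. \<forall>x\<in>carrier M. g (h x) = f x"
    by (rule bexI[OF _ homs_0[of X]]) (use a assms homs_zero[of X Y g] homs_zero[of M Y f] in auto)
qed

lemma pd_le_zero: "fd M \<Longrightarrow> carrier M = {\<zero>\<^bsub>M\<^esub>} \<Longrightarrow> pd_le m M"
proof (induction m)
  case (Suc m)
  have k: "ker M M (\<lambda>x. x) = carrier M" using Suc.prems by (auto simp: ker_def)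
  have "pd_le m (restr M (ker M M (\<lambda>x. x)))"
    unfolding k restr_simps(6) by (rule Suc.IH[OF Suc.prems])
  moreover have "projective M" using Suc.prems by (rule proj_zero)
  moreover have "(\<lambda>x. x) ` carrier M = carrier M" by simp
  ultimately show ?case using Suc.prems(1) homs_id[of M] unfolding pd_le.simps by blast
qed (simp add: proj_zero)

lemma resolution_pd_le:
  "projective_resolution A M n P d \<Longrightarrow> fd M \<Longrightarrow> pd_le n M"
proof (induction n arbitrary: M P d)
  case 0
  have res: "projective (P 0)" "d 0 \<in> homs (P 0) M" "d 0 ` carrier (P 0) = carrier M" "projective (P 1)"
     "carrier (P 1) = {\<zero>\<^bsub>P 1\<^esub>}" "d 1 \<in> homs (P 1) (P 0)" "d 1 ` carrier (P 1) = ker (P 0) M (d 0)"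
    using 0(1) by (auto simp: projective_resolution_def exact_at_def a_kernel_ker)
  have "ker (P 0) M (d 0) = {\<zero>\<^bsub>P 0\<^esub>}"
    using res(4-7) res(1) homs_zero[of "P 1" "P 0" "d 1"] by (metis fd_rmod image_empty image_insert proj_fd)
  then have "inj_on (d 0) (carrier (P 0))"
    using res 0(2) homs_inj_iff[of "P 0" M "d 0"] by (auto simp: ker_def)
  then obtain g where g: "g \<in> homs M (P 0)" "\<And>y. y \<in> carrier M \<Longrightarrow> d 0 (g y) = y"
    using homs_inverse[OF _ _ res(2) _ res(3)] res(1) 0(2) by (metis fd_rmod proj_fd)
  then show ?case using proj_retract[OF res(1) 0(2) g(1) res(2)] by simp
next
  case (Suc n)
  define K where "K = restr (P 0) (ker (P 0) M (d 0))"
  have res: "\<And>j. projective (P j)" "d 0 \<in> homs (P 0) M" "d 0 ` carrier (P 0) = carrier M"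
    "\<And>j. j > Suc n \<Longrightarrow> carrier (P j) = {\<zero>\<^bsub>P j\<^esub>}" "\<And>j. d (Suc j) \<in> homs (P (Suc j)) (P j)"
    "d 1 ` carrier (P 1) = ker (P 0) M (d 0)"
    "\<And>j. exact_at (P (Suc (Suc j))) (d (Suc (Suc j))) (P (Suc j)) (d (Suc j)) (P j)"
    using Suc.prems by (auto simp: projective_resolution_def exact_at_def a_kernel_ker)
  have d1: "d 1 \<in> homs (P 1) K"
    unfolding K_def by (rule homs_restr_cod) (use res(5)[of 0] res(6) in auto)
  \<comment> \<open>Dropping \<open>P 0\<close> leaves a resolution of the first syzygy, one step
    shorter.\<close>
  have "projective_resolution A K n (\<lambda>j. P (Suc j)) (\<lambda>j. d (Suc j))"
    unfolding projective_resolution_def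
    using res(1,4,5) d1 res(6) res(7)
    by (auto simp: K_def exact_at_def a_kernel_ker)
  moreover have "fd K" using res Suc.prems by (simp add: K_def sub_fd)
  ultimately have "pd_le n K" by (rule Suc.IH)
  then show ?case using res Suc.prems by (auto simp: K_def)
qed

lemma pd_le_resolution:
  "pd_le n M \<Longrightarrow> \<exists>P d. projective_resolution A M n P d"
proof (induction n arbitrary: M)
  case 0
  then have M: "projective M" "rmod M" "fd M" by auto
  define Z where "Z = restr M {\<zero>\<^bsub>M\<^esub>}"
  have Z: "fd Z" "carrier Z = {\<zero>\<^bsub>M\<^esub>}" "\<zero>\<^bsub>Z\<^esub> = \<zero>\<^bsub>M\<^esub>" using M by (auto simp: Z_def sub_fd)
  have pZ: "projective Z" using Z by (intro proj_zero) auto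
  have h: "(\<lambda>x. \<zero>\<^bsub>M\<^esub>) \<in> homs Z M" "(\<lambda>x. \<zero>\<^bsub>M\<^esub>) \<in> homs Z Z"
    using homs_0[of M] homs_0[of Z Z] M Z by auto
  have "projective_resolution A M 0 (\<lambda>j. if j = 0 then M else Z) (\<lambda>j. if j = 0 then (\<lambda>x. x) else (\<lambda>x. \<zero>\<^bsub>M\<^esub>))"
    unfolding projective_resolution_def using M pZ Z h
    by (auto simp: exact_at_def a_kernel_ker ker_def)
  then show ?case by blast
next
  case (Suc n)
  then obtain P0 \<pi> where P0: "projective P0" "\<pi> \<in> homs P0 M" "\<pi> ` carrier P0 = carrier M"
    and DK: "pd_le n (restr P0 (ker P0 M \<pi>))" and M: "fd M" by auto
  obtain P d where res: "projective_resolution A (restr P0 (ker P0 M \<pi>)) n P d"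
    using Suc.IH[OF DK] by blast
  have s: "ker P0 M \<pi> \<subseteq> carrier P0" by (auto simp: ker_def)
  have d0: "d 0 \<in> homs (P 0) P0"
    using res s by (auto simp: projective_resolution_def intro: homs_restr_cod_incl)
  have "projective_resolution A M (Suc n) (case_nat P0 P) (case_nat \<pi> d)"
    unfolding projective_resolution_def
  proof (intro conjI allI impI)
    fix j
    show "projective (case j of 0 \<Rightarrow> P0 | Suc x \<Rightarrow> P x)"
      using P0 res by (auto simp: projective_resolution_def split: nat.split)
    show "carrier (case j of 0 \<Rightarrow> P0 | Suc x \<Rightarrow> P x) = {\<zero>\<^bsub>case j of 0 \<Rightarrow> P0 | Suc x \<Rightarrow> P x\<^esub>}" if "Suc n < j"
      using that res by (auto simp: projective_resolution_def split: nat.split)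
    show "(case Suc j of 0 \<Rightarrow> \<pi> | Suc x \<Rightarrow> d x) \<in> homs (case Suc j of 0 \<Rightarrow> P0 | Suc x \<Rightarrow> P x) (case j of 0 \<Rightarrow> P0 | Suc x \<Rightarrow> P x)"
      using d0 res by (auto simp: projective_resolution_def split: nat.split)
    show "exact_at (case Suc (Suc j) of 0 \<Rightarrow> P0 | Suc x \<Rightarrow> P x) (case Suc (Suc j) of 0 \<Rightarrow> \<pi> | Suc x \<Rightarrow> d x)
        (case Suc j of 0 \<Rightarrow> P0 | Suc x \<Rightarrow> P x) (case Suc j of 0 \<Rightarrow> \<pi> | Suc x \<Rightarrow> d x)
        (case j of 0 \<Rightarrow> P0 | Suc x \<Rightarrow> P x)"
      using res by (auto simp: projective_resolution_def exact_at_def a_kernel_ker split: nat.split)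
  qed (use P0 res in \<open>auto simp: projective_resolution_def exact_at_def a_kernel_ker\<close>)
  then show ?case by blast
qed

lemma proj_dim_le_iff:
  assumes "fd M" shows "proj_dim A M \<le> enat m \<longleftrightarrow> pd_le m M"
proof
  assume le: "proj_dim A M \<le> enat m"
  define S where "S = {enat n | n. \<exists>P d. projective_resolution A M n P d}"
  have "Inf S \<le> enat m" using le by (simp add: proj_dim_def S_def)
  \<comment> \<open>The infimum of the empty set is infinite, so the bound makes the set nonempty
    and the infimum attained. A resolution of length n also counts as one of any length m \<ge>
    n.\<close>
  then have "S \<noteq> {}" by (auto simp: Inf_enat_def)
  then have "Inf S \<in> S" unfolding Inf_enat_def by (auto intro: LeastI)
  then obtain n P d where n: "Inf S = enat n" "projective_resolution A M n P d" by (auto simp: S_def)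
  then have "projective_resolution A M m P d"
    using \<open>Inf S \<le> enat m\<close> by (auto simp: projective_resolution_def)
  then show "pd_le m M" using assms by (rule resolution_pd_le)
next
  assume "pd_le m M"
  then have "enat m \<in> {enat n | n. \<exists>P d. projective_resolution A M n P d}"
    using pd_le_resolution by blast
  then show "proj_dim A M \<le> enat m" unfolding proj_dim_def by (rule Inf_lower)
qed

text \<open>Given by maps and equations, this covers the external sum of two modules as well as an
  internal decomposition into submodules.\<close>

definition biprod where
  "biprod M M1 M2 i1 i2 r1 r2 \<longleftrightarrow> i1 \<in> homs M1 M \<and> i2 \<in> homs M2 M \<and> r1 \<in> homs M M1 \<and> r2 \<in> homs M M2 \<and>
    (\<forall>x\<in>carrier M1. r1 (i1 x) = x \<and> r2 (i1 x) = \<zero>\<^bsub>M2\<^esub>) \<and>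
    (\<forall>x\<in>carrier M2. r2 (i2 x) = x \<and> r1 (i2 x) = \<zero>\<^bsub>M1\<^esub>) \<and>
    (\<forall>x\<in>carrier M. i1 (r1 x) \<oplus>\<^bsub>M\<^esub> i2 (r2 x) = x)"

lemma fd_spanE:
  assumes "fd M"
  obtains B where "finite B" "B \<subseteq> carrier M" "\<And>W. ksub M W \<Longrightarrow> B \<subseteq> W \<Longrightarrow> carrier M \<subseteq> W"
proof -
  obtain B where B: "finite B" "B \<subseteq> carrier M" "carrier M \<subseteq> range (lin_eval M B)"
    using assms by (rule fdE)
  have "carrier M \<subseteq> W" if "ksub M W" "B \<subseteq> W" for W
  proof
    fix x assume "x \<in> carrier M"
    then obtain c where "x = lin_eval M B c" using B(3) by auto
    then show "x \<in> W" using lin_eval_ksub[OF _ that(1) B(1) that(2)] assms by simp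
  qed
  then show ?thesis using that B by blast
qed

lemma biprod_fd:
  assumes "fd M1" "fd M2" "rmod M" "biprod M M1 M2 i1 i2 r1 r2"
  shows "fd M"
proof -
  obtain B1 where B1: "finite B1" "B1 \<subseteq> carrier M1" "\<And>W. ksub M1 W \<Longrightarrow> B1 \<subseteq> W \<Longrightarrow> carrier M1 \<subseteq> W"
    using fd_spanE[OF assms(1)] by blast
  obtain B2 where B2: "finite B2" "B2 \<subseteq> carrier M2" "\<And>W. ksub M2 W \<Longrightarrow> B2 \<subseteq> W \<Longrightarrow> carrier M2 \<subseteq> W"
    using fd_spanE[OF assms(2)] by blast
  have h: "i1 \<in> homs M1 M" "i2 \<in> homs M2 M" "r1 \<in> homs M M1" "r2 \<in> homs M M2"
    "\<And>x. x \<in> carrier M \<Longrightarrow> i1 (r1 x) \<oplus>\<^bsub>M\<^esub> i2 (r2 x) = x"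
    using assms(4) by (auto simp: biprod_def)
  show ?thesis
  proof (rule fdI[of _ "i1 ` B1 \<union> i2 ` B2"])
    fix W assume W: "ksub M W" "i1 ` B1 \<union> i2 ` B2 \<subseteq> W"
    have "carrier M1 \<subseteq> {x \<in> carrier M1. i1 x \<in> W}"
      by (rule B1(3)[OF ksub_vimage]) (use W h assms B1(2) in auto)
    moreover have "carrier M2 \<subseteq> {x \<in> carrier M2. i2 x \<in> W}"
      by (rule B2(3)[OF ksub_vimage]) (use W h assms B2(2) in auto)
    ultimately have "i1 (r1 x) \<in> W" "i2 (r2 x) \<in> W" if "x \<in> carrier M" for x
      using homs_cl[OF h(3) that] homs_cl[OF h(4) that] by auto
    then have "i1 (r1 x) \<oplus>\<^bsub>M\<^esub> i2 (r2 x) \<in> W" if "x \<in> carrier M" for x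
      using W(1) that by (auto simp: ksub_def)
    then show "carrier M \<subseteq> W" using h(5) by auto
  qed (use B1(1,2) B2(1,2) h assms in auto)
qed

lemma biprod_proj:
  assumes P: "projective M1" "projective M2" and M: "fd M" and b: "biprod M M1 M2 i1 i2 r1 r2"
  shows "projective M"
proof (rule projectiveI[OF M])
  fix X Y :: "('a, nat \<Rightarrow> 'k) module" and g f
  assume a: "fd X" "fd Y" "g \<in> homs X Y" "g ` carrier X = carrier Y" "f \<in> homs M Y"
  have h: "i1 \<in> homs M1 M" "i2 \<in> homs M2 M" "r1 \<in> homs M M1" "r2 \<in> homs M M2"
    "\<And>x. x \<in> carrier M \<Longrightarrow> i1 (r1 x) \<oplus>\<^bsub>M\<^esub> i2 (r2 x) = x"
    using b by (auto simp: biprod_def)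
  obtain h1 where h1: "h1 \<in> homs M1 X" "\<And>x. x \<in> carrier M1 \<Longrightarrow> g (h1 x) = f (i1 x)"
    using proj_lift[OF P(1) a(1-4) homs_comp[OF h(1) a(5)]] by blast
  obtain h2 where h2: "h2 \<in> homs M2 X" "\<And>x. x \<in> carrier M2 \<Longrightarrow> g (h2 x) = f (i2 x)"
    using proj_lift[OF P(2) a(1-4) homs_comp[OF h(2) a(5)]] by blast
  have "g (h1 (r1 x) \<oplus>\<^bsub>X\<^esub> h2 (r2 x)) = f x" if x: "x \<in> carrier M" for x
  proof -
    have c: "r1 x \<in> carrier M1" "r2 x \<in> carrier M2" using h x by auto
    have "g (h1 (r1 x) \<oplus>\<^bsub>X\<^esub> h2 (r2 x)) = f (i1 (r1 x)) \<oplus>\<^bsub>Y\<^esub> f (i2 (r2 x))"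
      using c h1 h2 a(3) by (simp add: homs_add)
    also have "\<dots> = f (i1 (r1 x) \<oplus>\<^bsub>M\<^esub> i2 (r2 x))"
      using c h a(5) by (simp add: homs_add)
    finally show ?thesis using h(5) x by simp
  qed
  then show "\<exists>h\<in>homs M X. \<forall>x\<in>carrier M. g (h x) = f x"
    using a by (intro bexI[OF _ homs_sum[OF _ homs_comp[OF h(3) h1(1)] homs_comp[OF h(4) h2(1)]]]) auto
qed

lemma direct_sum:
  fixes M1 M2 :: "('a, nat \<Rightarrow> 'k) module"
  assumes M: "rmod M1" "rmod M2"
  obtains S :: "('a, nat \<Rightarrow> 'k) module" and i1 i2 r1 r2 where "rmod S" "biprod S M1 M2 i1 i2 r1 r2"
proof -
  \<comment> \<open>Interleaving two sequences at even and odd positions keeps pairs inside the type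
    \<open>nat \<Rightarrow> 'k\<close>.\<close>
  define pr where "pr x y n = (if even n then x (n div 2) else y (n div 2))" for x y :: "nat \<Rightarrow> 'k" and n
  define r1 where "r1 z n = z (2 * n)" for z :: "nat \<Rightarrow> 'k" and n
  define r2 where "r2 z n = z (2 * n + 1)" for z :: "nat \<Rightarrow> 'k" and n
  have [simp]: "r1 (pr x y) = x" "r2 (pr x y) = y" for x y
    by (auto simp: pr_def r1_def r2_def fun_eq_iff)
  have pr [simp]: "pr (r1 z) (r2 z) = z" for z
    by (auto simp: pr_def r1_def r2_def fun_eq_iff elim: evenE oddE)
  define S :: "('a, nat \<Rightarrow> 'k) module" where
    "S = \<lparr>carrier = {z. r1 z \<in> carrier M1 \<and> r2 z \<in> carrier M2}, mult = undefined, one = undefined,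
      zero = pr \<zero>\<^bsub>M1\<^esub> \<zero>\<^bsub>M2\<^esub>, add = (\<lambda>z w. pr (r1 z \<oplus>\<^bsub>M1\<^esub> r1 w) (r2 z \<oplus>\<^bsub>M2\<^esub> r2 w)),
      smult = (\<lambda>a z. pr (a \<odot>\<^bsub>M1\<^esub> r1 z) (a \<odot>\<^bsub>M2\<^esub> r2 z))\<rparr>"
  have "abelian_group S"
  proof (rule abelian_groupI)
    fix z assume "z \<in> carrier S"
    then show "\<exists>y\<in>carrier S. y \<oplus>\<^bsub>S\<^esub> z = \<zero>\<^bsub>S\<^esub>"
      using M by (intro bexI[of _ "pr (\<ominus>\<^bsub>M1\<^esub> r1 z) (\<ominus>\<^bsub>M2\<^esub> r2 z)"]) (auto simp: S_def)
  qed (use M in \<open>auto simp: S_def madd_ac\<close>)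
  then have S: "rmod S"
    by (rule rmodI) (use M in \<open>auto simp: S_def sm_addl sm_addr sm_mult\<close>)
  have "biprod S M1 M2 (\<lambda>x. pr x \<zero>\<^bsub>M2\<^esub>) (\<lambda>y. pr \<zero>\<^bsub>M1\<^esub> y) r1 r2"
    unfolding biprod_def by (intro conjI homsI ballI) (use M in \<open>auto simp: S_def\<close>)
  then show ?thesis using that S by blast
qed

text \<open>Split case of the horseshoe lemma: the sum of two projective presentations presents the
  sum, and its kernel is the sum of the kernels.\<close>

lemma pd_le_biprod:
  "pd_le m M1 \<Longrightarrow> pd_le m M2 \<Longrightarrow> fd M \<Longrightarrow> biprod M M1 M2 i1 i2 r1 r2 \<Longrightarrow> pd_le m M"
proof (induction m arbitrary: M M1 M2 i1 i2 r1 r2)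
  case 0
  show ?case using biprod_proj[OF _ _ 0(3,4)] 0(1,2) by simp
next
  case (Suc m)
  obtain P1 \<pi>1 where P1: "projective P1" "\<pi>1 \<in> homs P1 M1" "\<pi>1 ` carrier P1 = carrier M1"
    and D1: "pd_le m (restr P1 (ker P1 M1 \<pi>1))" and M1: "fd M1" using Suc.prems(1) by auto
  obtain P2 \<pi>2 where P2: "projective P2" "\<pi>2 \<in> homs P2 M2" "\<pi>2 ` carrier P2 = carrier M2"
    and D2: "pd_le m (restr P2 (ker P2 M2 \<pi>2))" and M2: "fd M2" using Suc.prems(2) by auto
  have R: "rmod P1" "rmod P2" "rmod M1" "rmod M2" "rmod M" using P1 P2 M1 M2 Suc.prems by auto
  obtain P :: "('a, nat \<Rightarrow> 'k) module" and j1 j2 q1 q2 where P: "rmod P" "biprod P P1 P2 j1 j2 q1 q2"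
    by (rule direct_sum[OF R(1,2)])
  have fP: "fd P" and pP: "projective P"
    using biprod_fd[OF _ _ P] biprod_proj[OF P1(1) P2(1) _ P(2)] P1 P2 by auto
  have i: "i1 \<in> homs M1 M" "i2 \<in> homs M2 M" "r1 \<in> homs M M1" "r2 \<in> homs M M2"
    "\<And>x. x \<in> carrier M \<Longrightarrow> i1 (r1 x) \<oplus>\<^bsub>M\<^esub> i2 (r2 x) = x"
    "\<And>x. x \<in> carrier M1 \<Longrightarrow> r1 (i1 x) = x" "\<And>x. x \<in> carrier M1 \<Longrightarrow> r2 (i1 x) = \<zero>\<^bsub>M2\<^esub>"
    "\<And>x. x \<in> carrier M2 \<Longrightarrow> r2 (i2 x) = x" "\<And>x. x \<in> carrier M2 \<Longrightarrow> r1 (i2 x) = \<zero>\<^bsub>M1\<^esub>"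
    using Suc.prems(4) by (auto simp: biprod_def)
  have j: "j1 \<in> homs P1 P" "j2 \<in> homs P2 P" "q1 \<in> homs P P1" "q2 \<in> homs P P2"
    "\<And>x. x \<in> carrier P \<Longrightarrow> j1 (q1 x) \<oplus>\<^bsub>P\<^esub> j2 (q2 x) = x"
    "\<And>x. x \<in> carrier P1 \<Longrightarrow> q1 (j1 x) = x" "\<And>x. x \<in> carrier P1 \<Longrightarrow> q2 (j1 x) = \<zero>\<^bsub>P2\<^esub>"
    "\<And>x. x \<in> carrier P2 \<Longrightarrow> q2 (j2 x) = x" "\<And>x. x \<in> carrier P2 \<Longrightarrow> q1 (j2 x) = \<zero>\<^bsub>P1\<^esub>"
    using P(2) by (auto simp: biprod_def)
  define \<pi> where "\<pi> z = i1 (\<pi>1 (q1 z)) \<oplus>\<^bsub>M\<^esub> i2 (\<pi>2 (q2 z))" for z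
  have \<pi>: "\<pi> \<in> homs P M"
    unfolding \<pi>_def
    by (rule homs_sum[OF R(5) homs_comp[OF homs_comp[OF j(3) P1(2)] i(1)] homs_comp[OF homs_comp[OF j(4) P2(2)] i(2)]])
  have sur: "\<pi> ` carrier P = carrier M"
  proof
    show "carrier M \<subseteq> \<pi> ` carrier P"
    proof
      fix x assume x: "x \<in> carrier M"
      obtain p1 where p1: "p1 \<in> carrier P1" "\<pi>1 p1 = r1 x" using P1(3) homs_cl[OF i(3) x] by force
      obtain p2 where p2: "p2 \<in> carrier P2" "\<pi>2 p2 = r2 x" using P2(3) homs_cl[OF i(4) x] by force
      have "q1 (j1 p1 \<oplus>\<^bsub>P\<^esub> j2 p2) = p1" "q2 (j1 p1 \<oplus>\<^bsub>P\<^esub> j2 p2) = p2"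
        using p1 p2 j R by (simp_all add: homs_add[OF j(3)] homs_add[OF j(4)])
      then have "\<pi> (j1 p1 \<oplus>\<^bsub>P\<^esub> j2 p2) = x" using p1 p2 i(5) x by (simp add: \<pi>_def)
      moreover have "j1 p1 \<oplus>\<^bsub>P\<^esub> j2 p2 \<in> carrier P" using p1 p2 j P(1) by simp
      ultimately show "x \<in> \<pi> ` carrier P" by blast
    qed
  qed (use \<pi> in auto)
  have r\<pi>: "r1 (\<pi> z) = \<pi>1 (q1 z)" "r2 (\<pi> z) = \<pi>2 (q2 z)" if "z \<in> carrier P" for z
  proof -
    have c: "\<pi>1 (q1 z) \<in> carrier M1" "\<pi>2 (q2 z) \<in> carrier M2" using that j P1 P2 by auto
    show "r1 (\<pi> z) = \<pi>1 (q1 z)" "r2 (\<pi> z) = \<pi>2 (q2 z)"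
      using c i R by (simp_all add: \<pi>_def homs_add[OF i(3)] homs_add[OF i(4)])
  qed
  have K: "ker P M \<pi> = {z \<in> carrier P. q1 z \<in> ker P1 M1 \<pi>1 \<and> q2 z \<in> ker P2 M2 \<pi>2}"
  proof (rule equalityI; rule subsetI)
    fix z assume "z \<in> ker P M \<pi>"
    then have "z \<in> carrier P" "\<pi> z = \<zero>\<^bsub>M\<^esub>" by (auto simp: ker_def)
    then show "z \<in> {z \<in> carrier P. q1 z \<in> ker P1 M1 \<pi>1 \<and> q2 z \<in> ker P2 M2 \<pi>2}"
      using r\<pi>[of z] j homs_zero[OF R(5,3) i(3)] homs_zero[OF R(5,4) i(4)] by (auto simp: ker_def)
  next
    fix z assume "z \<in> {z \<in> carrier P. q1 z \<in> ker P1 M1 \<pi>1 \<and> q2 z \<in> ker P2 M2 \<pi>2}"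
    then show "z \<in> ker P M \<pi>"
      using R homs_zero[OF R(3,5) i(1)] homs_zero[OF R(4,5) i(2)] by (auto simp: ker_def \<pi>_def)
  qed
  have kz: "\<zero>\<^bsub>P1\<^esub> \<in> ker P1 M1 \<pi>1" "\<zero>\<^bsub>P2\<^esub> \<in> ker P2 M2 \<pi>2"
    using R P1(2) P2(2) by (auto simp: ker_def homs_zero)
  have ks: "x \<in> ker P1 M1 \<pi>1 \<Longrightarrow> x \<in> carrier P1" "y \<in> ker P2 M2 \<pi>2 \<Longrightarrow> y \<in> carrier P2" for x y
    by (auto simp: ker_def)
  have b: "biprod (restr P (ker P M \<pi>)) (restr P1 (ker P1 M1 \<pi>1)) (restr P2 (ker P2 M2 \<pi>2)) j1 j2 q1 q2"
    unfolding biprod_def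
    by (intro conjI homsI ballI) (use j kz ks in \<open>auto simp: K homs_add homs_sm R P(1) ker_smod P1 P2\<close>)
  have "fd (restr P (ker P M \<pi>))" using sub_fd[OF fP] \<pi> P(1) R by simp
  then have "pd_le m (restr P (ker P M \<pi>))" using Suc.IH[OF D1 D2 _ b] by blast
  then show ?case using pP \<pi> sur Suc.prems by auto
qed

section \<open>Vanishing of Ext by lifting along an injective coresolution\<close>

text \<open>The coresolved module is not part of the data; it is recovered up to isomorphism as the
  kernel of \<delta> 0.\<close>

definition inj_coresolution :: "(nat \<Rightarrow> ('a, nat \<Rightarrow> 'k) module) \<Rightarrow> (nat \<Rightarrow> (nat \<Rightarrow> 'k) \<Rightarrow> (nat \<Rightarrow> 'k)) \<Rightarrow> bool" where
  "inj_coresolution J \<delta> \<longleftrightarrow> (\<forall>i. injective (J i)) \<and> (\<forall>i. \<delta> i \<in> homs (J i) (J (Suc i))) \<and>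
    (\<forall>i. \<delta> i ` carrier (J i) = ker (J (Suc i)) (J (Suc (Suc i))) (\<delta> (Suc i)))"

text \<open>
  By dimension shifting, \<open>Ext_vanishes J \<delta> j X\<close> says that \<open>Ext\<close> of degree \<open>j + 1\<close> from \<open>X\<close> to the
  kernel of \<open>\<delta> 0\<close> is zero.
\<close>

definition Ext_vanishes :: "(nat \<Rightarrow> ('a, nat \<Rightarrow> 'k) module) \<Rightarrow> (nat \<Rightarrow> (nat \<Rightarrow> 'k) \<Rightarrow> (nat \<Rightarrow> 'k)) \<Rightarrow> nat \<Rightarrow>
    ('a, nat \<Rightarrow> 'k) module \<Rightarrow> bool" where
  "Ext_vanishes J \<delta> j X \<longleftrightarrow> (\<forall>f\<in>homs X (J (Suc j)). (\<forall>x\<in>carrier X. \<delta> (Suc j) (f x) = \<zero>\<^bsub>J (Suc (Suc j))\<^esub>) \<longrightarrow>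
    (\<exists>g\<in>homs X (J j). \<forall>x\<in>carrier X. \<delta> j (g x) = f x))"

lemma inj_coresolutionD:
  assumes "inj_coresolution J \<delta>"
  shows "injective (J i)" "fd (J i)" "rmod (J i)" "\<delta> i \<in> homs (J i) (J (Suc i))"
    "y \<in> carrier (J i) \<Longrightarrow> \<delta> (Suc i) (\<delta> i y) = \<zero>\<^bsub>J (Suc (Suc i))\<^esub>"
proof -
  show "injective (J i)" "fd (J i)" "rmod (J i)" "\<delta> i \<in> homs (J i) (J (Suc i))"
    using assms by (auto simp: inj_coresolution_def)
  assume "y \<in> carrier (J i)"
  then have "\<delta> i y \<in> ker (J (Suc i)) (J (Suc (Suc i))) (\<delta> (Suc i))"
    using assms by (metis imageI inj_coresolution_def)
  then show "\<delta> (Suc i) (\<delta> i y) = \<zero>\<^bsub>J (Suc (Suc i))\<^esub>" by (simp add: ker_def)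
qed

lemma Ext_vanishesE:
  assumes "Ext_vanishes J \<delta> j X" "f \<in> homs X (J (Suc j))"
    "\<And>x. x \<in> carrier X \<Longrightarrow> \<delta> (Suc j) (f x) = \<zero>\<^bsub>J (Suc (Suc j))\<^esub>"
  obtains g where "g \<in> homs X (J j)" "\<And>x. x \<in> carrier X \<Longrightarrow> \<delta> j (g x) = f x"
  using assms unfolding Ext_vanishes_def by blast

lemma Ext_vanishesI:
  assumes "\<And>f. f \<in> homs X (J (Suc j)) \<Longrightarrow>
      (\<And>x. x \<in> carrier X \<Longrightarrow> \<delta> (Suc j) (f x) = \<zero>\<^bsub>J (Suc (Suc j))\<^esub>) \<Longrightarrow>
      \<exists>g\<in>homs X (J j). \<forall>x\<in>carrier X. \<delta> j (g x) = f x"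
  shows "Ext_vanishes J \<delta> j X"
  using assms unfolding Ext_vanishes_def by blast

text \<open>By exactness a cocycle has its values in the image of \<delta> j, onto which \<delta> j
  is surjective, so projectivity lifts it.\<close>

lemma proj_Ext_vanishes:
  assumes J: "inj_coresolution J \<delta>" and P: "projective P"
  shows "Ext_vanishes J \<delta> j P"
proof (rule Ext_vanishesI)
  fix f assume f: "f \<in> homs P (J (Suc j))"
    and z: "\<And>x. x \<in> carrier P \<Longrightarrow> \<delta> (Suc j) (f x) = \<zero>\<^bsub>J (Suc (Suc j))\<^esub>"
  note J' = inj_coresolutionD[OF J]
  define I where "I = \<delta> j ` carrier (J j)"
  have I: "smod I (J (Suc j))" unfolding I_def using J' by simp
  have "f x \<in> I" if "x \<in> carrier P" for x
    using that f z J unfolding I_def inj_coresolution_def by (auto simp: ker_def)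
  then have f': "f \<in> homs P (restr (J (Suc j)) I)" by (intro homs_restr_cod f)
  have g': "\<delta> j \<in> homs (J j) (restr (J (Suc j)) I)" by (intro homs_restr_cod J') (simp add: I_def)
  obtain h where "h \<in> homs P (J j)" "\<And>x. x \<in> carrier P \<Longrightarrow> \<delta> j (h x) = f x"
    using proj_lift[OF P J'(2)[of j] sub_fd[OF J'(2) I] g' _ f'] by (auto simp: I_def)
  then show "\<exists>g\<in>homs P (J j). \<forall>x\<in>carrier P. \<delta> j (g x) = f x" by blast
qed

text \<open>The part Ext^(j+1)(L) -> Ext^(j+2)(M) -> Ext^(j+2)(B) of the long exact sequence of 0 ->
  L -> B -> M -> 0, with both outer terms zero, carried out on lifts.\<close>

lemma Ext_vanishes_cokernel:
  assumes J: "inj_coresolution J \<delta>" and B: "fd B" and M: "fd M" and p: "p \<in> homs B M" "p ` carrier B = carrier M"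
    and L: "Ext_vanishes J \<delta> j (restr B (ker B M p))" and VB: "Ext_vanishes J \<delta> (Suc j) B"
  shows "Ext_vanishes J \<delta> (Suc j) M"
proof (rule Ext_vanishesI)
  note J' = inj_coresolutionD[OF J]
  let ?L = "ker B M p"
  have sL: "smod ?L B" using B M p by simp
  have sub: "x \<in> carrier B" if "x \<in> ?L" for x using that by (simp add: ker_def)
  fix f assume f: "f \<in> homs M (J (Suc (Suc j)))"
    and z: "\<And>x. x \<in> carrier M \<Longrightarrow> \<delta> (Suc (Suc j)) (f x) = \<zero>\<^bsub>J (Suc (Suc (Suc j)))\<^esub>"
  obtain g where g: "g \<in> homs B (J (Suc j))" "\<And>x. x \<in> carrier B \<Longrightarrow> \<delta> (Suc j) (g x) = f (p x)"
    using Ext_vanishesE[OF VB homs_comp[OF p(1) f]] z p by auto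
  have "\<delta> (Suc j) (g x) = \<zero>\<^bsub>J (Suc (Suc j))\<^esub>" if "x \<in> ?L" for x
    using that g f M J' by (auto simp: ker_def homs_zero)
  then obtain h where h: "h \<in> homs (restr B ?L) (J j)" "\<And>x. x \<in> ?L \<Longrightarrow> \<delta> j (h x) = g x"
    using Ext_vanishesE[OF L homs_restr_dom[OF g(1) sL]] by auto
  obtain h' where h': "h' \<in> homs B (J j)" "\<And>x. x \<in> ?L \<Longrightarrow> h' x = h x"
    using inj_extend[OF J'(1) B sL h(1)] by blast
  \<comment> \<open>The lift \<open>g\<close> need not vanish on the kernel L of \<open>p\<close>.
    There it equals \<delta> j of \<open>h\<close>, so subtracting \<delta> j of an extension of
    \<open>h\<close> makes it zero on L, while \<delta> (Suc j) does not see the correction.\<close>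
  define g' where "g' x = g x \<ominus>\<^bsub>J (Suc j)\<^esub> \<delta> j (h' x)" for x
  have g': "g' \<in> homs B (J (Suc j))"
    unfolding g'_def by (rule homs_diff[OF J'(3) g(1) homs_comp[OF h'(1) J'(4)]])
  have "g' x = \<zero>\<^bsub>J (Suc j)\<^esub>" if "x \<in> carrier B" "p x = \<zero>\<^bsub>M\<^esub>" for x
  proof -
    have x: "x \<in> ?L" using that by (simp add: ker_def)
    then have "\<delta> j (h' x) = g x" using h h' by simp
    then show ?thesis using that g(1) J'(3) by (simp add: g'_def)
  qed
  then obtain k where k: "k \<in> homs M (J (Suc j))" "\<And>x. x \<in> carrier B \<Longrightarrow> k (p x) = g' x"
    using factor_through[OF _ _ _ p g'] B M J' by (metis fd_rmod)
  have "\<delta> (Suc j) (k y) = f y" if y: "y \<in> carrier M" for y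
  proof -
    obtain x where x: "x \<in> carrier B" "y = p x" by (rule surjE[OF p(2) y])
    have "\<delta> (Suc j) (g' x) = \<delta> (Suc j) (g x) \<ominus>\<^bsub>J (Suc (Suc j))\<^esub> \<delta> (Suc j) (\<delta> j (h' x))"
      unfolding g'_def using x g h' J'(4)[of j] by (intro homs_minus[OF J'(3) J'(3) J'(4)]) auto
    also have "\<dots> = f y" using x g h' J'(5) f p J'(3) by simp
    finally show ?thesis using k x by simp
  qed
  then show "\<exists>g\<in>homs M (J (Suc j)). \<forall>x\<in>carrier M. \<delta> (Suc j) (g x) = f x" using k by blast
qed

text \<open>Each syzygy lowers the degree by one. Index j stands for degree j + 1, hence the bound m
  \<le> j.\<close>

lemma pd_le_imp_Ext_vanishes:
  assumes J: "inj_coresolution J \<delta>"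
  shows "pd_le m M \<Longrightarrow> m \<le> j \<Longrightarrow> Ext_vanishes J \<delta> j M"
proof (induction m arbitrary: M j)
  case 0
  then show ?case using proj_Ext_vanishes[OF J] by simp
next
  case (Suc m)
  then obtain j' where j: "j = Suc j'" "m \<le> j'" by (cases j) auto
  obtain P \<pi> where P: "projective P" "\<pi> \<in> homs P M" "\<pi> ` carrier P = carrier M"
    "pd_le m (restr P (ker P M \<pi>))" and M: "fd M" using Suc.prems by auto
  show ?case unfolding j(1)
    by (rule Ext_vanishes_cokernel[OF J _ M P(2,3) Suc.IH[OF P(4) j(2)] proj_Ext_vanishes[OF J P(1)]]) (use P in simp)
qed

text \<open>Dimension shifting: the connecting map from Ext of degree j + 1 of the syzygy to Ext of
  degree j + 2 of \<open>X\<close> is injective, because Ext of \<open>P\<close> vanishes.\<close>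

lemma Ext_vanishes_syzygy:
  assumes J: "inj_coresolution J \<delta>" and P: "projective P" and X: "fd X" and p: "p \<in> homs P X" "p ` carrier P = carrier X"
    and V: "Ext_vanishes J \<delta> (Suc j) X"
  shows "Ext_vanishes J \<delta> j (restr P (ker P X p))"
proof (rule Ext_vanishesI)
  note J' = inj_coresolutionD[OF J]
  let ?K = "ker P X p"
  have fP: "fd P" "rmod P" "rmod X" using P X by auto
  have sK: "smod ?K P" using fP p by simp
  have sub: "x \<in> carrier P" if "x \<in> ?K" for x using that by (simp add: ker_def)
  fix f assume f: "f \<in> homs (restr P ?K) (J (Suc j))"
    and z: "\<And>x. x \<in> carrier (restr P ?K) \<Longrightarrow> \<delta> (Suc j) (f x) = \<zero>\<^bsub>J (Suc (Suc j))\<^esub>"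
  obtain f' where f': "f' \<in> homs P (J (Suc j))" "\<And>x. x \<in> ?K \<Longrightarrow> f' x = f x"
    using inj_extend[OF J'(1) fP(1) sK f] by blast
  \<comment> \<open>The image of \<open>f\<close> under the connecting map: \<open>f\<close> extends
    to \<open>P\<close>, and \<delta> of the extension is zero on the syzygy and hence descends to
    \<open>X\<close>.\<close>
  obtain h where h: "h \<in> homs X (J (Suc (Suc j)))" "\<And>x. x \<in> carrier P \<Longrightarrow> h (p x) = \<delta> (Suc j) (f' x)"
    by (rule factor_through[OF fP(2,3) J'(3) p homs_comp[OF f'(1) J'(4)]]) (use f' z in \<open>auto simp: ker_def\<close>)
  have "\<delta> (Suc (Suc j)) (h y) = \<zero>\<^bsub>J (Suc (Suc (Suc j)))\<^esub>" if y: "y \<in> carrier X" for y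
  proof -
    obtain x where x: "x \<in> carrier P" "y = p x" by (rule surjE[OF p(2) y])
    then show ?thesis using h J'(5)[of "f' x" "Suc j"] f' by simp
  qed
  then obtain g where g: "g \<in> homs X (J (Suc j))" "\<And>y. y \<in> carrier X \<Longrightarrow> \<delta> (Suc j) (g y) = h y"
    using Ext_vanishesE[OF V h(1)] by blast
  define w where "w x = f' x \<ominus>\<^bsub>J (Suc j)\<^esub> g (p x)" for x
  have w: "w \<in> homs P (J (Suc j))"
    unfolding w_def by (rule homs_diff[OF J'(3) f'(1) homs_comp[OF p(1) g(1)]])
  have "\<delta> (Suc j) (w x) = \<zero>\<^bsub>J (Suc (Suc j))\<^esub>" if x: "x \<in> carrier P" for x
  proof -
    have "\<delta> (Suc j) (w x) = \<delta> (Suc j) (f' x) \<ominus>\<^bsub>J (Suc (Suc j))\<^esub> \<delta> (Suc j) (g (p x))"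
      unfolding w_def using x g f' p(1) by (intro homs_minus[OF J'(3) J'(3) J'(4)]) auto
    also have "\<dots> = \<zero>\<^bsub>J (Suc (Suc j))\<^esub>" using x g h p(1) f' J'(3) J'(4)[of "Suc j"] by simp
    finally show ?thesis .
  qed
  then obtain u where u: "u \<in> homs P (J j)" "\<And>x. x \<in> carrier P \<Longrightarrow> \<delta> j (u x) = w x"
    using Ext_vanishesE[OF proj_Ext_vanishes[OF J P] w] by blast
  have "\<delta> j (u x) = f x" if x: "x \<in> ?K" for x
  proof -
    have "g (p x) = \<zero>\<^bsub>J (Suc j)\<^esub>" using x g(1) fP J'(3) by (simp add: ker_def homs_zero)
    then show ?thesis using u(2)[OF sub[OF x]] f' x J'(3) homs_cl[OF f'(1) sub[OF x]] by (simp add: w_def)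
  qed
  then show "\<exists>g\<in>homs (restr P ?K) (J j). \<forall>x\<in>carrier (restr P ?K). \<delta> j (g x) = f x"
    using homs_restr_dom[OF u(1) sK] by auto
qed

text \<open>The coresolved module is here the kernel K of \<open>p\<close> itself. The class of 0 ->
  K -> P -> X -> 0 lies in Ext of degree 1 from X to K, which vanishes, so the sequence
  splits.\<close>

lemma Ext_vanishes_0_split:
  fixes P :: "('a, nat \<Rightarrow> 'k) module"
  assumes J: "inj_coresolution J \<delta>" and P: "fd P" and X: "fd X" and p: "p \<in> homs P X" "p ` carrier P = carrier X"
    and V: "Ext_vanishes J \<delta> 0 X"
    and \<iota>: "\<iota> \<in> homs (restr P (ker P X p)) (J 0)" "inj_on \<iota> (ker P X p)" "\<iota> ` ker P X p = ker (J 0) (J 1) (\<delta> 0)"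
  obtains \<rho> where "\<rho> \<in> homs P (restr P (ker P X p))" "\<And>x. x \<in> ker P X p \<Longrightarrow> \<rho> x = x"
proof -
  note J' = inj_coresolutionD[OF J]
  let ?K = "ker P X p"
  have R: "rmod P" "rmod X" using P X by auto
  have sK: "smod ?K P" using R p by simp
  have sub: "x \<in> carrier P" if "x \<in> ?K" for x using that by (simp add: ker_def)
  obtain i where i: "i \<in> homs P (J 0)" "\<And>x. x \<in> ?K \<Longrightarrow> i x = \<iota> x"
    using inj_extend[OF J'(1) P sK \<iota>(1)] by blast
  have \<iota>0: "\<delta> 0 (\<iota> x) = \<zero>\<^bsub>J 1\<^esub>" if "x \<in> ?K" for x
    using \<iota>(3) that by (auto simp: ker_def)
  obtain h where h: "h \<in> homs X (J 1)" "\<And>x. x \<in> carrier P \<Longrightarrow> h (p x) = \<delta> 0 (i x)"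
    using factor_through[OF R J'(3)[of "Suc 0"] p homs_comp[OF i(1) J'(4)]] i \<iota>0 by (auto simp: ker_def)
  have "\<delta> 1 (h y) = \<zero>\<^bsub>J 2\<^esub>" if y: "y \<in> carrier X" for y
  proof -
    obtain x where x: "x \<in> carrier P" "y = p x" by (rule surjE[OF p(2) y])
    then show ?thesis using h J'(5)[of "i x" 0] i by (simp add: numeral_2_eq_2)
  qed
  then obtain g where g: "g \<in> homs X (J 0)" "\<And>y. y \<in> carrier X \<Longrightarrow> \<delta> 0 (g y) = h y"
    using Ext_vanishesE[OF V, of h] h(1) by (auto simp: numeral_2_eq_2)
  \<comment> \<open>Subtracting the lift \<open>g\<close> of the obstruction \<open>h\<close>
    corrects \<open>i\<close> to a map with values in the kernel of \<delta> 0, the copy of K,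
    without changing it on K.\<close>
  define w where "w x = i x \<ominus>\<^bsub>J 0\<^esub> g (p x)" for x
  have w: "w \<in> homs P (J 0)"
    unfolding w_def by (rule homs_diff[OF J'(3) i(1) homs_comp[OF p(1) g(1)]])
  have wk: "w x \<in> \<iota> ` ?K" if x: "x \<in> carrier P" for x
  proof -
    have "\<delta> 0 (w x) = \<delta> 0 (i x) \<ominus>\<^bsub>J (Suc 0)\<^esub> \<delta> 0 (g (p x))"
      unfolding w_def using x g i p(1) by (intro homs_minus[OF J'(3) J'(3) J'(4)]) auto
    also have "\<dots> = \<zero>\<^bsub>J 1\<^esub>" using x g h p(1) i J'(3) J'(4)[of 0] by simp
    finally show ?thesis using \<iota>(3) x w by (auto simp: ker_def)
  qed
  have rK: "rmod (restr P ?K)" using R sK by simp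
  have "\<iota> \<in> homs (restr P ?K) (restr (J 0) (\<iota> ` ?K))" by (rule homs_restr_cod[OF \<iota>(1)]) simp
  moreover have "smod (\<iota> ` ?K) (J 0)" using img_smod[OF rK J'(3) \<iota>(1)] by simp
  ultimately obtain k where k: "k \<in> homs (restr (J 0) (\<iota> ` ?K)) (restr P ?K)"
    "\<And>x. x \<in> carrier (restr P ?K) \<Longrightarrow> k (\<iota> x) = x"
    by (rule_tac homs_inverse[OF rK, of "restr (J 0) (\<iota> ` ?K)" \<iota>]) (use \<iota>(2) J'(3) in auto)
  have "(\<lambda>x. k (w x)) \<in> homs P (restr P ?K)"
    by (rule homs_comp[OF homs_restr_cod[OF w wk] k(1)])
  moreover have "k (w x) = x" if x: "x \<in> ?K" for x
  proof -
    have "g (p x) = \<zero>\<^bsub>J 0\<^esub>" using x g(1) R J'(3) by (simp add: ker_def homs_zero)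
    then have "w x = \<iota> x" using x i homs_cl[OF i(1) sub[OF x]] J'(3) by (simp add: w_def)
    then show ?thesis using k x by simp
  qed
  ultimately show ?thesis by (rule that)
qed

lemma Ext_vanishes_retract:
  assumes "Ext_vanishes J \<delta> j M" "i \<in> homs X M" "r \<in> homs M X" "\<And>x. x \<in> carrier X \<Longrightarrow> r (i x) = x"
  shows "Ext_vanishes J \<delta> j X"
proof (rule Ext_vanishesI)
  fix f assume f: "f \<in> homs X (J (Suc j))"
    and z: "\<And>x. x \<in> carrier X \<Longrightarrow> \<delta> (Suc j) (f x) = \<zero>\<^bsub>J (Suc (Suc j))\<^esub>"
  obtain g where g: "g \<in> homs M (J j)" "\<And>x. x \<in> carrier M \<Longrightarrow> \<delta> j (g x) = f (r x)"
    using Ext_vanishesE[OF assms(1) homs_comp[OF assms(3) f]] z assms(3) by auto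
  show "\<exists>g\<in>homs X (J j). \<forall>x\<in>carrier X. \<delta> j (g x) = f x"
    by (rule bexI[OF _ homs_comp[OF assms(2) g(1)]]) (use g assms in auto)
qed

end

section \<open>Uniserial modules over a Nakayama algebra\<close>

text \<open>
  \<open>\<xi>\<close> is the sum of all arrows, and the index of the idempotent \<open>e i\<close> counts modulo \<open>N\<close>. The linear
  quiver is covered as well: it is the cyclic one with the last arrow set to zero, so that for its
  last vertex both sides of \<open>e_xi\<close> vanish.
\<close>

locale nakayama = kalgebra A for A :: "('k::field, 'a) module" (structure) +
  fixes N nil :: nat and e :: "nat \<Rightarrow> 'a" and \<xi> :: 'a
  assumes fd_regular: "fd_module A (regular_module A)"
    and N_pos: "N > 0"
    and e_cl [simp]: "e i \<in> carrier A"
    and e_mult: "e i \<otimes> e j = (if i mod N = j mod N then e i else \<zero>)"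
    and e_mod: "e (i mod N) = e i"
    and xi_cl [simp]: "\<xi> \<in> carrier A"
    and e_xi: "e i \<otimes> \<xi> = \<xi> \<otimes> e (Suc i)"
    and xi_nil: "\<xi> [^] nil = \<zero>"
    and A_induct: "\<And>a P. a \<in> carrier A \<Longrightarrow> P \<zero> \<Longrightarrow>
      (\<And>a b. a \<in> carrier A \<Longrightarrow> b \<in> carrier A \<Longrightarrow> P a \<Longrightarrow> P b \<Longrightarrow> P (a \<oplus> b)) \<Longrightarrow>
      (\<And>c i t. P ((c \<odot> \<one>) \<otimes> (e i \<otimes> \<xi> [^] (t::nat)))) \<Longrightarrow> P a"
begin

lemmas A_induct' [consumes 1, case_names zero add basis] = A_induct

definition xpow :: "nat \<Rightarrow> 'a" where "xpow t = \<xi> [^] t"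

lemma xpow_cl [simp]: "xpow t \<in> carrier A" by (simp add: xpow_def)
lemma xpow_0 [simp]: "xpow 0 = \<one>" by (simp add: xpow_def)
lemma xpow_1 [simp]: "xpow (Suc 0) = \<xi>" by (simp add: xpow_def)
lemma xpow_add: "xpow (s + t) = xpow s \<otimes> xpow t" by (simp add: xpow_def A.nat_pow_mult)
lemma xpow_nil: "nil \<le> t \<Longrightarrow> xpow t = \<zero>"
  using xpow_add[of nil "t - nil"] by (simp add: xpow_def xi_nil)

lemma e_cong: "i mod N = j mod N \<Longrightarrow> e i = e j"
  by (metis e_mod)
lemma mod_add_cancel:
  assumes "(i + u) mod N = (j + u) mod N" shows "i mod N = j mod N"
proof -
  \<comment> \<open>Adding u another N - 1 times turns it into a multiple of \<open>N\<close>, which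
    replaces subtraction in the natural numbers.\<close>
  have *: "x + u + (N - 1) * u = x + N * u" for x
    using N_pos by (cases N) auto
  have "(i + u + (N - 1) * u) mod N = (j + u + (N - 1) * u) mod N"
    using assms by (metis mod_add_left_eq)
  then show ?thesis unfolding * by simp
qed
lemma e_shift [simp]: "e (i + k * N) = e i" "e (i + N * k) = e i"
  by (auto intro: e_cong)

lemma e_xpow: "e i \<otimes> xpow t = xpow t \<otimes> e (i + t)"
proof (induction t)
  case (Suc t)
  have "e i \<otimes> xpow (Suc t) = (e i \<otimes> xpow t) \<otimes> \<xi>"
    using xpow_add[of t 1] by (simp add: A.m_assoc)
  also have "\<dots> = xpow t \<otimes> (\<xi> \<otimes> e (Suc (i + t)))"
    unfolding Suc by (simp add: A.m_assoc e_xi)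
  also have "\<dots> = xpow (Suc t) \<otimes> e (i + Suc t)"
    using xpow_add[of t 1] by (simp add: A.m_assoc)
  finally show ?case .
qed simp

lemma xpow_xpow: "rmod M \<Longrightarrow> m \<in> carrier M \<Longrightarrow> xpow s \<odot>\<^bsub>M\<^esub> (xpow t \<odot>\<^bsub>M\<^esub> m) = xpow (s + t) \<odot>\<^bsub>M\<^esub> m"
  by (simp add: add.commute[of s t] xpow_add sm_mult)
lemma xi_xpow: "rmod M \<Longrightarrow> m \<in> carrier M \<Longrightarrow> \<xi> \<odot>\<^bsub>M\<^esub> (xpow t \<odot>\<^bsub>M\<^esub> m) = xpow (Suc t) \<odot>\<^bsub>M\<^esub> m"
  using xpow_xpow[of M m 1 t] by simp
lemma xpow_xi: "rmod M \<Longrightarrow> m \<in> carrier M \<Longrightarrow> xpow t \<odot>\<^bsub>M\<^esub> (\<xi> \<odot>\<^bsub>M\<^esub> m) = xpow (Suc t) \<odot>\<^bsub>M\<^esub> m"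
  using xpow_xpow[of M m t 1] by simp
lemma e_e_sm: "rmod M \<Longrightarrow> m \<in> carrier M \<Longrightarrow>
    e j \<odot>\<^bsub>M\<^esub> (e i \<odot>\<^bsub>M\<^esub> m) = (if i mod N = j mod N then e i \<odot>\<^bsub>M\<^esub> m else \<zero>\<^bsub>M\<^esub>)"
  by (simp add: sm_mult[symmetric] e_mult)
lemma e_xpow_sm: "rmod M \<Longrightarrow> m \<in> carrier M \<Longrightarrow> e (i + t) \<odot>\<^bsub>M\<^esub> (xpow t \<odot>\<^bsub>M\<^esub> m) = xpow t \<odot>\<^bsub>M\<^esub> (e i \<odot>\<^bsub>M\<^esub> m)"
  by (simp add: sm_mult[symmetric] e_xpow)
lemma e_hom: "rmod M \<Longrightarrow> v \<in> carrier M \<Longrightarrow> e a \<odot>\<^bsub>M\<^esub> v = v \<Longrightarrow>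
    e i \<odot>\<^bsub>M\<^esub> v = (if a mod N = i mod N then v else \<zero>\<^bsub>M\<^esub>)"
  by (metis e_e_sm)
lemma e_xpow_hom: "rmod M \<Longrightarrow> v \<in> carrier M \<Longrightarrow> e a \<odot>\<^bsub>M\<^esub> v = v \<Longrightarrow> e (a + t) \<odot>\<^bsub>M\<^esub> (xpow t \<odot>\<^bsub>M\<^esub> v) = xpow t \<odot>\<^bsub>M\<^esub> v"
  by (simp add: e_xpow_sm)

lemma basis_sm:
  assumes "rmod M" "v \<in> carrier M"
  shows "((c \<odot> \<one>) \<otimes> (e i \<otimes> \<xi> [^] (t::nat))) \<odot>\<^bsub>M\<^esub> v = sc c \<odot>\<^bsub>M\<^esub> (xpow t \<odot>\<^bsub>M\<^esub> (e i \<odot>\<^bsub>M\<^esub> v))"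
  using assms by (simp add: sc_def[symmetric] xpow_def[symmetric] sm_mult sc_sm_comm)

text \<open>Scalars, idempotents and \<xi> generate the algebra, by \<open>A_induct\<close>.\<close>

lemma hmI_generators:
  assumes M: "rmod M" and Y: "rmod Y" and cl: "\<And>m. m \<in> carrier M \<Longrightarrow> F m \<in> carrier Y"
    and add: "\<And>m m'. m \<in> carrier M \<Longrightarrow> m' \<in> carrier M \<Longrightarrow> F (m \<oplus>\<^bsub>M\<^esub> m') = F m \<oplus>\<^bsub>Y\<^esub> F m'"
    and sc: "\<And>c m. m \<in> carrier M \<Longrightarrow> F (sc c \<odot>\<^bsub>M\<^esub> m) = sc c \<odot>\<^bsub>Y\<^esub> F m"
    and e: "\<And>i m. m \<in> carrier M \<Longrightarrow> F (e i \<odot>\<^bsub>M\<^esub> m) = e i \<odot>\<^bsub>Y\<^esub> F m"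
    and xi: "\<And>m. m \<in> carrier M \<Longrightarrow> F (\<xi> \<odot>\<^bsub>M\<^esub> m) = \<xi> \<odot>\<^bsub>Y\<^esub> F m"
  shows "F \<in> homs M Y"
proof (rule homsI)
  fix a m assume "a \<in> carrier A" "m \<in> carrier M"
  then show "F (a \<odot>\<^bsub>M\<^esub> m) = a \<odot>\<^bsub>Y\<^esub> F m"
  proof (induction a rule: A_induct')
    case zero
    then show ?case using sc[of m 0] M Y cl by simp
  next
    case (add a b)
    then show ?case using M Y cl assms(4) by (simp add: sm_addl)
  next
    case (basis c i t)
    have "F (xpow t \<odot>\<^bsub>M\<^esub> m') = xpow t \<odot>\<^bsub>Y\<^esub> F m'" if "m' \<in> carrier M" for m'
    proof (induction t)
      case (Suc t)
      have "F (xpow (Suc t) \<odot>\<^bsub>M\<^esub> m') = F (\<xi> \<odot>\<^bsub>M\<^esub> (xpow t \<odot>\<^bsub>M\<^esub> m'))" using that M by (simp add: xi_xpow)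
      also have "\<dots> = \<xi> \<odot>\<^bsub>Y\<^esub> (xpow t \<odot>\<^bsub>Y\<^esub> F m')" using that M Suc by (simp add: xi)
      finally show ?case using that Y cl by (simp add: xi_xpow)
    qed (use that M Y cl in simp)
    then show ?case using basis M Y cl by (simp add: basis_sm sc e)
  qed
qed (use assms in auto)

section \<open>Submodules generated by one homogeneous vector\<close>

definition cyclic :: "('a, 'b) module \<Rightarrow> 'b \<Rightarrow> 'b set" where
  "cyclic M v = (\<lambda>r. r \<odot>\<^bsub>M\<^esub> v) ` carrier A"

lemma cyclic_restr [simp]: "cyclic (restr M T) v = cyclic M v" by (simp add: cyclic_def)

lemma cyclic_smod [simp]:
  assumes "rmod M" "v \<in> carrier M" shows "smod (cyclic M v) M"
  unfolding cyclic_def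
proof (rule smodI)
  show "\<zero>\<^bsub>M\<^esub> \<in> (\<lambda>r. r \<odot>\<^bsub>M\<^esub> v) ` carrier A" using assms by (auto intro: image_eqI[of _ _ \<zero>])
qed (use assms in \<open>auto simp: sm_addl[symmetric] sm_mult[symmetric]\<close>)

lemma cyclic_self [simp]: "rmod M \<Longrightarrow> v \<in> carrier M \<Longrightarrow> v \<in> cyclic M v"
  unfolding cyclic_def by (auto intro: image_eqI[of _ _ \<one>])

lemma cyclic_sub: "rmod M \<Longrightarrow> smod T M \<Longrightarrow> v \<in> T \<Longrightarrow> cyclic M v \<subseteq> T"
  by (auto simp: cyclic_def)

text \<open>Every idempotent fixes or kills the homogeneous vector v, so v A is spanned by the v
  \<xi>^t.\<close>

lemma cyclic_induct [consumes 4, case_names zero add basis]: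
  assumes M: "rmod M" "v \<in> carrier M" "e a \<odot>\<^bsub>M\<^esub> v = v" and y: "y \<in> cyclic M v"
    and zero: "Q \<zero>\<^bsub>M\<^esub>"
    and add: "\<And>y z. y \<in> cyclic M v \<Longrightarrow> z \<in> cyclic M v \<Longrightarrow> Q y \<Longrightarrow> Q z \<Longrightarrow> Q (y \<oplus>\<^bsub>M\<^esub> z)"
    and basis: "\<And>c t. Q (sc c \<odot>\<^bsub>M\<^esub> (xpow t \<odot>\<^bsub>M\<^esub> v))"
  shows "Q y"
proof -
  obtain r where r: "r \<in> carrier A" "y = r \<odot>\<^bsub>M\<^esub> v" using y by (auto simp: cyclic_def)
  have "Q (r \<odot>\<^bsub>M\<^esub> v)"
    using r(1)
  proof (induction r rule: A_induct')
    case zero then show ?case using assms(5) M by simp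
  next
    case (add a b)
    then show ?case using assms(6)[of "a \<odot>\<^bsub>M\<^esub> v" "b \<odot>\<^bsub>M\<^esub> v"] M by (auto simp: sm_addl cyclic_def)
  next
    case (basis c i t)
    show ?case using assms(7)[of c t] assms(5) M e_hom[OF M, of i] by (simp add: basis_sm)
  qed
  then show ?thesis using r by simp
qed

text \<open>Modulo its radical, the multiples of \<xi>, the module v A is spanned by v.\<close>

lemma cyclic_decomp:
  assumes M: "rmod M" "v \<in> carrier M" "e a \<odot>\<^bsub>M\<^esub> v = v" and y: "y \<in> cyclic M v"
  shows "\<exists>c. \<exists>z\<in>cyclic M v. y = sc c \<odot>\<^bsub>M\<^esub> v \<oplus>\<^bsub>M\<^esub> \<xi> \<odot>\<^bsub>M\<^esub> z"
  using M y
proof (induction rule: cyclic_induct)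
  case zero
  show ?case using M by (intro exI[of _ 0] bexI[of _ "\<zero>\<^bsub>M\<^esub>"]) auto
next
  case (add y z)
  note o = smod_in[OF cyclic_smod[OF M(1,2)]]
  from add obtain c y' d z' where
    "y' \<in> cyclic M v" "y = sc c \<odot>\<^bsub>M\<^esub> v \<oplus>\<^bsub>M\<^esub> \<xi> \<odot>\<^bsub>M\<^esub> y'" "z' \<in> cyclic M v" "z = sc d \<odot>\<^bsub>M\<^esub> v \<oplus>\<^bsub>M\<^esub> \<xi> \<odot>\<^bsub>M\<^esub> z'" by blast
  moreover from this M o have "(sc c \<odot>\<^bsub>M\<^esub> v \<oplus>\<^bsub>M\<^esub> \<xi> \<odot>\<^bsub>M\<^esub> y') \<oplus>\<^bsub>M\<^esub> (sc d \<odot>\<^bsub>M\<^esub> v \<oplus>\<^bsub>M\<^esub> \<xi> \<odot>\<^bsub>M\<^esub> z') =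
      sc (c + d) \<odot>\<^bsub>M\<^esub> v \<oplus>\<^bsub>M\<^esub> \<xi> \<odot>\<^bsub>M\<^esub> (y' \<oplus>\<^bsub>M\<^esub> z')"
    by (simp add: madd_add_add sc_sm_plus sm_addr)
  ultimately show ?case using M smod_add[OF cyclic_smod[OF M(1,2)]] by metis
next
  case (basis c t)
  have S: "smod (cyclic M v) M" using M by simp
  show ?case
  proof (cases t)
    case 0
    then show ?thesis using M by (intro exI[of _ c] bexI[of _ "\<zero>\<^bsub>M\<^esub>"]) auto
  next
    case (Suc u)
    then show ?thesis using M S
      by (intro exI[of _ 0] bexI[of _ "sc c \<odot>\<^bsub>M\<^esub> (xpow u \<odot>\<^bsub>M\<^esub> v)"]) (auto simp: sc_sm_comm xi_xpow)
  qed
qed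

lemma xpow_cyclic:
  assumes M: "rmod M" "v \<in> carrier M" "e a \<odot>\<^bsub>M\<^esub> v = v" and y: "y \<in> cyclic M v"
  shows "xpow s \<odot>\<^bsub>M\<^esub> y \<in> cyclic M (xpow s \<odot>\<^bsub>M\<^esub> v)"
  using M y
proof (induction rule: cyclic_induct)
  case zero
  show ?case using M by simp
next
  case (add y z)
  then show ?case using M smod_in[OF cyclic_smod[OF M(1,2)]] by (simp add: sm_addr)
next
  case (basis c t)
  have S: "smod (cyclic M (xpow s \<odot>\<^bsub>M\<^esub> v)) M" using M by simp
  have "xpow s \<odot>\<^bsub>M\<^esub> (sc c \<odot>\<^bsub>M\<^esub> (xpow t \<odot>\<^bsub>M\<^esub> v)) = sc c \<odot>\<^bsub>M\<^esub> (xpow t \<odot>\<^bsub>M\<^esub> (xpow s \<odot>\<^bsub>M\<^esub> v))"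
    using M by (simp add: sc_sm_comm xpow_xpow add.commute)
  then show ?case using M S by simp
qed

lemma xpow_cyclic_zero:
  assumes M: "rmod M" "v \<in> carrier M" "e a \<odot>\<^bsub>M\<^esub> v = v" and y: "y \<in> cyclic M v" and z: "xpow s \<odot>\<^bsub>M\<^esub> v = \<zero>\<^bsub>M\<^esub>"
  shows "xpow s \<odot>\<^bsub>M\<^esub> y = \<zero>\<^bsub>M\<^esub>"
  using xpow_cyclic[OF M y, of s] z M by (auto simp: cyclic_def)

lemma hom_eq_cyclic:
  assumes "f \<in> homs M Y" "g \<in> homs M Y" "v \<in> carrier M" "f v = g v" "y \<in> cyclic M v"
  shows "f y = g y"
  using assms by (auto simp: cyclic_def homs_sm)

lemma exists_e_nonzero:
  assumes M: "rmod M" "m \<in> carrier M" "m \<noteq> \<zero>\<^bsub>M\<^esub>"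
  shows "\<exists>i. e i \<odot>\<^bsub>M\<^esub> m \<noteq> \<zero>\<^bsub>M\<^esub>"
proof (rule ccontr)
  assume "\<not> ?thesis"
  then have z: "e i \<odot>\<^bsub>M\<^esub> m = \<zero>\<^bsub>M\<^esub>" for i by blast
  have "r \<odot>\<^bsub>M\<^esub> m = \<zero>\<^bsub>M\<^esub>" if "r \<in> carrier A" for r
    using that
  proof (induction r rule: A_induct')
    case (basis c i t)
    show ?case using M z by (simp add: basis_sm)
  qed (use M in \<open>auto simp: sm_addl\<close>)
  from this[OF A.one_closed] show False using M by simp
qed

subsection \<open>Combinations of the vectors \<open>v \<xi>\<^sup>t\<close>\<close>

primrec lin_comb :: "('a, 'b) module \<Rightarrow> 'b \<Rightarrow> (nat \<Rightarrow> 'k) \<Rightarrow> nat \<Rightarrow> 'b" where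
  "lin_comb M v c 0 = \<zero>\<^bsub>M\<^esub>"
| "lin_comb M v c (Suc t) = lin_comb M v c t \<oplus>\<^bsub>M\<^esub> sc (c t) \<odot>\<^bsub>M\<^esub> (xpow t \<odot>\<^bsub>M\<^esub> v)"

context
  fixes M :: "('a, 'b) module" and v
  assumes M: "rmod M" and v: "v \<in> carrier M"
begin

lemma lin_comb_cl [simp]: "lin_comb M v c n \<in> carrier M"
  using M v by (induction n) auto
lemma lin_comb_cyclic: "lin_comb M v c n \<in> cyclic M v"
  using smod_zero[OF cyclic_smod[OF M v]] smod_add[OF cyclic_smod[OF M v]] smod_sm[OF cyclic_smod[OF M v]] cyclic_self[OF M v]
  by (induction n) auto
lemma lin_comb_add: "lin_comb M v (\<lambda>t. c t + d t) n = lin_comb M v c n \<oplus>\<^bsub>M\<^esub> lin_comb M v d n"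
  using M v by (induction n) (auto simp: sc_sm_plus madd_ac)
lemma lin_comb_scale: "lin_comb M v (\<lambda>t. k * c t) n = sc k \<odot>\<^bsub>M\<^esub> lin_comb M v c n"
  using M v by (induction n) (auto simp: sc_sm_times sm_addr)
lemma lin_comb_cong: "(\<And>t. t < n \<Longrightarrow> c t = d t) \<Longrightarrow> lin_comb M v c n = lin_comb M v d n"
  by (induction n) auto
lemma lin_comb_unit: "lin_comb M v (\<lambda>u. if u = t then 1 else 0) n = (if t < n then xpow t \<odot>\<^bsub>M\<^esub> v else \<zero>\<^bsub>M\<^esub>)"
  using M v by (induction n) (auto simp: less_Suc_eq)
lemma xi_lin_comb: "\<xi> \<odot>\<^bsub>M\<^esub> lin_comb M v c n = lin_comb M v (case_nat 0 c) (Suc n)"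
  using M v by (induction n) (auto simp: sm_addr sc_sm_comm xi_xpow)
lemma e_lin_comb: "e a \<odot>\<^bsub>M\<^esub> v = v \<Longrightarrow>
    e i \<odot>\<^bsub>M\<^esub> lin_comb M v c n = lin_comb M v (\<lambda>t. if (a + t) mod N = i mod N then c t else 0) n"
proof (induction n)
  case (Suc n)
  have "e i \<odot>\<^bsub>M\<^esub> (xpow n \<odot>\<^bsub>M\<^esub> v) = (if (a + n) mod N = i mod N then xpow n \<odot>\<^bsub>M\<^esub> v else \<zero>\<^bsub>M\<^esub>)"
    using M v Suc.prems by (intro e_hom) (auto simp: e_xpow_hom)
  then show ?case using M v Suc by (simp add: sm_addr sc_sm_comm)
qed (use M in simp)
text \<open>Reads off the lowest nonzero coefficient: the term at u lands on the socle vector v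
  \<xi>^(l-1), and all later terms are pushed beyond it.\<close>

lemma xpow_lin_comb:
  assumes "xpow l \<odot>\<^bsub>M\<^esub> v = \<zero>\<^bsub>M\<^esub>" "u < l" "\<And>u'. u' < u \<Longrightarrow> c u' = 0"
  shows "xpow (l - 1 - u) \<odot>\<^bsub>M\<^esub> lin_comb M v c n = (if u < n then sc (c u) \<odot>\<^bsub>M\<^esub> (xpow (l - 1) \<odot>\<^bsub>M\<^esub> v) else \<zero>\<^bsub>M\<^esub>)"
proof (induction n)
  case (Suc n)
  have *: "xpow (l - 1 - u) \<odot>\<^bsub>M\<^esub> (sc (c n) \<odot>\<^bsub>M\<^esub> (xpow n \<odot>\<^bsub>M\<^esub> v)) = sc (c n) \<odot>\<^bsub>M\<^esub> (xpow (l - 1 - u + n) \<odot>\<^bsub>M\<^esub> v)"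
    using M v by (simp add: sc_sm_comm xpow_xpow)
  consider "n < u" | "n = u" | "n > u" by linarith
  then show ?case
  proof cases
    case 3
    then have "l - 1 - u + n = (n - Suc u) + l" using assms(2) by simp
    then have "xpow (l - 1 - u + n) \<odot>\<^bsub>M\<^esub> v = xpow (n - Suc u) \<odot>\<^bsub>M\<^esub> (xpow l \<odot>\<^bsub>M\<^esub> v)"
      using xpow_xpow[OF M v, of "n - Suc u" l] by simp
    then show ?thesis using 3 * Suc M v assms by (simp add: sm_addr)
  next
    case 2
    then have "l - 1 - u + n = l - 1" using assms(2) by simp
    then show ?thesis using 2 * Suc M v by (simp add: sm_addr)
  next
    case 1
    then show ?thesis using * Suc M v assms(3) by (simp add: sm_addr)
  qed
qed (use M in simp)

end

lemma lfunD:
  assumes "lfun M \<phi>"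
  shows "m \<in> carrier M \<Longrightarrow> m' \<in> carrier M \<Longrightarrow> \<phi> (m \<oplus>\<^bsub>M\<^esub> m') = \<phi> m + \<phi> m'"
    "m \<in> carrier M \<Longrightarrow> \<phi> (sc c \<odot>\<^bsub>M\<^esub> m) = c * \<phi> m"
  using assms by (auto simp: lfun_def)

text \<open>
  A homomorphism into \<open>v A\<close> is determined by its coefficient at the socle \<open>v \<xi>\<^sup>l\<^sup>-\<^sup>1\<close>. The formula below
  recovers it from that coefficient \<open>\<phi>\<close>; it yields both the splitting of pure uniserial submodules
  and the injectivity of maximal uniserial modules.
\<close>

lemma functional_hom:
  assumes M: "rmod M" and J: "rmod J" "v \<in> carrier J" "e a \<odot>\<^bsub>J\<^esub> v = v" "xpow l \<odot>\<^bsub>J\<^esub> v = \<zero>\<^bsub>J\<^esub>" "l > 0"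
    and \<phi>: "lfun M \<phi>" and \<phi>e: "\<And>m. m \<in> carrier M \<Longrightarrow> \<phi> (e (a + l - 1) \<odot>\<^bsub>M\<^esub> m) = \<phi> m"
    and \<phi>l: "\<And>m. m \<in> carrier M \<Longrightarrow> \<phi> (xpow l \<odot>\<^bsub>M\<^esub> m) = 0"
  shows "(\<lambda>m. lin_comb J v (\<lambda>t. \<phi> (xpow (l - 1 - t) \<odot>\<^bsub>M\<^esub> m)) l) \<in> homs M J"
proof (rule hmI_generators[OF M J(1)])
  note \<phi>' = lfunD[OF \<phi>]
  fix m assume m: "m \<in> carrier M"
  show "lin_comb J v (\<lambda>t. \<phi> (xpow (l - 1 - t) \<odot>\<^bsub>M\<^esub> (m \<oplus>\<^bsub>M\<^esub> m'))) l =
    lin_comb J v (\<lambda>t. \<phi> (xpow (l - 1 - t) \<odot>\<^bsub>M\<^esub> m)) l \<oplus>\<^bsub>J\<^esub> lin_comb J v (\<lambda>t. \<phi> (xpow (l - 1 - t) \<odot>\<^bsub>M\<^esub> m')) l"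
    if "m' \<in> carrier M" for m'
    using m that M J by (simp add: lin_comb_add[symmetric] sm_addr \<phi>')
  show "lin_comb J v (\<lambda>t. \<phi> (xpow (l - 1 - t) \<odot>\<^bsub>M\<^esub> (sc c \<odot>\<^bsub>M\<^esub> m))) l =
    sc c \<odot>\<^bsub>J\<^esub> lin_comb J v (\<lambda>t. \<phi> (xpow (l - 1 - t) \<odot>\<^bsub>M\<^esub> m)) l" for c
    using m M J by (simp add: lin_comb_scale[symmetric] sc_sm_comm \<phi>')
  show "lin_comb J v (\<lambda>t. \<phi> (xpow (l - 1 - t) \<odot>\<^bsub>M\<^esub> (\<xi> \<odot>\<^bsub>M\<^esub> m))) l =
    \<xi> \<odot>\<^bsub>J\<^esub> lin_comb J v (\<lambda>t. \<phi> (xpow (l - 1 - t) \<odot>\<^bsub>M\<^esub> m)) l"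
  proof -
    have "\<xi> \<odot>\<^bsub>J\<^esub> lin_comb J v (\<lambda>t. \<phi> (xpow (l - 1 - t) \<odot>\<^bsub>M\<^esub> m)) l =
      lin_comb J v (case_nat 0 (\<lambda>t. \<phi> (xpow (l - 1 - t) \<odot>\<^bsub>M\<^esub> m))) l"
      using J by (simp add: xi_lin_comb)
    \<comment> \<open>Multiplication by \<xi> shifts the coefficients. The term leaving at position
      l was zero as v \<xi>^l = 0, and the new coefficient at 0 has to be \<phi> (m \<xi>^l), which
      vanishes by assumption.\<close>
    also have "\<dots> = lin_comb J v (\<lambda>t. \<phi> (xpow (l - 1 - t) \<odot>\<^bsub>M\<^esub> (\<xi> \<odot>\<^bsub>M\<^esub> m))) l"
    proof (rule lin_comb_cong[OF J(1,2)])
      fix t assume t: "t < l"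
      show "(case t of 0 \<Rightarrow> 0 | Suc t \<Rightarrow> \<phi> (xpow (l - 1 - t) \<odot>\<^bsub>M\<^esub> m)) = \<phi> (xpow (l - 1 - t) \<odot>\<^bsub>M\<^esub> (\<xi> \<odot>\<^bsub>M\<^esub> m))"
      proof (cases t)
        case 0
        then show ?thesis using \<phi>l m M J(5) by (simp add: xpow_xi)
      next
        case (Suc u)
        then have "Suc (l - 1 - t) = l - 1 - u" using t by simp
        then show ?thesis using Suc m M by (simp add: xpow_xi)
      qed
    qed
    finally show ?thesis by simp
  qed
  show "lin_comb J v (\<lambda>t. \<phi> (xpow (l - 1 - t) \<odot>\<^bsub>M\<^esub> (e i \<odot>\<^bsub>M\<^esub> m))) l =
    e i \<odot>\<^bsub>J\<^esub> lin_comb J v (\<lambda>t. \<phi> (xpow (l - 1 - t) \<odot>\<^bsub>M\<^esub> m)) l" for i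
    unfolding e_lin_comb[OF J(1-3)]
  proof (rule lin_comb_cong[OF J(1,2)])
    fix t assume t: "t < l"
    define u where "u = l - 1 - t"
    have au: "a + l - 1 = (a + t) + u" using t by (simp add: u_def)
    have y: "e (i + u) \<odot>\<^bsub>M\<^esub> (xpow u \<odot>\<^bsub>M\<^esub> m) = xpow u \<odot>\<^bsub>M\<^esub> (e i \<odot>\<^bsub>M\<^esub> m)" using m M by (rule e_xpow_sm[rotated])
    \<comment> \<open>The vector m e_i \<xi>^u sits at vertex i + u, and \<phi> sees only the vertex
      a + l - 1 = (a + t) + u.\<close>
    have "\<phi> (xpow u \<odot>\<^bsub>M\<^esub> (e i \<odot>\<^bsub>M\<^esub> m)) = (if (a + t) mod N = i mod N then \<phi> (xpow u \<odot>\<^bsub>M\<^esub> m) else 0)"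
    proof (cases "(a + t) mod N = i mod N")
      case True
      then have "e (a + l - 1) = e (i + u)" unfolding au by (intro e_cong) (metis mod_add_left_eq)
      then show ?thesis using y \<phi>e[of "xpow u \<odot>\<^bsub>M\<^esub> m"] m M True by simp
    next
      case False
      have "(i + u) mod N \<noteq> (a + l - 1) mod N"
        unfolding au using False mod_add_cancel[of i u "a + t"] by metis
      then have "e (a + l - 1) \<odot>\<^bsub>M\<^esub> (e (i + u) \<odot>\<^bsub>M\<^esub> (xpow u \<odot>\<^bsub>M\<^esub> m)) = \<zero>\<^bsub>M\<^esub>"
        using m M by (simp add: e_e_sm)
      then have "\<phi> (xpow u \<odot>\<^bsub>M\<^esub> (e i \<odot>\<^bsub>M\<^esub> m)) = \<phi> \<zero>\<^bsub>M\<^esub>"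
        unfolding y using \<phi>e[of "xpow u \<odot>\<^bsub>M\<^esub> (e i \<odot>\<^bsub>M\<^esub> m)"] m M by simp
      then show ?thesis using False lfun_0[OF \<phi> M] by simp
    qed
    then show "\<phi> (xpow (l - 1 - t) \<odot>\<^bsub>M\<^esub> (e i \<odot>\<^bsub>M\<^esub> m)) = (if (a + t) mod N = i mod N then \<phi> (xpow (l - 1 - t) \<odot>\<^bsub>M\<^esub> m) else 0)"
      by (simp add: u_def)
  qed
qed (use J in auto)

text \<open>The coefficients \<phi> (v \<xi>^(l-1-t)) are 1 at t = 0 and 0 otherwise. Hence the map
  of \<open>functional_hom\<close> is the identity on v A.\<close>

lemma functional_hom_generator:
  assumes J: "rmod J" "v \<in> carrier J" and l: "l > 0"
    and \<phi>: "\<And>t. t < l - 1 \<Longrightarrow> \<phi> (xpow t \<odot>\<^bsub>J\<^esub> v) = 0" "\<phi> (xpow (l - 1) \<odot>\<^bsub>J\<^esub> v) = 1"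
  shows "lin_comb J v (\<lambda>t. \<phi> (xpow (l - 1 - t) \<odot>\<^bsub>J\<^esub> v)) l = v"
proof -
  have "lin_comb J v (\<lambda>t. \<phi> (xpow (l - 1 - t) \<odot>\<^bsub>J\<^esub> v)) l = lin_comb J v (\<lambda>u. if u = 0 then 1 else 0) l"
    by (rule lin_comb_cong[OF J]) (use \<phi> in auto)
  then show ?thesis using lin_comb_unit[OF J, of 0 l] l J by simp
qed

text \<open>Supplies the functional for \<open>functional_hom\<close> and
  \<open>functional_hom_generator\<close>. It has to kill the span of the v \<xi>^t above the socle
  and of M \<xi>^l; the hypothesis \<open>s\<close>, a purity condition, keeps the socle vector
  outside that span.\<close>

lemma socle_functional:
  assumes M: "fd M" and v: "v \<in> carrier M" "e a \<odot>\<^bsub>M\<^esub> v = v" "xpow l \<odot>\<^bsub>M\<^esub> v = \<zero>\<^bsub>M\<^esub>" "l > 0"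
    and s: "\<And>m. m \<in> carrier M \<Longrightarrow> xpow (l - 1) \<odot>\<^bsub>M\<^esub> v \<noteq> xpow l \<odot>\<^bsub>M\<^esub> m"
  obtains \<phi> where "lfun M \<phi>" "\<And>m. m \<in> carrier M \<Longrightarrow> \<phi> (e (a + l - 1) \<odot>\<^bsub>M\<^esub> m) = \<phi> m"
    "\<And>m. m \<in> carrier M \<Longrightarrow> \<phi> (xpow l \<odot>\<^bsub>M\<^esub> m) = 0"
    "\<And>t. t < l - 1 \<Longrightarrow> \<phi> (xpow t \<odot>\<^bsub>M\<^esub> v) = 0" "\<phi> (xpow (l - 1) \<odot>\<^bsub>M\<^esub> v) = 1"
proof -
  have R: "rmod M" using M by simp
  let ?\<sigma> = "a + l - 1"
  define W where "W = {lin_comb M v c (l - 1) \<oplus>\<^bsub>M\<^esub> xpow l \<odot>\<^bsub>M\<^esub> m | c m. m \<in> carrier M}"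
  have WI: "lin_comb M v c (l - 1) \<oplus>\<^bsub>M\<^esub> xpow l \<odot>\<^bsub>M\<^esub> m \<in> W" if "m \<in> carrier M" for c m
    using that by (auto simp: W_def)
  have lc0: "lin_comb M v (\<lambda>_. 0) n = \<zero>\<^bsub>M\<^esub>" for n using R v by (induction n) auto
  have Wx: "xpow l \<odot>\<^bsub>M\<^esub> m \<in> W" if "m \<in> carrier M" for m
    using WI[OF that, of "\<lambda>_. 0"] that R by (simp add: lc0)
  have Wv: "xpow t \<odot>\<^bsub>M\<^esub> v \<in> W" if "t < l - 1" for t
    using WI[of "\<zero>\<^bsub>M\<^esub>" "\<lambda>u. if u = t then 1 else 0"] that R v by (simp add: lin_comb_unit)
  have W: "ksub M W"
    unfolding ksub_def
  proof (intro conjI ballI allI)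
    show "\<zero>\<^bsub>M\<^esub> \<in> W" using Wx[of "\<zero>\<^bsub>M\<^esub>"] R by simp
    fix y assume "y \<in> W"
    then obtain c m where y: "m \<in> carrier M" "y = lin_comb M v c (l - 1) \<oplus>\<^bsub>M\<^esub> xpow l \<odot>\<^bsub>M\<^esub> m" by (auto simp: W_def)
    have "sc k \<odot>\<^bsub>M\<^esub> y = lin_comb M v (\<lambda>t. k * c t) (l - 1) \<oplus>\<^bsub>M\<^esub> xpow l \<odot>\<^bsub>M\<^esub> (sc k \<odot>\<^bsub>M\<^esub> m)" for k
      using y R v by (simp add: lin_comb_scale sm_addr sc_sm_comm)
    then show "sc k \<odot>\<^bsub>M\<^esub> y \<in> W" for k using WI y R by simp
    fix z assume "z \<in> W"
    then obtain d n where z: "n \<in> carrier M" "z = lin_comb M v d (l - 1) \<oplus>\<^bsub>M\<^esub> xpow l \<odot>\<^bsub>M\<^esub> n" by (auto simp: W_def)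
    have "y \<oplus>\<^bsub>M\<^esub> z = lin_comb M v (\<lambda>t. c t + d t) (l - 1) \<oplus>\<^bsub>M\<^esub> xpow l \<odot>\<^bsub>M\<^esub> (m \<oplus>\<^bsub>M\<^esub> n)"
      using y z R v by (simp add: lin_comb_add sm_addr madd_add_add)
    then show "y \<oplus>\<^bsub>M\<^esub> z \<in> W" using WI y z R by simp
  qed (use R v in \<open>auto simp: W_def\<close>)
  have sW: "xpow (l - 1) \<odot>\<^bsub>M\<^esub> v \<notin> W"
  proof
    assume "xpow (l - 1) \<odot>\<^bsub>M\<^esub> v \<in> W"
    then obtain c m where m: "m \<in> carrier M"
      and y: "xpow (l - 1) \<odot>\<^bsub>M\<^esub> v = lin_comb M v c (l - 1) \<oplus>\<^bsub>M\<^esub> xpow l \<odot>\<^bsub>M\<^esub> m" by (auto simp: W_def)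
    \<comment> \<open>Lowest coefficient first: multiplying the relation by \<xi>^(l-1-u) moves the
      term at u to the socle and kills the later ones, so a nonzero \<open>c u\<close> would put the
      socle vector into M \<xi>^l, against \<open>s\<close>.\<close>
    have "c u = 0" if "u < l - 1" for u
      using that
    proof (induction u rule: less_induct)
      case (less u)
      have u: "u < l" using less by simp
      have 1: "xpow (l - 1 - u) \<odot>\<^bsub>M\<^esub> lin_comb M v c (l - 1) = sc (c u) \<odot>\<^bsub>M\<^esub> (xpow (l - 1) \<odot>\<^bsub>M\<^esub> v)"
        using xpow_lin_comb[OF R v(1,3) u, of c "l - 1"] less by simp
      have "l - 1 - u + (l - 1) = (l - 2 - u) + l" using less by simp
      then have 2: "xpow (l - 1 - u) \<odot>\<^bsub>M\<^esub> (xpow (l - 1) \<odot>\<^bsub>M\<^esub> v) = \<zero>\<^bsub>M\<^esub>"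
        using v R xpow_xpow[OF R v(1), of "l - 2 - u" l] by (simp add: xpow_xpow)
      have 3: "xpow (l - 1 - u) \<odot>\<^bsub>M\<^esub> (xpow l \<odot>\<^bsub>M\<^esub> m) = xpow l \<odot>\<^bsub>M\<^esub> (xpow (l - 1 - u) \<odot>\<^bsub>M\<^esub> m)"
        using R m by (simp add: xpow_xpow add.commute)
      have "\<zero>\<^bsub>M\<^esub> = sc (c u) \<odot>\<^bsub>M\<^esub> (xpow (l - 1) \<odot>\<^bsub>M\<^esub> v) \<oplus>\<^bsub>M\<^esub> xpow l \<odot>\<^bsub>M\<^esub> (xpow (l - 1 - u) \<odot>\<^bsub>M\<^esub> m)"
        using arg_cong[OF y, of "\<lambda>z. xpow (l - 1 - u) \<odot>\<^bsub>M\<^esub> z"] R v m 1 2 3 by (simp add: sm_addr)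
      then have 4: "xpow l \<odot>\<^bsub>M\<^esub> (xpow (l - 1 - u) \<odot>\<^bsub>M\<^esub> m) = \<ominus>\<^bsub>M\<^esub> (sc (c u) \<odot>\<^bsub>M\<^esub> (xpow (l - 1) \<odot>\<^bsub>M\<^esub> v))"
        using R v m by (intro mneg_unique) auto
      show "c u = 0"
      proof (rule ccontr)
        assume c: "c u \<noteq> 0"
        have "xpow l \<odot>\<^bsub>M\<^esub> (\<ominus>\<^bsub>M\<^esub> (sc (1 / c u) \<odot>\<^bsub>M\<^esub> (xpow (l - 1 - u) \<odot>\<^bsub>M\<^esub> m))) =
            \<ominus>\<^bsub>M\<^esub> (sc (1 / c u) \<odot>\<^bsub>M\<^esub> (xpow l \<odot>\<^bsub>M\<^esub> (xpow (l - 1 - u) \<odot>\<^bsub>M\<^esub> m)))"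
          using R m by (simp add: sm_negr sc_sm_comm)
        also have "\<dots> = sc (1 / c u) \<odot>\<^bsub>M\<^esub> (sc (c u) \<odot>\<^bsub>M\<^esub> (xpow (l - 1) \<odot>\<^bsub>M\<^esub> v))"
          unfolding 4 using R v by (simp add: sm_negr)
        also have "\<dots> = xpow (l - 1) \<odot>\<^bsub>M\<^esub> v" using R v c by (simp add: sc_sm_times[symmetric])
        finally show False using s R m by (metis mneg_cl sc_cl sm_cl xpow_cl)
      qed
    qed
    then have "lin_comb M v c (l - 1) = lin_comb M v (\<lambda>_. 0) (l - 1)" using R v by (intro lin_comb_cong) auto
    then have "xpow (l - 1) \<odot>\<^bsub>M\<^esub> v = xpow l \<odot>\<^bsub>M\<^esub> m" using y R m by (simp add: lc0)
    then show False using s m by blast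
  qed
  have "xpow (l - 1) \<odot>\<^bsub>M\<^esub> v \<in> carrier M" using R v by simp
  from separating_functional[OF M W this sW] obtain \<phi> where
    \<phi>: "lfun M \<phi>" "\<And>w. w \<in> W \<Longrightarrow> \<phi> w = 0" "\<phi> (xpow (l - 1) \<odot>\<^bsub>M\<^esub> v) = 1" by blast
  show ?thesis
  proof (rule that[of "\<lambda>m. \<phi> (e ?\<sigma> \<odot>\<^bsub>M\<^esub> m)"])
    show "lfun M (\<lambda>m. \<phi> (e ?\<sigma> \<odot>\<^bsub>M\<^esub> m))"
      using lfunD[OF \<phi>(1)] R by (auto simp: lfun_def sm_addr sc_sm_comm)
    show "\<phi> (e ?\<sigma> \<odot>\<^bsub>M\<^esub> (e ?\<sigma> \<odot>\<^bsub>M\<^esub> m)) = \<phi> (e ?\<sigma> \<odot>\<^bsub>M\<^esub> m)" if "m \<in> carrier M" for m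
      using R that by (simp add: e_e_sm)
    show "\<phi> (e ?\<sigma> \<odot>\<^bsub>M\<^esub> (xpow l \<odot>\<^bsub>M\<^esub> m)) = 0" if m: "m \<in> carrier M" for m
    proof -
      \<comment> \<open>Rewrites the vertex as i + l modulo \<open>N\<close> with i a natural
        number, so that the idempotent can be moved past \<xi>^l.\<close>
      have "?\<sigma> + (N - 1) * l + l = ?\<sigma> + N * l"
        using N_pos by (cases N) auto
      then have "e ?\<sigma> = e (?\<sigma> + (N - 1) * l + l)" by (metis e_shift(2))
      then have "e ?\<sigma> \<odot>\<^bsub>M\<^esub> (xpow l \<odot>\<^bsub>M\<^esub> m) = xpow l \<odot>\<^bsub>M\<^esub> (e (?\<sigma> + (N - 1) * l) \<odot>\<^bsub>M\<^esub> m)"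
        using e_xpow_sm[OF R m, of "?\<sigma> + (N - 1) * l" l] by simp
      then show ?thesis using \<phi>(2) Wx R m by simp
    qed
    show "\<phi> (e ?\<sigma> \<odot>\<^bsub>M\<^esub> (xpow t \<odot>\<^bsub>M\<^esub> v)) = 0" if t: "t < l - 1" for t
    proof -
      have "e ?\<sigma> \<odot>\<^bsub>M\<^esub> (xpow t \<odot>\<^bsub>M\<^esub> v) \<in> {\<zero>\<^bsub>M\<^esub>, xpow t \<odot>\<^bsub>M\<^esub> v}"
        using e_hom[OF R _ e_xpow_hom[OF R v(1,2)], of t ?\<sigma>] R v by simp
      then show ?thesis using \<phi>(2) Wv[OF t] W by (auto simp: ksub_def)
    qed
    have "a + (l - 1) = ?\<sigma>" using v by simp
    then show "\<phi> (e ?\<sigma> \<odot>\<^bsub>M\<^esub> (xpow (l - 1) \<odot>\<^bsub>M\<^esub> v)) = 1"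
      using e_xpow_hom[OF R v(1,2), of "l - 1"] \<phi>(3) by simp
  qed
qed

text \<open>
  \<open>uniserial M a b v\<close>: the module is generated by \<open>v\<close> and its composition factors, from the top to
  the socle, are the simple modules at the vertices \<open>a, \<dots>, b - 1\<close> counted modulo \<open>N\<close>. The zero module is
  the case \<open>a = b\<close>. We think of \<open>M\<close> as the interval \<open>[a, b)\<close>.
\<close>

definition uniserial :: "('a, 'b) module \<Rightarrow> nat \<Rightarrow> nat \<Rightarrow> 'b \<Rightarrow> bool" where
  "uniserial M a b v \<longleftrightarrow> fd M \<and> a \<le> b \<and> v \<in> carrier M \<and> e a \<odot>\<^bsub>M\<^esub> v = v \<and> carrier M = cyclic M v \<and>
    (\<forall>t. xpow t \<odot>\<^bsub>M\<^esub> v = \<zero>\<^bsub>M\<^esub> \<longleftrightarrow> b - a \<le> t)"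

text \<open>For the largest t with s in M \<xi>^t, the vector s is not divisible by \<xi>^(t+1).
  This is the purity that \<open>socle_functional\<close> asks for, and the resulting homomorphism
  retracts \<open>M\<close> onto v A. The bound \<open>nil \<le> \<sigma>\<close> makes \<sigma> - t
  an untruncated difference.\<close>

lemma socle_summand:
  assumes M: "fd M" and s: "s \<in> carrier M" "s \<noteq> \<zero>\<^bsub>M\<^esub>" "e \<sigma> \<odot>\<^bsub>M\<^esub> s = s" "\<xi> \<odot>\<^bsub>M\<^esub> s = \<zero>\<^bsub>M\<^esub>" and \<sigma>: "nil \<le> \<sigma>"
  obtains t v F where "t \<le> \<sigma>" "v \<in> carrier M" "uniserial (restr M (cyclic M v)) (\<sigma> - t) (Suc \<sigma>) v" "s = xpow t \<odot>\<^bsub>M\<^esub> v"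
    "\<And>t' w. w \<in> carrier M \<Longrightarrow> s = xpow t' \<odot>\<^bsub>M\<^esub> w \<Longrightarrow> t' \<le> t"
    "F \<in> homs M (restr M (cyclic M v))" "\<And>y. y \<in> cyclic M v \<Longrightarrow> F y = y"
proof -
  have R: "rmod M" using M by simp
  define Q where "Q t \<longleftrightarrow> (\<exists>w\<in>carrier M. s = xpow t \<odot>\<^bsub>M\<^esub> w)" for t
  have Qb: "t \<le> nil" if "Q t" for t
    using that s R xpow_nil[of t] by (cases "t \<le> nil") (auto simp: Q_def)
  have Q0: "Q 0" using s R by (auto simp: Q_def)
  define t where "t = (GREATEST t. Q t)"
  have t: "Q t" "\<And>t'. Q t' \<Longrightarrow> t' \<le> t"
    unfolding t_def using GreatestI_nat[of Q 0 nil] Greatest_le_nat[of Q _ nil] Qb Q0 by auto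
  obtain w where w: "w \<in> carrier M" "s = xpow t \<odot>\<^bsub>M\<^esub> w" using t by (auto simp: Q_def)
  have t\<sigma>: "t \<le> \<sigma>" using Qb[OF t(1)] \<sigma> by simp
  \<comment> \<open>As s lies at vertex \<sigma>, only the component of w at vertex \<sigma> - t
    contributes to it.\<close>
  define v where "v = e (\<sigma> - t) \<odot>\<^bsub>M\<^esub> w"
  have v: "v \<in> carrier M" "e (\<sigma> - t) \<odot>\<^bsub>M\<^esub> v = v" using w R by (auto simp: v_def e_e_sm)
  have sv: "xpow t \<odot>\<^bsub>M\<^esub> v = s"
    using e_xpow_sm[OF R w(1), of "\<sigma> - t" t] t\<sigma> s w by (simp add: v_def)
  have l0: "xpow (Suc t) \<odot>\<^bsub>M\<^esub> v = \<zero>\<^bsub>M\<^esub>" using xi_xpow[OF R v(1), of t] sv s by simp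
  have sl: "xpow (Suc t - 1) \<odot>\<^bsub>M\<^esub> v \<noteq> xpow (Suc t) \<odot>\<^bsub>M\<^esub> m" if "m \<in> carrier M" for m
    using t(2)[of "Suc t"] that sv by (auto simp: Q_def)
  obtain \<phi> where \<phi>: "lfun M \<phi>" "\<And>m. m \<in> carrier M \<Longrightarrow> \<phi> (e (\<sigma> - t + Suc t - 1) \<odot>\<^bsub>M\<^esub> m) = \<phi> m"
    "\<And>m. m \<in> carrier M \<Longrightarrow> \<phi> (xpow (Suc t) \<odot>\<^bsub>M\<^esub> m) = 0"
    "\<And>u. u < Suc t - 1 \<Longrightarrow> \<phi> (xpow u \<odot>\<^bsub>M\<^esub> v) = 0" "\<phi> (xpow (Suc t - 1) \<odot>\<^bsub>M\<^esub> v) = 1"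
    by (rule socle_functional[OF M v l0 zero_less_Suc]) (use sl that in blast)+
  define F where "F m = lin_comb M v (\<lambda>u. \<phi> (xpow (Suc t - 1 - u) \<odot>\<^bsub>M\<^esub> m)) (Suc t)" for m
  have F: "F \<in> homs M M"
    unfolding F_def by (rule functional_hom[OF R R v l0 zero_less_Suc \<phi>(1)]) (use \<phi>(2,3) in simp_all)
  have Fv: "F v = v"
    unfolding F_def by (rule functional_hom_generator[OF R v(1) zero_less_Suc]) (use \<phi>(4,5) in simp_all)
  have F1: "F y = y" if "y \<in> cyclic M v" for y
    using hom_eq_cyclic[OF F homs_id v(1) _ that] Fv by simp
  have F2: "F \<in> homs M (restr M (cyclic M v))"
    by (rule homs_restr_cod[OF F]) (unfold F_def, rule lin_comb_cyclic[OF R v(1)])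
  have "xpow u \<odot>\<^bsub>M\<^esub> v = \<zero>\<^bsub>M\<^esub> \<longleftrightarrow> Suc t \<le> u" for u
  proof
    assume z: "xpow u \<odot>\<^bsub>M\<^esub> v = \<zero>\<^bsub>M\<^esub>"
    show "Suc t \<le> u"
    proof (rule ccontr)
      assume "\<not> Suc t \<le> u"
      then have "s = xpow (t - u) \<odot>\<^bsub>M\<^esub> (xpow u \<odot>\<^bsub>M\<^esub> v)" using sv R v by (simp add: xpow_xpow)
      then show False using z s R by simp
    qed
  next
    assume "Suc t \<le> u"
    then have "xpow u \<odot>\<^bsub>M\<^esub> v = xpow (u - Suc t) \<odot>\<^bsub>M\<^esub> (xpow (Suc t) \<odot>\<^bsub>M\<^esub> v)" using R v by (simp add: xpow_xpow)
    then show "xpow u \<odot>\<^bsub>M\<^esub> v = \<zero>\<^bsub>M\<^esub>" using l0 R by simp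
  qed
  then have "uniserial (restr M (cyclic M v)) (\<sigma> - t) (Suc \<sigma>) v"
    unfolding uniserial_def using sub_fd[OF M cyclic_smod[OF R v(1)]] v R t\<sigma> by (auto simp: Suc_diff_le)
  then show ?thesis using that[OF t\<sigma> v(1) _ sv[symmetric] _ F2 F1] t(2) by (auto simp: Q_def)
qed

end

section \<open>Indecomposable projectives, and the quotients and kernels of maps between
  intervals\<close>

context nakayama
begin

text \<open>
  The indecomposable projective module with top at \<open>a\<close> is the interval \<open>[a, proj_end a)\<close>.
\<close>

definition proj_length :: "nat \<Rightarrow> nat" where "proj_length a = (LEAST t. e a \<otimes> xpow t = \<zero>)"
definition proj_end :: "nat \<Rightarrow> nat" where "proj_end a = a + proj_length a"

lemma e_xpow_zero_iff: "e a \<otimes> xpow t = \<zero> \<longleftrightarrow> proj_length a \<le> t"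
proof
  assume "proj_length a \<le> t"
  have "e a \<otimes> xpow (proj_length a) = \<zero>"
    unfolding proj_length_def by (rule LeastI[of _ nil]) (simp add: xpow_nil)
  moreover have "e a \<otimes> xpow t = (e a \<otimes> xpow (proj_length a)) \<otimes> xpow (t - proj_length a)"
    using \<open>proj_length a \<le> t\<close> xpow_add[of "proj_length a" "t - proj_length a"] by (simp add: A.m_assoc)
  ultimately show "e a \<otimes> xpow t = \<zero>" by simp
qed (simp add: proj_length_def Least_le)

text \<open>The Kupisch condition: since e_a \<xi>^(t+1) = \<xi> e_(a+1) \<xi>^t, a path from a + 1
  that vanishes also vanishes when prolonged backwards to a. So \<open>proj_length\<close> drops by
  at most one from a to a + 1.\<close>

lemma proj_end_mono: "a \<le> b \<Longrightarrow> proj_end a \<le> proj_end b"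
proof (rule lift_Suc_mono_le[of proj_end])
  fix a
  have "e a \<otimes> xpow (Suc (proj_length (Suc a))) = \<xi> \<otimes> (e (Suc a) \<otimes> xpow (proj_length (Suc a)))"
    using xpow_add[of 1 "proj_length (Suc a)"] by (simp add: A.m_assoc[symmetric] e_xi)
  also have "\<dots> = \<zero>" using e_xpow_zero_iff[of "Suc a" "proj_length (Suc a)"] by simp
  finally show "proj_end a \<le> proj_end (Suc a)" by (simp add: e_xpow_zero_iff proj_end_def)
qed

lemma uniserialD:
  assumes "uniserial M a b v"
  shows "fd M" "rmod M" "a \<le> b" "v \<in> carrier M" "e a \<odot>\<^bsub>M\<^esub> v = v" "cyclic M v = carrier M"
    "\<And>t. xpow t \<odot>\<^bsub>M\<^esub> v = \<zero>\<^bsub>M\<^esub> \<longleftrightarrow> b - a \<le> t"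
  using assms by (auto simp: uniserial_def)

lemma homs_cyclic: "f \<in> homs M Y \<Longrightarrow> v \<in> carrier M \<Longrightarrow> f ` cyclic M v = cyclic Y (f v)"
  by (auto simp: cyclic_def homs_sm image_image)

lemma uniserial_le_proj_end: "uniserial M a b v \<Longrightarrow> b \<le> proj_end a"
proof -
  assume g: "uniserial M a b v"
  note g' = uniserialD[OF g]
  have "xpow (proj_length a) \<odot>\<^bsub>M\<^esub> v = (e a \<otimes> xpow (proj_length a)) \<odot>\<^bsub>M\<^esub> v" using g' by (simp add: sm_mult)
  also have "\<dots> = \<zero>\<^bsub>M\<^esub>" using g' e_xpow_zero_iff[of a "proj_length a"] by simp
  finally show ?thesis using g' by (simp add: proj_end_def)
qed

lemma uniserial_nonzero: "uniserial M a b v \<Longrightarrow> a < b \<Longrightarrow> v \<noteq> \<zero>\<^bsub>M\<^esub>"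
  using uniserialD(7)[of M a b v 0] uniserialD(2,4)[of M a b v] by auto

lemma uniserial_trivial: "uniserial M a a v \<Longrightarrow> carrier M = {\<zero>\<^bsub>M\<^esub>}"
proof -
  assume g: "uniserial M a a v"
  note g' = uniserialD[OF g]
  have v0: "v = \<zero>\<^bsub>M\<^esub>" using g'(7)[of 0] g' by simp
  have "cyclic M v = {\<zero>\<^bsub>M\<^esub>}" unfolding v0 cyclic_def using g'(2) by (auto intro: image_eqI[of _ _ \<one>])
  then show ?thesis using g' by simp
qed

text \<open>Vertices count modulo \<open>N\<close>, so an interval may be moved up until the later
  subtractions are not truncated.\<close>

lemma uniserial_shift: "uniserial M a b v \<Longrightarrow> uniserial M (a + k * N) (b + k * N) v"
  by (auto simp: uniserial_def)

lemma uniserial_sub: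
  assumes g: "uniserial M c b v" and a: "c \<le> a" "a \<le> b"
  shows "uniserial (restr M (cyclic M (xpow (a - c) \<odot>\<^bsub>M\<^esub> v))) a b (xpow (a - c) \<odot>\<^bsub>M\<^esub> v)"
proof -
  note g' = uniserialD[OF g]
  have "e a \<odot>\<^bsub>M\<^esub> (xpow (a - c) \<odot>\<^bsub>M\<^esub> v) = xpow (a - c) \<odot>\<^bsub>M\<^esub> v"
    using e_xpow_hom[OF g'(2,4,5), of "a - c"] a by simp
  moreover have "xpow t \<odot>\<^bsub>M\<^esub> (xpow (a - c) \<odot>\<^bsub>M\<^esub> v) = \<zero>\<^bsub>M\<^esub> \<longleftrightarrow> b - a \<le> t" for t
    using g' a by (auto simp: xpow_xpow)
  ultimately show ?thesis
    using a g' sub_fd[OF g'(1) cyclic_smod[OF g'(2)]] by (simp add: uniserial_def)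
qed

lemma uniserial_iso:
  assumes g: "uniserial M a b v" and f: "f \<in> homs M Y" "inj_on f (carrier M)" "f ` carrier M = carrier Y" and Y: "fd Y"
  shows "uniserial Y a b (f v)"
proof -
  note g' = uniserialD[OF g]
  have Y': "rmod Y" using Y by simp
  have "xpow t \<odot>\<^bsub>Y\<^esub> f v = \<zero>\<^bsub>Y\<^esub> \<longleftrightarrow> xpow t \<odot>\<^bsub>M\<^esub> v = \<zero>\<^bsub>M\<^esub>" for t
  proof -
    have "xpow t \<odot>\<^bsub>Y\<^esub> f v = f (xpow t \<odot>\<^bsub>M\<^esub> v)" using f g' by (simp add: homs_sm)
    then show ?thesis using homs_inj_iff[OF g'(2) Y' f(1)] f(2) g'(2,4) homs_zero[OF g'(2) Y' f(1)] by (auto simp del: homs_cl)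
  qed
  moreover have "e a \<odot>\<^bsub>Y\<^esub> f v = f v" using f g' by (simp add: homs_sm[symmetric])
  moreover have "carrier Y = cyclic Y (f v)"
    using homs_cyclic[OF f(1) g'(4)] f(3) g'(6) by simp
  ultimately show ?thesis
    unfolding uniserial_def using Y g'(3,7) homs_cl[OF f(1) g'(4)] by blast
qed

lemma regular_simps:
  "carrier (regular_module A) = carrier A" "zero (regular_module A) = \<zero>"
  "add (regular_module A) = (\<oplus>)" "r \<odot>\<^bsub>regular_module A\<^esub> y = y \<otimes> r"
  by (simp_all add: regular_module_def)

text \<open>A copy of e_a A in the type that \<open>projective_module\<close> speaks of. The last
  clause is the existence part of Hom(e_a A, M) = M e_a.\<close>

definition is_cover :: "('a, nat \<Rightarrow> 'k) module \<Rightarrow> nat \<Rightarrow> (nat \<Rightarrow> 'k) \<Rightarrow> bool" where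
  "is_cover Q a u \<longleftrightarrow> projective Q \<and> uniserial Q a (proj_end a) u \<and>
    (\<forall>(M :: ('a, nat \<Rightarrow> 'k) module) m. rmod M \<longrightarrow> m \<in> carrier M \<longrightarrow> e a \<odot>\<^bsub>M\<^esub> m = m \<longrightarrow> (\<exists>\<pi>\<in>homs Q M. \<pi> u = m))"

lemma exists_cover:
  obtains Q u where "is_cover Q a u"
proof -
  define R where "R = regular_module A"
  note R = regular_simps[folded R_def]
  have fR: "fd R" "rmod R" using fd_regular by (auto simp: R_def)
  define S where "S = restr R (cyclic R (e a))"
  have sm: "smod (cyclic R (e a)) R" using fR by (simp add: R)
  have fS: "fd S" using sub_fd[OF fR(1) sm] by (simp add: S_def)
  have gS: "uniserial S a (proj_end a) (e a)"
    using fS fR by (auto simp: uniserial_def S_def proj_end_def R e_mult e_xpow_zero_iff)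
  obtain Q :: "('a, nat \<Rightarrow> 'k) module" and r where Q: "fd Q" "r \<in> homs S Q" "r ` carrier S = carrier Q" "inj_on r (carrier S)"
    by (rule fd_copy[OF fS])
  obtain k where k: "k \<in> homs Q S" "\<And>y. y \<in> carrier S \<Longrightarrow> k (r y) = y"
    by (rule homs_inverse[OF _ _ Q(2,4,3)]) (use fS Q(1) that in auto)
  have gQ: "uniserial Q a (proj_end a) (r (e a))" by (rule uniserial_iso[OF gS Q(2,4,3,1)])
  have ea: "e a \<in> carrier S" using uniserialD(4)[OF gS] .
  have univ: "\<exists>\<pi>\<in>homs Q M. \<pi> (r (e a)) = m"
    if M: "rmod M" "m \<in> carrier M" "e a \<odot>\<^bsub>M\<^esub> m = m" for M :: "('a, nat \<Rightarrow> 'k) module" and m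
  proof -
    have "(\<lambda>y. y \<odot>\<^bsub>M\<^esub> m) \<in> homs R M"
      by (rule homsI) (use M in \<open>auto simp: R sm_addl sm_mult\<close>)
    then have "(\<lambda>y. y \<odot>\<^bsub>M\<^esub> m) \<in> homs S M" unfolding S_def by (rule homs_restr_dom[OF _ sm])
    from homs_comp[OF k(1) this] show ?thesis by (rule bexI[rotated]) (simp add: k ea M)
  qed
  have "projective Q"
  proof (rule projectiveI[OF Q(1)])
    fix X Y :: "('a, nat \<Rightarrow> 'k) module" and g f
    assume a: "fd X" "fd Y" "g \<in> homs X Y" "g ` carrier X = carrier Y" "f \<in> homs Q Y"
    let ?u = "r (e a)"
    note u = uniserialD[OF gQ]
    obtain z where z: "z \<in> carrier X" "f ?u = g z" by (rule surjE[OF a(4) homs_cl[OF a(5) u(4)]])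
    \<comment> \<open>An arbitrary preimage z of the image of the generator is replaced by z e_a, to
      which the universal property applies; its image is unchanged because the generator is fixed by
      e_a.\<close>
    have "e a \<odot>\<^bsub>X\<^esub> (e a \<odot>\<^bsub>X\<^esub> z) = e a \<odot>\<^bsub>X\<^esub> z" using a z by (simp add: e_e_sm)
    then obtain h where h: "h \<in> homs Q X" "h ?u = e a \<odot>\<^bsub>X\<^esub> z" using univ[of X "e a \<odot>\<^bsub>X\<^esub> z"] a z by auto
    have gh: "g (h ?u) = f ?u"
      using h a z u homs_sm[OF a(5), of "e a" ?u] by (simp add: homs_sm)
    have "g (h y) = f y" if "y \<in> carrier Q" for y
      using hom_eq_cyclic[of "\<lambda>y. g (h y)" Q Y f ?u y] homs_comp[OF h(1) a(3)] a(5) u(4,6) gh that by simp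
    then show "\<exists>h\<in>homs Q X. \<forall>x\<in>carrier Q. g (h x) = f x" using h by blast
  qed
  then have "is_cover Q a (r (e a))" unfolding is_cover_def using gQ univ by blast
  then show ?thesis by (rule that)
qed

lemma cover_kernel:
  assumes P: "uniserial P a b' u" and X: "uniserial X a b v" and \<pi>: "\<pi> \<in> homs P X" "\<pi> u = v"
  shows "\<pi> ` carrier P = carrier X" "b \<le> b'" "ker P X \<pi> = cyclic P (xpow (b - a) \<odot>\<^bsub>P\<^esub> u)"
proof -
  note P' = uniserialD[OF P] and X' = uniserialD[OF X]
  have h0: "\<pi> \<zero>\<^bsub>P\<^esub> = \<zero>\<^bsub>X\<^esub>" by (rule homs_zero[OF P'(2) X'(2) \<pi>(1)])
  have \<pi>x: "\<pi> (xpow t \<odot>\<^bsub>P\<^esub> u) = xpow t \<odot>\<^bsub>X\<^esub> v" for t using P' \<pi> by (simp add: homs_sm)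
  show "\<pi> ` carrier P = carrier X"
    using homs_cyclic[OF \<pi>(1) P'(4)] P'(6) X'(6) \<pi>(2) by simp
  have "xpow (b' - a) \<odot>\<^bsub>X\<^esub> v = \<zero>\<^bsub>X\<^esub>"
    using \<pi>x[of "b' - a"] P'(7)[of "b' - a"] h0 by simp
  then show "b \<le> b'" using X' P' by simp
  \<comment> \<open>Divisibility of y by \<xi>^t improves one step at a time. In y = (c u + z'
    \<xi>) \<xi>^t the scalar c is zero: a further factor \<xi>^(l-1-t) pushes the image of the
    relation onto the nonzero socle vector of \<open>X\<close> and kills the multiple of
    \<xi>^l.\<close>
  have claim: "\<exists>z\<in>carrier P. y = xpow t \<odot>\<^bsub>P\<^esub> z" if y: "y \<in> ker P X \<pi>" and "t \<le> b - a" for y t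
    using that(2)
  proof (induction t)
    case 0
    then show ?case using y P' by (auto simp: ker_def)
  next
    case (Suc t)
    then obtain z where z: "z \<in> carrier P" "y = xpow t \<odot>\<^bsub>P\<^esub> z" by auto
    then obtain c z' where z': "z' \<in> cyclic P u" "z = sc c \<odot>\<^bsub>P\<^esub> u \<oplus>\<^bsub>P\<^esub> \<xi> \<odot>\<^bsub>P\<^esub> z'"
      using cyclic_decomp[OF P'(2,4,5)] P'(6) by metis
    have z'c: "z' \<in> carrier P" using z' P'(6) by simp
    define w where "w = \<pi> z'"
    have w: "w \<in> carrier X" using z'c \<pi> by (simp add: w_def)
    have "\<zero>\<^bsub>X\<^esub> = \<pi> y" using y by (simp add: ker_def)
    also have "\<dots> = xpow t \<odot>\<^bsub>X\<^esub> (sc c \<odot>\<^bsub>X\<^esub> v \<oplus>\<^bsub>X\<^esub> \<xi> \<odot>\<^bsub>X\<^esub> w)"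
      using z z' z'c P' \<pi> by (simp add: homs_sm homs_add w_def)
    finally have eq0: "xpow t \<odot>\<^bsub>X\<^esub> (sc c \<odot>\<^bsub>X\<^esub> v \<oplus>\<^bsub>X\<^esub> \<xi> \<odot>\<^bsub>X\<^esub> w) = \<zero>\<^bsub>X\<^esub>" by simp
    define l where "l = b - a"
    have tl: "l - 1 - t + t = l - 1" "Suc (l - 1) = l" using Suc.prems by (auto simp: l_def)
    have "\<zero>\<^bsub>X\<^esub> = xpow (l - 1 - t) \<odot>\<^bsub>X\<^esub> (xpow t \<odot>\<^bsub>X\<^esub> (sc c \<odot>\<^bsub>X\<^esub> v \<oplus>\<^bsub>X\<^esub> \<xi> \<odot>\<^bsub>X\<^esub> w))"
      unfolding eq0 using X'(2) by simp
    also have "\<dots> = xpow (l - 1) \<odot>\<^bsub>X\<^esub> (sc c \<odot>\<^bsub>X\<^esub> v \<oplus>\<^bsub>X\<^esub> \<xi> \<odot>\<^bsub>X\<^esub> w)"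
      using X' w tl by (simp add: xpow_xpow)
    also have "\<dots> = sc c \<odot>\<^bsub>X\<^esub> (xpow (l - 1) \<odot>\<^bsub>X\<^esub> v) \<oplus>\<^bsub>X\<^esub> xpow l \<odot>\<^bsub>X\<^esub> w"
      using X' w tl(2) by (simp add: sm_addr sc_sm_comm xpow_xi)
    also have "xpow l \<odot>\<^bsub>X\<^esub> w = \<zero>\<^bsub>X\<^esub>"
      using xpow_cyclic_zero[OF X'(2,4,5)] w X'(6,7) by (simp add: l_def)
    finally have "sc c \<odot>\<^bsub>X\<^esub> (xpow (l - 1) \<odot>\<^bsub>X\<^esub> v) = \<zero>\<^bsub>X\<^esub>" using X' by simp
    moreover have "xpow (l - 1) \<odot>\<^bsub>X\<^esub> v \<noteq> \<zero>\<^bsub>X\<^esub>" using X'(7) Suc.prems by (simp add: l_def)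
    ultimately have "c = 0" using sc_sm_eq_0[of X "xpow (l - 1) \<odot>\<^bsub>X\<^esub> v" c] X' by auto
    then have "y = xpow (Suc t) \<odot>\<^bsub>P\<^esub> z'" using z z' z'c P' by (simp add: xpow_xi)
    then show ?case using z'c by blast
  qed
  show "ker P X \<pi> = cyclic P (xpow (b - a) \<odot>\<^bsub>P\<^esub> u)"
  proof
    show "ker P X \<pi> \<subseteq> cyclic P (xpow (b - a) \<odot>\<^bsub>P\<^esub> u)"
    proof
      fix y assume "y \<in> ker P X \<pi>"
      then obtain z where "z \<in> carrier P" "y = xpow (b - a) \<odot>\<^bsub>P\<^esub> z" using claim by blast
      then show "y \<in> cyclic P (xpow (b - a) \<odot>\<^bsub>P\<^esub> u)" using xpow_cyclic[OF P'(2,4,5)] P'(6) by simp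
    qed
    have "xpow (b - a) \<odot>\<^bsub>P\<^esub> u \<in> ker P X \<pi>" using P' X' \<pi>x by (simp add: ker_def)
    then show "cyclic P (xpow (b - a) \<odot>\<^bsub>P\<^esub> u) \<subseteq> ker P X \<pi>"
      by (rule cyclic_sub[OF P'(2) ker_smod[OF P'(2) X'(2) \<pi>(1)]])
  qed
qed

lemma cover_map:
  fixes X :: "('a, nat \<Rightarrow> 'k) module"
  assumes Q: "is_cover Q a u" and X: "uniserial X a b v"
  obtains \<pi> where "\<pi> \<in> homs Q X" "\<pi> u = v" "\<pi> ` carrier Q = carrier X" "b \<le> proj_end a"
    "ker Q X \<pi> = cyclic Q (xpow (b - a) \<odot>\<^bsub>Q\<^esub> u)" "uniserial (restr Q (ker Q X \<pi>)) b (proj_end a) (xpow (b - a) \<odot>\<^bsub>Q\<^esub> u)"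
proof -
  note X' = uniserialD[OF X]
  have Q': "uniserial Q a (proj_end a) u" using Q by (simp add: is_cover_def)
  obtain \<pi> where \<pi>: "\<pi> \<in> homs Q X" "\<pi> u = v" using Q X'(2,4,5) unfolding is_cover_def by blast
  note k = cover_kernel[of Q a "proj_end a" u X b v \<pi>, OF Q' X \<pi>]
  have "uniserial (restr Q (ker Q X \<pi>)) b (proj_end a) (xpow (b - a) \<odot>\<^bsub>Q\<^esub> u)"
    unfolding k(3) by (rule uniserial_sub[OF Q' X'(3) k(2)])
  then show ?thesis using that \<pi> k by blast
qed

lemma uniserial_quotient:
  fixes P :: "('a, 'b) module"
  assumes P: "uniserial P a b' u" and b: "a \<le> b" "b \<le> b'"
  obtains X :: "('a, 'b) module" and \<pi> where "uniserial X a b (\<pi> u)" "\<pi> \<in> homs P X" "\<pi> ` carrier P = carrier X"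
    "ker P X \<pi> = cyclic P (xpow (b - a) \<odot>\<^bsub>P\<^esub> u)"
proof -
  note P' = uniserialD[OF P]
  define w where "w = xpow (b - a) \<odot>\<^bsub>P\<^esub> u"
  have w: "w \<in> carrier P" "e b \<odot>\<^bsub>P\<^esub> w = w"
    using P'(2,4) e_xpow_hom[OF P'(2,4,5), of "b - a"] b by (auto simp: w_def)
  have sw: "smod (cyclic P w) P" using P' w by simp
  obtain X :: "('a, 'b) module" and \<pi> where X: "rmod X" "\<pi> \<in> homs P X" "\<pi> ` carrier P = carrier X" "ker P X \<pi> = cyclic P w"
    by (rule quotient_module[OF P'(2) sw])
  have fX: "fd X" by (rule img_fd[OF P'(1) X(1-3)])
  have "xpow t \<odot>\<^bsub>X\<^esub> \<pi> u = \<zero>\<^bsub>X\<^esub> \<longleftrightarrow> b - a \<le> t" for t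
  proof -
    have "xpow t \<odot>\<^bsub>X\<^esub> \<pi> u = \<pi> (xpow t \<odot>\<^bsub>P\<^esub> u)" using P' X by (simp add: homs_sm)
    then have iff: "xpow t \<odot>\<^bsub>X\<^esub> \<pi> u = \<zero>\<^bsub>X\<^esub> \<longleftrightarrow> xpow t \<odot>\<^bsub>P\<^esub> u \<in> cyclic P w"
      using X(4) P' by (auto simp: ker_def)
    have "b - a \<le> t" if "xpow t \<odot>\<^bsub>P\<^esub> u \<in> cyclic P w"
    proof (rule ccontr)
      assume t: "\<not> b - a \<le> t"
      \<comment> \<open>Everything in w A is killed by \<xi>^(b'-b), whereas u \<xi>^t with t < b -
        a survives it.\<close>
      have "xpow (b' - b) \<odot>\<^bsub>P\<^esub> w = \<zero>\<^bsub>P\<^esub>" using P' b by (simp add: w_def xpow_xpow)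
      then have "xpow (b' - b) \<odot>\<^bsub>P\<^esub> (xpow t \<odot>\<^bsub>P\<^esub> u) = \<zero>\<^bsub>P\<^esub>"
        by (rule xpow_cyclic_zero[OF P'(2) w that])
      then have "b' - a \<le> b' - b + t" using P' by (simp add: xpow_xpow)
      then show False using t b by simp
    qed
    moreover have "xpow t \<odot>\<^bsub>P\<^esub> u \<in> cyclic P w" if "b - a \<le> t"
    proof -
      have "xpow t \<odot>\<^bsub>P\<^esub> u = xpow (t - (b - a)) \<odot>\<^bsub>P\<^esub> w" using that P' by (simp add: w_def xpow_xpow)
      then show ?thesis by (simp add: cyclic_def)
    qed
    ultimately show ?thesis using iff by blast
  qed
  moreover have "e a \<odot>\<^bsub>X\<^esub> \<pi> u = \<pi> u" using X P' by (simp add: homs_sm[symmetric])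
  moreover have "carrier X = cyclic X (\<pi> u)"
    using homs_cyclic[OF X(2) P'(4)] P'(6) X(3) by simp
  ultimately have "uniserial X a b (\<pi> u)"
    unfolding uniserial_def using fX b homs_cl[OF X(2) P'(4)] by blast
  then show ?thesis using X(2-4) unfolding w_def by (rule that)
qed

text \<open>Both modules are quotients of the same indecomposable projective by the same
  submodule.\<close>

lemma uniserial_unique:
  fixes X Y :: "('a, nat \<Rightarrow> 'k) module"
  assumes Y: "uniserial Y a b v" and X: "uniserial X a b w"
  obtains f where "f \<in> homs Y X" "inj_on f (carrier Y)" "f ` carrier Y = carrier X"
proof -
  note Y' = uniserialD[OF Y] and X' = uniserialD[OF X]
  obtain Q u where Q: "is_cover Q a u" by (rule exists_cover)
  then have Q': "rmod Q" by (auto simp: is_cover_def dest: uniserialD(2))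
  obtain \<pi>Y where kY: "\<pi>Y \<in> homs Q Y" "\<pi>Y u = v" "\<pi>Y ` carrier Q = carrier Y" "b \<le> proj_end a"
    "ker Q Y \<pi>Y = cyclic Q (xpow (b - a) \<odot>\<^bsub>Q\<^esub> u)" "uniserial (restr Q (ker Q Y \<pi>Y)) b (proj_end a) (xpow (b - a) \<odot>\<^bsub>Q\<^esub> u)"
    by (rule cover_map[OF Q Y])
  obtain \<pi>X where kX: "\<pi>X \<in> homs Q X" "\<pi>X u = w" "\<pi>X ` carrier Q = carrier X" "b \<le> proj_end a"
    "ker Q X \<pi>X = cyclic Q (xpow (b - a) \<odot>\<^bsub>Q\<^esub> u)" "uniserial (restr Q (ker Q X \<pi>X)) b (proj_end a) (xpow (b - a) \<odot>\<^bsub>Q\<^esub> u)"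
    by (rule cover_map[OF Q X])
  have k: "x \<in> carrier Q \<Longrightarrow> \<pi>Y x = \<zero>\<^bsub>Y\<^esub> \<longleftrightarrow> \<pi>X x = \<zero>\<^bsub>X\<^esub>" for x
    using kY(5) kX(5) by (auto simp: ker_def set_eq_iff)
  obtain f where f: "f \<in> homs Y X" "\<And>x. x \<in> carrier Q \<Longrightarrow> f (\<pi>Y x) = \<pi>X x"
    by (rule factor_through[OF Q' Y'(2) X'(2) kY(1,3) kX(1)]) (use k in auto)
  have "inj_on f (carrier Y)"
    unfolding homs_inj_iff[OF Y'(2) X'(2) f(1)]
  proof (intro ballI impI)
    fix y assume y: "y \<in> carrier Y" "f y = \<zero>\<^bsub>X\<^esub>"
    obtain x where x: "x \<in> carrier Q" "y = \<pi>Y x" by (rule surjE[OF kY(3) y(1)])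
    then show "y = \<zero>\<^bsub>Y\<^esub>" using f(2) y k by auto
  qed
  moreover have "f ` carrier Y = carrier X"
    unfolding kY(3)[symmetric] kX(3)[symmetric] using f(2) by (auto simp: image_iff)
  ultimately show ?thesis using that f by blast
qed

section \<open>Projective dimension of uniserial modules\<close>

text \<open>
  The first syzygy of the interval \<open>[a, b)\<close> is the interval \<open>[b, proj_end a)\<close>.
\<close>

primrec interval_pd_le :: "nat \<Rightarrow> nat \<Rightarrow> nat \<Rightarrow> bool" where
  "interval_pd_le 0 = (\<lambda>a b. a = b \<or> proj_end a = b)"
| "interval_pd_le (Suc m) = (\<lambda>a b. a = b \<or> interval_pd_le m b (proj_end a))"

lemma interval_pd_le_refl [simp]: "interval_pd_le m a a" by (cases m) auto
lemma interval_pd_le_proj_end [simp]: "interval_pd_le m a (proj_end a)" by (cases m) auto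

lemma interval_pd_le_imp_pd_le:
  fixes X :: "('a, nat \<Rightarrow> 'k) module"
  shows "uniserial X a b v \<Longrightarrow> interval_pd_le m a b \<Longrightarrow> pd_le m X"
proof (induction m arbitrary: X a b v)
  case (0 X a b v)
  note X' = uniserialD[OF 0(1)]
  obtain Q u where Qc: "is_cover Q a u" by (rule exists_cover)
  then have Q: "projective Q" "uniserial Q a (proj_end a) u" by (auto simp: is_cover_def)
  show ?case
  proof (cases "a = b")
    case True
    then show ?thesis using uniserial_trivial[of X a v] 0(1) X'(1) pd_le_zero[of X 0] by blast
  next
    case False
    then have b: "b = proj_end a" using 0(2) by simp
    obtain f where f: "f \<in> homs Q X" "inj_on f (carrier Q)" "f ` carrier Q = carrier X"
      by (rule uniserial_unique[OF Q(2) 0(1)[unfolded b]])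
    obtain g where g: "g \<in> homs X Q" "\<And>y. y \<in> carrier X \<Longrightarrow> f (g y) = y"
      by (rule homs_inverse[OF uniserialD(2)[OF Q(2)] X'(2) f]) (use that in blast)
    show ?thesis using proj_retract[OF Q(1) X'(1) g(1) f(1) g(2)] by simp
  qed
next
  case (Suc m X a b v)
  note X' = uniserialD[OF Suc(2)]
  show ?case
  proof (cases "a = b")
    case True
    then show ?thesis using uniserial_trivial[of X a v] Suc(2) X'(1) pd_le_zero[of X "Suc m"] by blast
  next
    case False
    then have pm: "interval_pd_le m b (proj_end a)" using Suc(3) by simp
    obtain Q u where Qc: "is_cover Q a u" by (rule exists_cover)
    then have Q: "projective Q" by (simp add: is_cover_def)
    obtain \<pi> where k: "\<pi> \<in> homs Q X" "\<pi> u = v" "\<pi> ` carrier Q = carrier X" "b \<le> proj_end a"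
      "ker Q X \<pi> = cyclic Q (xpow (b - a) \<odot>\<^bsub>Q\<^esub> u)" "uniserial (restr Q (ker Q X \<pi>)) b (proj_end a) (xpow (b - a) \<odot>\<^bsub>Q\<^esub> u)"
      by (rule cover_map[OF Qc Suc(2)])
    have "pd_le m (restr Q (ker Q X \<pi>))" using k(6) pm by (rule Suc.IH)
    then show ?thesis using Q k(1,3) X'(1) by auto
  qed
qed

text \<open>
  The combinatorial core: if \<open>[a, b)\<close> has projective dimension exactly \<open>2 n\<close>, then so small a projective
  dimension is inherited by every larger interval with the same socle. Exactness is essential: it keeps
  the syzygies of even degree below \<open>2 n\<close> nonzero, and those start at monotone images of \<open>a\<close> and \<open>c\<close>.
\<close>

lemma interval_pd_le_extend:
  "interval_pd_le (2 * n) a b \<Longrightarrow> (n > 0 \<longrightarrow> \<not> interval_pd_le (2 * n - 1) a b) \<Longrightarrow> a < b \<Longrightarrow> c \<le> a \<Longrightarrow> b \<le> proj_end c \<Longrightarrow> interval_pd_le (2 * n) c b"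
proof (induction n arbitrary: a b c)
  case 0
  \<comment> \<open>Squeeze: b = \<open>proj_end a\<close>, which is at least
    \<open>proj_end c\<close>, which is at least b.\<close>
  then show ?case using proj_end_mono[of c a] by auto
next
  case (Suc n)
  have e: "2 * Suc n = Suc (Suc (2 * n))" by simp
  have np: "\<not> interval_pd_le (Suc (2 * n)) a b" using Suc.prems(2) by simp
  then have n1: "\<not> interval_pd_le (2 * n) b (proj_end a)" by simp
  then have "b \<noteq> proj_end a" by auto
  moreover have "proj_end a \<noteq> proj_end b" using n1 by auto
  moreover have "proj_end a \<le> proj_end b" using Suc.prems(3) by (intro proj_end_mono) simp
  ultimately have lt: "proj_end a < proj_end b" by simp
  \<comment> \<open>The second syzygies of [a,b) and [c,b) start at the images of a and c and both
    end at \<open>proj_end b\<close>, so the induction hypothesis applies to them.\<close>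
  have p1: "interval_pd_le (2 * n) (proj_end a) (proj_end b)"
    using Suc.prems(1,3) \<open>b \<noteq> proj_end a\<close> by (simp add: e)
  have "n > 0 \<longrightarrow> \<not> interval_pd_le (2 * n - 1) (proj_end a) (proj_end b)"
  proof
    assume "n > 0"
    then obtain k where "2 * n = Suc k" by (cases n) auto
    then show "\<not> interval_pd_le (2 * n - 1) (proj_end a) (proj_end b)" using n1 by simp
  qed
  moreover have "proj_end c \<le> proj_end a" "proj_end b \<le> proj_end (proj_end c)" using Suc.prems by (auto intro: proj_end_mono)
  ultimately have "interval_pd_le (2 * n) (proj_end c) (proj_end b)" using Suc.IH[OF p1] lt by blast
  then show ?case by (simp add: e)
qed

section \<open>Injective coresolutions of uniserial modules\<close>

text \<open>The hypothesis \<open>z\<close> says that no nonzero path of length b - c ends at the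
  socle vertex b - 1, so the interval cannot be prolonged at its top. Extending a homomorphism then
  becomes linear algebra: its socle coefficient is a functional, which extends to \<open>Y\<close>,
  and \<open>functional_hom\<close> turns the extension back into a homomorphism.\<close>

lemma uniserial_injective:
  assumes J: "uniserial J c b v" and cb: "c < b" and z: "xpow (b - c) \<otimes> e (b - 1) = \<zero>"
  shows "injective J"
proof (rule injectiveI)
  note J' = uniserialD[OF J]
  show "fd J" by (rule J')
  define l where "l = b - c"
  have l: "l > 0" "c + l - 1 = b - 1" using cb by (auto simp: l_def)
  have vl: "xpow l \<odot>\<^bsub>J\<^esub> v = \<zero>\<^bsub>J\<^esub>" using J' by (simp add: l_def)
  have Jl: "xpow l \<odot>\<^bsub>J\<^esub> m = \<zero>\<^bsub>J\<^esub>" if "m \<in> carrier J" for m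
    using xpow_cyclic_zero[OF J'(2,4,5) _ vl] that J'(6) by simp
  have sl: "xpow (l - 1) \<odot>\<^bsub>J\<^esub> v \<noteq> xpow l \<odot>\<^bsub>J\<^esub> m" if "m \<in> carrier J" for m
    using Jl[OF that] J'(7)[of "l - 1"] l by (simp add: l_def)
  obtain \<phi> where \<phi>: "lfun J \<phi>" "\<And>m. m \<in> carrier J \<Longrightarrow> \<phi> (e (c + l - 1) \<odot>\<^bsub>J\<^esub> m) = \<phi> m"
    "\<And>m. m \<in> carrier J \<Longrightarrow> \<phi> (xpow l \<odot>\<^bsub>J\<^esub> m) = 0"
    "\<And>u. u < l - 1 \<Longrightarrow> \<phi> (xpow u \<odot>\<^bsub>J\<^esub> v) = 0" "\<phi> (xpow (l - 1) \<odot>\<^bsub>J\<^esub> v) = 1"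
    by (rule socle_functional[OF J'(1,4,5) vl l(1)]) (use sl that in blast)+
  \<comment> \<open>On \<open>J\<close> itself the formula gives the identity. So it will be enough
    that the extended functional after \<open>g\<close> agrees with \<phi> after
    \<open>f\<close>.\<close>
  have Fid: "lin_comb J v (\<lambda>u. \<phi> (xpow (l - 1 - u) \<odot>\<^bsub>J\<^esub> m)) l = m" if "m \<in> carrier J" for m
  proof -
    have "(\<lambda>m. lin_comb J v (\<lambda>u. \<phi> (xpow (l - 1 - u) \<odot>\<^bsub>J\<^esub> m)) l) \<in> homs J J"
      by (rule functional_hom[OF J'(2,2,4,5) vl l(1) \<phi>(1)]) (use \<phi>(2,3) in simp_all)
    moreover have "lin_comb J v (\<lambda>u. \<phi> (xpow (l - 1 - u) \<odot>\<^bsub>J\<^esub> v)) l = v"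
      by (rule functional_hom_generator[OF J'(2,4) l(1)]) (use \<phi>(4,5) in simp_all)
    ultimately show ?thesis
      using hom_eq_cyclic[of _ J J "\<lambda>x. x" v m] that J'(4,6) homs_id by metis
  qed
  fix X Y :: "('a, nat \<Rightarrow> 'k) module" and g f
  assume a: "fd X" "fd Y" "g \<in> homs X Y" "inj_on g (carrier X)" "f \<in> homs X J"
  have R: "rmod X" "rmod Y" using a by auto
  define gi where "gi = inv_into (carrier X) g"
  have gi: "gi (g m) = m" if "m \<in> carrier X" for m using that a(4) by (simp add: gi_def)
  have img: "smod (g ` carrier X) Y" using R a by simp
  \<comment> \<open>The socle coefficient of \<open>f\<close>, transported to the image of
    \<open>g\<close>.\<close>
  define \<phi>0 where "\<phi>0 y = \<phi> (f (gi y))" for y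
  obtain \<phi>1 where \<phi>1: "lfun Y \<phi>1" "\<And>y. y \<in> g ` carrier X \<Longrightarrow> \<phi>1 y = \<phi>0 y"
  proof (rule lfun_extend[OF a(2) smod_ksub[OF img], of \<phi>0])
    fix y y' assume "y \<in> g ` carrier X" "y' \<in> g ` carrier X"
    then obtain m m' where "m \<in> carrier X" "y = g m" "m' \<in> carrier X" "y' = g m'" by blast
    then show "\<phi>0 (y \<oplus>\<^bsub>Y\<^esub> y') = \<phi>0 y + \<phi>0 y'"
      using a R lfunD(1)[OF \<phi>(1)] gi by (simp add: \<phi>0_def homs_add[OF a(3), symmetric] homs_add[OF a(5)])
  next
    fix k y assume "y \<in> g ` carrier X"
    then obtain m where "m \<in> carrier X" "y = g m" by blast
    then show "\<phi>0 (sc k \<odot>\<^bsub>Y\<^esub> y) = k * \<phi>0 y"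
      using a R lfunD(2)[OF \<phi>(1)] gi by (simp add: \<phi>0_def homs_sm[OF a(3), symmetric] homs_sm[OF a(5)])
  qed blast
  have \<phi>1g: "\<phi>1 (g m) = \<phi> (f m)" if "m \<in> carrier X" for m
    using that \<phi>1(2)[of "g m"] gi by (simp add: \<phi>0_def)
  \<comment> \<open>Composition with the idempotent restricts attention to the socle vertex, where
    \<open>z\<close> kills all multiples of \<xi>^l.\<close>
  define \<psi> where "\<psi> m = \<phi>1 (e (c + l - 1) \<odot>\<^bsub>Y\<^esub> m)" for m
  have \<psi>: "lfun Y \<psi>"
    using lfunD[OF \<phi>1(1)] R by (auto simp: \<psi>_def lfun_def sm_addr sc_sm_comm)
  have \<psi>e: "\<psi> (e (c + l - 1) \<odot>\<^bsub>Y\<^esub> m) = \<psi> m" if "m \<in> carrier Y" for m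
    using that R by (simp add: \<psi>_def e_e_sm)
  have \<psi>l: "\<psi> (xpow l \<odot>\<^bsub>Y\<^esub> m) = 0" if "m \<in> carrier Y" for m
  proof -
    have "e (c + l - 1) \<odot>\<^bsub>Y\<^esub> (xpow l \<odot>\<^bsub>Y\<^esub> m) = (xpow l \<otimes> e (b - 1)) \<odot>\<^bsub>Y\<^esub> m"
      using that R l by (simp add: sm_mult)
    also have "\<dots> = \<zero>\<^bsub>Y\<^esub>" using z that R by (simp add: l_def)
    finally show ?thesis using lfun_0[OF \<phi>1(1) R(2)] by (simp add: \<psi>_def)
  qed
  define F where "F m = lin_comb J v (\<lambda>u. \<psi> (xpow (l - 1 - u) \<odot>\<^bsub>Y\<^esub> m)) l" for m
  have F: "F \<in> homs Y J"
    unfolding F_def by (rule functional_hom[OF R(2) J'(2,4,5) vl l(1) \<psi>]) (use \<psi>e \<psi>l in simp_all)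
  have "F (g m) = f m" if m: "m \<in> carrier X" for m
  proof -
    have "\<psi> (xpow u \<odot>\<^bsub>Y\<^esub> g m) = \<phi> (xpow u \<odot>\<^bsub>J\<^esub> f m)" for u
    proof -
      have "e (c + l - 1) \<odot>\<^bsub>Y\<^esub> (xpow u \<odot>\<^bsub>Y\<^esub> g m) = g (e (c + l - 1) \<odot>\<^bsub>X\<^esub> (xpow u \<odot>\<^bsub>X\<^esub> m))"
        using m R by (simp add: homs_sm[OF a(3)])
      then have "\<psi> (xpow u \<odot>\<^bsub>Y\<^esub> g m) = \<phi> (f (e (c + l - 1) \<odot>\<^bsub>X\<^esub> (xpow u \<odot>\<^bsub>X\<^esub> m)))"
        using m R \<phi>1g by (simp add: \<psi>_def)
      also have "\<dots> = \<phi> (e (c + l - 1) \<odot>\<^bsub>J\<^esub> (xpow u \<odot>\<^bsub>J\<^esub> f m))"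
        using m R by (simp add: homs_sm[OF a(5)])
      also have "\<dots> = \<phi> (xpow u \<odot>\<^bsub>J\<^esub> f m)"
        by (rule \<phi>(2)) (use m J'(2) homs_cl[OF a(5)] in simp)
      finally show ?thesis .
    qed
    then show ?thesis using Fid[OF homs_cl[OF a(5) m]] by (simp add: F_def)
  qed
  then show "\<exists>h\<in>homs Y J. \<forall>x\<in>carrier X. h (g x) = f x" using F by blast
qed

definition is_uniserial :: "('a, nat \<Rightarrow> 'k) module \<Rightarrow> bool" where
  "is_uniserial Z \<longleftrightarrow> (\<exists>a b v. uniserial Z a b v)"

text \<open>If the longest nonzero path ending at the socle vertex has l vertices, then [b - l, b)
  is injective and contains a copy of [a,b). The cokernel [b - l, a) is uniserial again, so the step
  can be iterated.\<close>

lemma uniserial_embed: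
  assumes Y: "is_uniserial Y"
  shows "\<exists>J \<iota> Z \<pi>. injective J \<and> \<iota> \<in> homs Y J \<and> inj_on \<iota> (carrier Y) \<and> \<pi> \<in> homs J Z \<and>
    \<pi> ` carrier J = carrier Z \<and> ker J Z \<pi> = \<iota> ` carrier Y \<and> is_uniserial Z"
proof -
  obtain a0 b0 v0 where g0: "uniserial Y a0 b0 v0" using Y by (auto simp: is_uniserial_def)
  \<comment> \<open>The number l found below is at most \<open>nil\<close>; this shift ensures l
    \<le> b, so that b - l is not truncated.\<close>
  define a b where "a = a0 + nil * N" and "b = b0 + nil * N"
  have g: "uniserial Y a b v0" unfolding a_def b_def by (rule uniserial_shift[OF g0])
  note Y' = uniserialD[OF g]
  show ?thesis
  proof (cases "a < b")
    case False
    then have tr: "carrier Y = {\<zero>\<^bsub>Y\<^esub>}" using g Y'(3) uniserial_trivial[of Y a v0] by simp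
    have "injective Y"
    proof (rule injectiveI[OF Y'(1)])
      fix X1 Y1 :: "('a, nat \<Rightarrow> 'k) module" and g f
      assume "f \<in> homs X1 Y"
      then have "f x = \<zero>\<^bsub>Y\<^esub>" if "x \<in> carrier X1" for x using that homs_cl[of f X1 Y x] tr by simp
      then show "\<exists>h\<in>homs Y1 Y. \<forall>x\<in>carrier X1. h (g x) = f x"
        by (intro bexI[OF _ homs_0[OF Y'(2)]]) simp
    qed
    moreover have "ker Y Y (\<lambda>x. \<zero>\<^bsub>Y\<^esub>) = (\<lambda>x. x) ` carrier Y" by (auto simp: ker_def)
    moreover have "(\<lambda>x. \<zero>\<^bsub>Y\<^esub>) ` carrier Y = carrier Y" using tr by simp
    ultimately show ?thesis using homs_0[OF Y'(2), of Y] homs_id[of Y] Y by (metis inj_on_id2)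
  next
    case True
    \<comment> \<open>The socle vertex is b - 1, as intervals are half-open; \<open>l - 1\<close> is
      the greatest length of a nonzero path ending there.\<close>
    define l where "l = (LEAST t. xpow t \<otimes> e (b - 1) = \<zero>)"
    have lz: "xpow l \<otimes> e (b - 1) = \<zero>" unfolding l_def by (rule LeastI[of _ nil]) (simp add: xpow_nil)
    have ll: "xpow t \<otimes> e (b - 1) \<noteq> \<zero>" if "t < l" for t using that not_less_Least unfolding l_def by blast
    have lnil: "l \<le> nil" unfolding l_def by (rule Least_le) (simp add: xpow_nil)
    have "nil \<le> nil * N" using N_pos by simp
    then have lb: "l \<le> b" using lnil unfolding b_def by linarith
    have bal: "b - a \<le> l"
    proof (rule ccontr)
      assume "\<not> b - a \<le> l"
      then have 1: "b - a - 1 = (b - a - 1 - l) + l" by simp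
      have "xpow (b - a - 1) \<otimes> e (b - 1) = xpow (b - a - 1 - l) \<otimes> (xpow l \<otimes> e (b - 1))"
        using xpow_add[of "b - a - 1 - l" l] 1 by (simp add: A.m_assoc)
      also have "\<dots> = \<zero>" unfolding lz by simp
      finally have z: "xpow (b - a - 1) \<otimes> e (b - 1) = \<zero>" .
      have "xpow (b - a - 1) \<odot>\<^bsub>Y\<^esub> v0 = e (b - 1) \<odot>\<^bsub>Y\<^esub> (xpow (b - a - 1) \<odot>\<^bsub>Y\<^esub> v0)"
        using e_xpow_hom[OF Y'(2,4,5), of "b - a - 1"] True by simp
      also have "\<dots> = (xpow (b - a - 1) \<otimes> e (b - 1)) \<odot>\<^bsub>Y\<^esub> v0" using Y' by (simp add: sm_mult)
      also have "\<dots> = \<zero>\<^bsub>Y\<^esub>" unfolding z using Y' by simp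
      finally show False using Y'(7)[of "b - a - 1"] True by simp
    qed
    define c where "c = b - l"
    have l0: "l > 0" using bal True by simp
    have coeff_space: "c \<le> a" "c < b" "b - c = l" using bal lb l0 by (auto simp: c_def)
    have "e c \<otimes> xpow (l - 1) = xpow (l - 1) \<otimes> e (b - 1)"
      using e_xpow[of c "l - 1"] lb l0 by (simp add: c_def)
    \<comment> \<open>By minimality of l the path of length l - 1 from c to b - 1 is nonzero, so
      [c,b) is a quotient of the indecomposable projective at c.\<close>
    then have "\<not> proj_length c \<le> l - 1" using ll[of "l - 1"] l0 e_xpow_zero_iff[of c "l - 1"] by simp
    then have bp: "b \<le> proj_end c" using lb l0 by (simp add: proj_end_def c_def)
    obtain Q u where "is_cover Q c u" by (rule exists_cover)
    then have Q: "uniserial Q c (proj_end c) u" by (simp add: is_cover_def)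
    obtain J :: "('a, nat \<Rightarrow> 'k) module" and \<pi>0 where J: "uniserial J c b (\<pi>0 u)"
      using uniserial_quotient[OF Q less_imp_le[OF coeff_space(2)] bp] by metis
    have iJ: "injective J" using uniserial_injective[OF J coeff_space(2)] lz coeff_space by simp
    let ?w = "xpow (a - c) \<odot>\<^bsub>J\<^esub> \<pi>0 u"
    have S: "uniserial (restr J (cyclic J ?w)) a b ?w" by (rule uniserial_sub[OF J coeff_space(1) Y'(3)])
    obtain \<iota> where \<iota>: "\<iota> \<in> homs Y (restr J (cyclic J ?w))" "inj_on \<iota> (carrier Y)" "\<iota> ` carrier Y = carrier (restr J (cyclic J ?w))"
      by (rule uniserial_unique[OF g S])
    obtain Z :: "('a, nat \<Rightarrow> 'k) module" and \<pi> where Z: "uniserial Z c a (\<pi> (\<pi>0 u))" "\<pi> \<in> homs J Z" "\<pi> ` carrier J = carrier Z" "ker J Z \<pi> = cyclic J ?w"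
      by (rule uniserial_quotient[OF J coeff_space(1) Y'(3)])
    have "?w \<in> carrier J" using uniserialD(2,4)[OF J] by simp
    then have "cyclic J ?w \<subseteq> carrier J" by (intro smod_sub cyclic_smod uniserialD(2)[OF J])
    with \<iota>(1) have \<iota>J: "\<iota> \<in> homs Y J" by (rule homs_restr_cod_incl)
    have "is_uniserial Z" using Z(1) by (auto simp: is_uniserial_def)
    then have "injective J \<and> \<iota> \<in> homs Y J \<and> inj_on \<iota> (carrier Y) \<and> \<pi> \<in> homs J Z \<and>
      \<pi> ` carrier J = carrier Z \<and> ker J Z \<pi> = \<iota> ` carrier Y \<and> is_uniserial Z"
      using iJ \<iota>J \<iota>(2,3) Z by simp
    then show ?thesis by (rule exI[of _ J, OF exI[of _ \<iota>, OF exI[of _ Z, OF exI[of _ \<pi>]]]])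
  qed
qed

text \<open>Iterates \<open>uniserial_embed\<close> on the cokernels, with choice functions for its
  witnesses; the differentials are the composites through the cokernels.\<close>

lemma uniserial_coresolution:
  assumes Y: "is_uniserial Y"
  obtains J \<delta> \<iota> where "inj_coresolution J \<delta>" "\<iota> \<in> homs Y (J 0)" "inj_on \<iota> (carrier Y)" "\<iota> ` carrier Y = ker (J 0) (J 1) (\<delta> 0)"
proof -
  have "\<forall>Y. \<exists>J \<iota> Z \<pi>. is_uniserial Y \<longrightarrow> injective J \<and> \<iota> \<in> homs Y J \<and> inj_on \<iota> (carrier Y) \<and> \<pi> \<in> homs J Z \<and>
    \<pi> ` carrier J = carrier Z \<and> ker J Z \<pi> = \<iota> ` carrier Y \<and> is_uniserial Z"
    using uniserial_embed by meson
  then obtain fJ f\<iota> fZ f\<pi> where ch: "\<And>Y. is_uniserial Y \<Longrightarrow> injective (fJ Y) \<and> f\<iota> Y \<in> homs Y (fJ Y) \<and> inj_on (f\<iota> Y) (carrier Y) \<and>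
    f\<pi> Y \<in> homs (fJ Y) (fZ Y) \<and> f\<pi> Y ` carrier (fJ Y) = carrier (fZ Y) \<and>
    ker (fJ Y) (fZ Y) (f\<pi> Y) = f\<iota> Y ` carrier Y \<and> is_uniserial (fZ Y)"
    by metis
  define Z where "Z n = (fZ ^^ n) Y" for n
  have Z: "is_uniserial (Z n)" "Z (Suc n) = fZ (Z n)" for n
    using Y ch by (induction n) (auto simp: Z_def)
  have R: "rmod (Z n)" "rmod (fJ (Z n))" for n
    using Z(1)[of n] uniserialD(2) ch[OF Z(1)[of n]] by (auto simp: is_uniserial_def)
  have i: "f\<iota> (Z n) \<in> homs (Z n) (fJ (Z n))" "inj_on (f\<iota> (Z n)) (carrier (Z n))"
    "f\<pi> (Z n) \<in> homs (fJ (Z n)) (Z (Suc n))" "f\<pi> (Z n) ` carrier (fJ (Z n)) = carrier (Z (Suc n))"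
    "ker (fJ (Z n)) (Z (Suc n)) (f\<pi> (Z n)) = f\<iota> (Z n) ` carrier (Z n)" for n
    using ch[OF Z(1)[of n]] by (auto simp: Z(2))
  define J where "J n = fJ (Z n)" for n
  define \<delta> where "\<delta> n = (\<lambda>x. f\<iota> (Z (Suc n)) (f\<pi> (Z n) x))" for n
  have ker\<delta>: "ker (J n) (J (Suc n)) (\<delta> n) = f\<iota> (Z n) ` carrier (Z n)" for n
  proof -
    have "f\<iota> (Z (Suc n)) y = \<zero>\<^bsub>J (Suc n)\<^esub> \<longleftrightarrow> y = \<zero>\<^bsub>Z (Suc n)\<^esub>" if "y \<in> carrier (Z (Suc n))" for y
      using homs_inj_iff[OF R i(1)] i(2) that homs_zero[OF R i(1)] by (auto simp: J_def)
    then have "ker (J n) (J (Suc n)) (\<delta> n) = ker (fJ (Z n)) (Z (Suc n)) (f\<pi> (Z n))"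
      using homs_cl[OF i(3)] by (auto simp: ker_def \<delta>_def J_def)
    then show ?thesis using i(5) by simp
  qed
  have "inj_coresolution J \<delta>"
    unfolding inj_coresolution_def
  proof (intro conjI allI)
    fix n
    show "injective (J n)" using ch[OF Z(1)] by (simp add: J_def)
    show "\<delta> n \<in> homs (J n) (J (Suc n))" unfolding \<delta>_def J_def by (rule homs_comp[OF i(3) i(1)])
    have "\<delta> n ` carrier (J n) = f\<iota> (Z (Suc n)) ` (f\<pi> (Z n) ` carrier (fJ (Z n)))"
      by (auto simp: \<delta>_def J_def)
    then show "\<delta> n ` carrier (J n) = ker (J (Suc n)) (J (Suc (Suc n))) (\<delta> (Suc n))"
      using ker\<delta> i(4) by simp
  qed
  then show ?thesis
    by (rule that[of J \<delta> "f\<iota> (Z 0)"]) (use i[of 0] ker\<delta>[of 0] in \<open>auto simp: J_def Z_def\<close>)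
qed

text \<open>Passing to the syzygy lowers the degree of Ext. In the last degree the test module is
  the syzygy itself: Ext of degree 1 into it vanishes, so the projective cover splits, which is
  possible for an interval only if the syzygy or the module is zero.\<close>

lemma Ext_vanishes_imp_interval_pd_le:
  fixes X :: "('a, nat \<Rightarrow> 'k) module"
  shows "uniserial X a b v \<Longrightarrow> (\<And>J \<delta>. inj_coresolution J \<delta> \<Longrightarrow> Ext_vanishes J \<delta> m X) \<Longrightarrow> interval_pd_le m a b"
proof (induction m arbitrary: X a b v)
  case (0 X a b v)
  note X' = uniserialD[OF 0(1)]
  obtain Q u where Qc: "is_cover Q a u" by (rule exists_cover)
  then have Q: "projective Q" "uniserial Q a (proj_end a) u" by (auto simp: is_cover_def)
  note Q' = uniserialD[OF Q(2)]
  define w where "w = xpow (b - a) \<odot>\<^bsub>Q\<^esub> u"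
  obtain \<pi> where k: "\<pi> \<in> homs Q X" "\<pi> u = v" "\<pi> ` carrier Q = carrier X" "b \<le> proj_end a"
    "ker Q X \<pi> = cyclic Q w" and gK: "uniserial (restr Q (ker Q X \<pi>)) b (proj_end a) w"
    unfolding w_def by (rule cover_map[OF Qc 0(1)])
  from gK have "is_uniserial (restr Q (ker Q X \<pi>))" by (auto simp: is_uniserial_def)
  then obtain J \<delta> \<iota> where J: "inj_coresolution J \<delta>" "\<iota> \<in> homs (restr Q (ker Q X \<pi>)) (J 0)"
    "inj_on \<iota> (ker Q X \<pi>)" "\<iota> ` ker Q X \<pi> = ker (J 0) (J 1) (\<delta> 0)"
    using uniserial_coresolution by (metis restr_simps(1))
  obtain \<rho> where \<rho>: "\<rho> \<in> homs Q (restr Q (ker Q X \<pi>))" "\<And>x. x \<in> ker Q X \<pi> \<Longrightarrow> \<rho> x = x"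
    by (rule Ext_vanishes_0_split[OF J(1) Q'(1) X'(1) k(1,3) 0(2)[OF J(1)] J(2-4)]) (use that in blast)
  \<comment> \<open>Otherwise the retraction would send u into w A, all of which is killed by
    \<xi>^(\<open>proj_end a\<close> - b). As it fixes w = u \<xi>^(b-a), the socle vector of
    \<open>Q\<close> would be zero.\<close>
  have "\<not> (a < b \<and> b < proj_end a)"
  proof
    assume ab: "a < b \<and> b < proj_end a"
    define y where "y = \<rho> u"
    have w: "w \<in> carrier Q" "e b \<odot>\<^bsub>Q\<^esub> w = w" "w \<in> ker Q X \<pi>"
      using Q' uniserialD(4,5)[OF gK] by (auto simp: w_def)
    have y: "y \<in> cyclic Q w" using homs_cl[OF \<rho>(1) Q'(4)] k(5) by (simp add: y_def)
    then have yc: "y \<in> carrier Q" using smod_sub[OF cyclic_smod[OF Q'(2) w(1)]] by blast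
    have "xpow (proj_end a - b) \<odot>\<^bsub>Q\<^esub> w = \<zero>\<^bsub>Q\<^esub>" using ab Q' by (simp add: w_def xpow_xpow)
    then have "xpow (proj_end a - b) \<odot>\<^bsub>Q\<^esub> y = \<zero>\<^bsub>Q\<^esub>" by (rule xpow_cyclic_zero[OF Q'(2) w(1,2) y])
    then have "xpow (b - a - 1) \<odot>\<^bsub>Q\<^esub> (xpow (proj_end a - b) \<odot>\<^bsub>Q\<^esub> y) = \<zero>\<^bsub>Q\<^esub>" using Q' by simp
    then have 1: "xpow (proj_end a - 1 - a) \<odot>\<^bsub>Q\<^esub> y = \<zero>\<^bsub>Q\<^esub>" using ab yc Q' by (simp add: xpow_xpow)
    have "w = \<rho> (xpow (b - a) \<odot>\<^bsub>Q\<^esub> u)" using \<rho>(2)[OF w(3)] by (simp add: w_def)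
    also have "\<dots> = xpow (b - a) \<odot>\<^bsub>Q\<^esub> y" using \<rho>(1) Q' by (simp add: homs_sm y_def)
    finally have "xpow (proj_end a - 1 - b) \<odot>\<^bsub>Q\<^esub> w = xpow (proj_end a - 1 - b) \<odot>\<^bsub>Q\<^esub> (xpow (b - a) \<odot>\<^bsub>Q\<^esub> y)" by simp
    also have "\<dots> = xpow (proj_end a - 1 - a) \<odot>\<^bsub>Q\<^esub> y" using ab yc Q' by (simp add: xpow_xpow)
    finally have "xpow (proj_end a - 1 - a) \<odot>\<^bsub>Q\<^esub> u = \<zero>\<^bsub>Q\<^esub>" using 1 ab Q' by (simp add: w_def xpow_xpow)
    then have "proj_end a - a \<le> proj_end a - 1 - a" using Q'(7) by blast
    then show False using ab by linarith
  qed
  then show ?case using X'(3) k(4) by auto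
next
  case (Suc m X a b v)
  note X' = uniserialD[OF Suc(2)]
  obtain Q u where Qc: "is_cover Q a u" by (rule exists_cover)
  then have Q: "projective Q" by (simp add: is_cover_def)
  obtain \<pi> where k: "\<pi> \<in> homs Q X" "\<pi> u = v" "\<pi> ` carrier Q = carrier X" "b \<le> proj_end a"
    "ker Q X \<pi> = cyclic Q (xpow (b - a) \<odot>\<^bsub>Q\<^esub> u)" "uniserial (restr Q (ker Q X \<pi>)) b (proj_end a) (xpow (b - a) \<odot>\<^bsub>Q\<^esub> u)"
    by (rule cover_map[OF Qc Suc(2)])
  have "Ext_vanishes J \<delta> m (restr Q (ker Q X \<pi>))" if J: "inj_coresolution J \<delta>" for J \<delta>
    by (rule Ext_vanishes_syzygy[OF J Q X'(1) k(1,3) Suc(3)[OF J]])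
  with k(6) have "interval_pd_le m b (proj_end a)" by (rule Suc.IH)
  then show ?case by simp
qed

end

context nakayama
begin

section \<open>The Gorenstein condition\<close>

lemma regular_rmod: "rmod (regular_module A)"
  using fd_regular by simp

text \<open>Some component y e_i is nonzero; its last nonzero multiple by a power of \<xi> lies in
  the socle.\<close>

lemma homogeneous_socle_element:
  assumes M: "rmod M" and y: "y \<in> carrier M" "y \<noteq> \<zero>\<^bsub>M\<^esub>"
  obtains s \<sigma> where "s \<in> cyclic M y" "s \<noteq> \<zero>\<^bsub>M\<^esub>" "e \<sigma> \<odot>\<^bsub>M\<^esub> s = s" "\<xi> \<odot>\<^bsub>M\<^esub> s = \<zero>\<^bsub>M\<^esub>" "nil \<le> \<sigma>"
proof -
  obtain i where i: "e i \<odot>\<^bsub>M\<^esub> y \<noteq> \<zero>\<^bsub>M\<^esub>" using exists_e_nonzero[OF M y] by blast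
  define y1 where "y1 = e i \<odot>\<^bsub>M\<^esub> y"
  have y1: "y1 \<in> carrier M" "y1 \<noteq> \<zero>\<^bsub>M\<^esub>" "e i \<odot>\<^bsub>M\<^esub> y1 = y1"
    using i M y by (auto simp: y1_def e_e_sm)
  define k where "k = (LEAST k. xpow k \<odot>\<^bsub>M\<^esub> y1 = \<zero>\<^bsub>M\<^esub>)"
  have k0: "xpow k \<odot>\<^bsub>M\<^esub> y1 = \<zero>\<^bsub>M\<^esub>"
    unfolding k_def by (rule LeastI[of _ nil]) (use M y1 in \<open>simp add: xpow_nil\<close>)
  have kl: "xpow t \<odot>\<^bsub>M\<^esub> y1 \<noteq> \<zero>\<^bsub>M\<^esub>" if "t < k" for t
    using that not_less_Least unfolding k_def by blast
  have "k \<noteq> 0"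
  proof
    assume "k = 0"
    with k0 y1 M show False by simp
  qed
  then obtain j where j: "k = Suc j" by (cases k) auto
  define s where "s = xpow j \<odot>\<^bsub>M\<^esub> y1"
  \<comment> \<open>Adding \<open>nil * N\<close> does not change the vertex and provides the room
    that \<open>socle_summand\<close> requires.\<close>
  define \<sigma> where "\<sigma> = i + j + nil * N"
  have "s = (e i \<otimes> xpow j) \<odot>\<^bsub>M\<^esub> y" using M y by (simp add: s_def y1_def sm_mult)
  then have "s \<in> cyclic M y" by (simp add: cyclic_def)
  moreover have "s \<noteq> \<zero>\<^bsub>M\<^esub>" using kl[of j] j by (simp add: s_def)
  moreover have "e \<sigma> \<odot>\<^bsub>M\<^esub> s = s"
    using e_xpow_hom[OF M y1(1,3), of j] by (simp add: s_def \<sigma>_def)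
  moreover have "\<xi> \<odot>\<^bsub>M\<^esub> s = \<zero>\<^bsub>M\<^esub>" using k0 j M y1 by (simp add: s_def xi_xpow)
  moreover have "nil \<le> nil * N" using N_pos by simp
  then have "nil \<le> \<sigma>" unfolding \<sigma>_def by linarith
  ultimately show ?thesis by (rule that)
qed

text \<open>The submodule s A is the line k s, so an essential submodule meets it only by containing
  s.\<close>

lemma socle_in_essential:
  assumes M: "rmod M" and S: "essential_submodule A S M" and s: "s \<in> carrier M" "s \<noteq> \<zero>\<^bsub>M\<^esub>"
    "e \<sigma> \<odot>\<^bsub>M\<^esub> s = s" "\<xi> \<odot>\<^bsub>M\<^esub> s = \<zero>\<^bsub>M\<^esub>"
  shows "s \<in> S"
proof (rule ccontr)
  assume nS: "s \<notin> S"
  have S': "smod S M" and ess: "\<And>T. smod T M \<Longrightarrow> T \<inter> S = {\<zero>\<^bsub>M\<^esub>} \<Longrightarrow> T = {\<zero>\<^bsub>M\<^esub>}"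
    using S by (auto simp: essential_submodule_def)
  have cyclic: "\<exists>c. y = sc c \<odot>\<^bsub>M\<^esub> s" if "y \<in> cyclic M s" for y
    using M s(1,3) that
  proof (induction rule: cyclic_induct)
    case zero
    show ?case using M s by (intro exI[of _ 0]) simp
  next
    case (add y z)
    then show ?case using M s(1) by (metis sc_sm_plus)
  next
    case (basis c t)
    show ?case
    proof (cases t)
      case 0
      then show ?thesis using M s by auto
    next
      case (Suc u)
      have "xpow t \<odot>\<^bsub>M\<^esub> s = \<zero>\<^bsub>M\<^esub>" using xpow_xi[OF M s(1), of u] s(4) M Suc by simp
      then show ?thesis using M s by (intro exI[of _ 0]) simp
    qed
  qed
  have "cyclic M s \<inter> S \<subseteq> {\<zero>\<^bsub>M\<^esub>}"
  proof
    fix y assume y: "y \<in> cyclic M s \<inter> S"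
    then obtain c where c: "y = sc c \<odot>\<^bsub>M\<^esub> s" using cyclic by blast
    have "c = 0"
    proof (rule ccontr)
      assume "c \<noteq> 0"
      then have "s = sc (1 / c) \<odot>\<^bsub>M\<^esub> y" using M s by (simp add: c sc_sm_times[symmetric])
      moreover have "sc (1 / c) \<odot>\<^bsub>M\<^esub> y \<in> S" using S' y by simp
      ultimately show False using nS by simp
    qed
    then show "y \<in> {\<zero>\<^bsub>M\<^esub>}" using c M s by simp
  qed
  moreover have "\<zero>\<^bsub>M\<^esub> \<in> cyclic M s \<inter> S" using S' M s by simp
  ultimately have "cyclic M s \<inter> S = {\<zero>\<^bsub>M\<^esub>}" by blast
  then have "cyclic M s = {\<zero>\<^bsub>M\<^esub>}" by (rule ess[OF cyclic_smod[OF M s(1)]])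
  then show False using cyclic_self[OF M s(1)] s(2) by auto
qed

lemma resolution_pd_le_even:
  assumes res: "minimal_injective_resolution A (regular_module A) E \<epsilon> d"
    and pd: "\<And>i. i < 2 * n \<Longrightarrow> pd_le i (E i)" and n: "n \<ge> 1"
  shows "pd_le (2 * n) (E (2 * n))"
proof -
  define R where "R = regular_module A"
  note R = regular_simps[folded R_def]
  have Rr: "rmod R" using regular_rmod by (simp add: R_def)
  have iE: "injective (E i)" "d i \<in> homs (E i) (E (Suc i))" and eps: "\<epsilon> \<in> homs R (E 0)" "inj_on \<epsilon> (carrier A)"
    and ex0: "\<epsilon> ` carrier A = ker (E 0) (E 1) (d 0)"
    and ex: "d i ` carrier (E i) = ker (E (Suc i)) (E (Suc (Suc i))) (d (Suc i))"
    and ess: "essential_submodule A (d i ` carrier (E i)) (E (Suc i))" for i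
    using res R by (auto simp: minimal_injective_resolution_def exact_at_def a_kernel_ker R_def)
  have rE: "rmod (E i)" "fd (E i)" for i using iE by auto
  have icE: "inj_coresolution E d" using iE ex by (auto simp: inj_coresolution_def)
  \<comment> \<open>Cosyzygies: \<open>L 0\<close> is a copy of the regular module, and
    \<open>L (Suc i)\<close> is the cokernel of \<open>L i\<close> in \<open>E i\<close>.\<close>
  define L where "L i = ker (E i) (E (Suc i)) (d i)" for i
  have sL: "smod (L i) (E i)" for i unfolding L_def using rE iE by simp
  have fL: "fd (restr (E i) (L i))" for i by (rule sub_fd[OF rE(2) sL])
  have V: "Ext_vanishes J \<delta> i (restr (E i) (L i))" if J: "inj_coresolution J \<delta>" and "i \<le> 2 * n" for J \<delta> i
    using that(2)
  proof (induction i)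
    case 0
    note J' = inj_coresolutionD[OF J]
    have eL: "\<epsilon> \<in> homs R (restr (E 0) (L 0))"
      by (rule homs_restr_cod[OF eps(1)]) (use ex0 in \<open>auto simp: L_def R\<close>)
    obtain k where k: "k \<in> homs (restr (E 0) (L 0)) R" "\<And>y. y \<in> carrier R \<Longrightarrow> k (\<epsilon> y) = y"
      by (rule homs_inverse[OF Rr _ eL]) (use eps ex0 rE sL that in \<open>auto simp: R L_def\<close>)
    show ?case
    proof (rule Ext_vanishesI)
      fix f assume f: "f \<in> homs (restr (E 0) (L 0)) (J (Suc 0))"
        and z: "\<And>x. x \<in> carrier (restr (E 0) (L 0)) \<Longrightarrow> \<delta> (Suc 0) (f x) = \<zero>\<^bsub>J (Suc (Suc 0))\<^esub>"
      have e1: "\<epsilon> \<one> \<in> L 0" using ex0 by (auto simp: L_def)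
      have "f (\<epsilon> \<one>) \<in> ker (J (Suc 0)) (J (Suc (Suc 0))) (\<delta> (Suc 0))"
        using z e1 homs_cl[OF f, of "\<epsilon> \<one>"] by (auto simp: ker_def)
      then have "f (\<epsilon> \<one>) \<in> \<delta> 0 ` carrier (J 0)" using J by (simp add: inj_coresolution_def)
      \<comment> \<open>A map out of the regular module is determined by the image of 1, so lifting
        this one element suffices.\<close>
      then obtain y where y: "y \<in> carrier (J 0)" "f (\<epsilon> \<one>) = \<delta> 0 y" by blast
      have "(\<lambda>r. r \<odot>\<^bsub>J 0\<^esub> y) \<in> homs R (J 0)"
        by (rule homsI) (use y J'(3) in \<open>auto simp: R sm_addl sm_mult\<close>)
      from homs_comp[OF k(1) this] have g: "(\<lambda>x. k x \<odot>\<^bsub>J 0\<^esub> y) \<in> homs (restr (E 0) (L 0)) (J 0)" .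
      have "\<delta> 0 (k x \<odot>\<^bsub>J 0\<^esub> y) = f x" if x: "x \<in> L 0" for x
      proof -
        obtain r where r: "r \<in> carrier A" "x = \<epsilon> r" using x ex0 by (auto simp: L_def)
        have "\<delta> 0 (k x \<odot>\<^bsub>J 0\<^esub> y) = r \<odot>\<^bsub>J (Suc 0)\<^esub> f (\<epsilon> \<one>)"
          using r k(2) y J'(4)[of 0] by (simp add: R homs_sm)
        also have "\<dots> = f (r \<odot>\<^bsub>E 0\<^esub> \<epsilon> \<one>)" using homs_sm[OF f r(1), of "\<epsilon> \<one>"] e1 by simp
        also have "r \<odot>\<^bsub>E 0\<^esub> \<epsilon> \<one> = \<epsilon> r" using homs_sm[OF eps(1) r(1), of \<one>] r by (simp add: R)
        finally show ?thesis using r by simp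
      qed
      then show "\<exists>g\<in>homs (restr (E 0) (L 0)) (J 0). \<forall>x\<in>carrier (restr (E 0) (L 0)). \<delta> 0 (g x) = f x"
        by (intro bexI[OF _ g]) simp
    qed
  next
    case (Suc i)
    have dL: "d i \<in> homs (E i) (restr (E (Suc i)) (L (Suc i)))"
      by (rule homs_restr_cod[OF iE(2)]) (use ex[of i] in \<open>auto simp: L_def\<close>)
    show ?case
    proof (rule Ext_vanishes_cokernel[OF J rE(2) fL dL])
      show "d i ` carrier (E i) = carrier (restr (E (Suc i)) (L (Suc i)))" using ex by (simp add: L_def)
      show "Ext_vanishes J \<delta> i (restr (E i) (ker (E i) (restr (E (Suc i)) (L (Suc i))) (d i)))"
        using Suc by (simp add: L_def)
      show "Ext_vanishes J \<delta> (Suc i) (E i)"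
        by (rule pd_le_imp_Ext_vanishes[OF J pd]) (use Suc in auto)
    qed
  qed
  define E' where "E' = E (2 * n)"
  define S where "S = L (2 * n)"
  have E': "rmod E'" "fd E'" using rE by (auto simp: E'_def)
  have n2: "2 * n = Suc (2 * n - 1)" "2 * n - 1 = Suc (2 * n - 2)" using n by auto
  have Sim: "S = d (2 * n - 1) ` carrier (E (2 * n - 1))"
    using ex[of "2 * n - 1"] n2(1) by (simp add: S_def L_def)
  have essS: "essential_submodule A S E'"
    unfolding Sim E'_def using ess[of "2 * n - 1"] n2(1) by simp
  have sS: "smod S E'" using sL by (simp add: S_def E'_def)
  have VS: "Ext_vanishes J \<delta> (2 * n) (restr E' S)" if "inj_coresolution J \<delta>" for J \<delta>
    using V[OF that, of "2 * n"] by (simp add: E'_def S_def)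
  \<comment> \<open>Otherwise Ext of degree 2n from \<open>U\<close> to the regular module would
    vanish, and the inclusion of \<open>U\<close> in \<open>E (2 * n)\<close> would factor through
    \<open>d (2 * n - 1)\<close>.\<close>
  have not_interval_pd_le: "\<not> interval_pd_le (2 * n - 1) a b" if X: "uniserial (restr E' U) a b v" and U: "smod U E'" "U \<subseteq> S" and ab: "a < b" for U a b v
  proof
    assume "interval_pd_le (2 * n - 1) a b"
    then have "pd_le (2 * n - 1) (restr E' U)" by (rule interval_pd_le_imp_pd_le[OF X])
    then have VX: "Ext_vanishes E d (2 * n - 1) (restr E' U)" by (rule pd_le_imp_Ext_vanishes[OF icE]) simp
    have id: "(\<lambda>x. x) \<in> homs (restr E' U) (E (Suc (2 * n - 1)))"
      using homs_restr_incl[OF U(1)] n2(1) by (simp add: E'_def)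
    have z: "d (Suc (2 * n - 1)) x = \<zero>\<^bsub>E (Suc (Suc (2 * n - 1)))\<^esub>" if "x \<in> carrier (restr E' U)" for x
      using that U(2) n2(1) by (auto simp: S_def L_def ker_def)
    obtain g where g: "g \<in> homs (restr E' U) (E (2 * n - 1))" "\<And>x. x \<in> U \<Longrightarrow> d (2 * n - 1) (g x) = x"
      using Ext_vanishesE[OF VX id z] by auto
    have rU: "rmod (restr E' U)" using E' U by simp
    define T where "T = g ` U"
    have sT: "smod T (E (2 * n - 1))" using img_smod[OF rU rE(1) g(1)] by (simp add: T_def)
    define m where "m = 2 * n - 2"
    have m: "2 * n - 1 = Suc m" using n2(2) by (simp add: m_def)
    \<comment> \<open>On \<open>T\<close> the map \<open>d (2 * n - 1)\<close> recovers x from g x,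
      while it kills the image of \<open>d m\<close>. That image is essential, so \<open>T\<close>
      is zero and with it the generator v.\<close>
    have "T \<inter> d m ` carrier (E m) = {\<zero>\<^bsub>E (Suc m)\<^esub>}"
    proof
      show "T \<inter> d m ` carrier (E m) \<subseteq> {\<zero>\<^bsub>E (Suc m)\<^esub>}"
      proof
        fix y assume y: "y \<in> T \<inter> d m ` carrier (E m)"
        then obtain x where x: "x \<in> U" "y = g x" by (auto simp: T_def)
        have "d (Suc m) y = \<zero>\<^bsub>E (Suc (Suc m))\<^esub>" using y ex[of m] by (auto simp: ker_def)
        then have "x = \<zero>\<^bsub>E'\<^esub>" using g(2)[OF x(1)] x(2) m n2(1) by (simp add: E'_def)
        then show "y \<in> {\<zero>\<^bsub>E (Suc m)\<^esub>}" using x(2) homs_zero[OF rU rE(1) g(1)] m by simp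
      qed
      show "{\<zero>\<^bsub>E (Suc m)\<^esub>} \<subseteq> T \<inter> d m ` carrier (E m)"
        using smod_zero[OF sT] smod_zero[OF img_smod[OF rE(1) rE(1) iE(2)[of m]]] m by simp
    qed
    then have "T = {\<zero>\<^bsub>E (Suc m)\<^esub>}" using ess[of m] sT m by (simp add: essential_submodule_def)
    moreover have "v \<in> U" using uniserialD(4)[OF X] by simp
    ultimately have "g v = \<zero>\<^bsub>E (Suc m)\<^esub>" by (auto simp: T_def)
    then have "d (Suc m) \<zero>\<^bsub>E (Suc m)\<^esub> = v" using g(2)[OF \<open>v \<in> U\<close>] m by simp
    then have "v = \<zero>\<^bsub>E'\<^esub>" using homs_zero[OF rE(1) rE(1) iE(2)[of "Suc m"]] m n2(1) by (simp add: E'_def)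
    then show False using uniserial_nonzero[OF X ab] by simp
  qed
  obtain \<mu> :: "(nat \<Rightarrow> 'k) set \<Rightarrow> nat" where
    \<mu>: "\<And>T T'. ksub E' T \<Longrightarrow> ksub E' T' \<Longrightarrow> T' \<subset> T \<Longrightarrow> \<mu> T' < \<mu> T"
    using fd_measure[OF E'(2)] by blast
  \<comment> \<open>Generalised to all direct summands \<open>T\<close>, given with a retraction, so
    that uniserial summands can be split off by induction on \<mu>.\<close>
  have main: "pd_le (2 * n) (restr E' T)"
    if "smod T E'" "\<rho> \<in> homs E' (restr E' T)" "\<And>x. x \<in> T \<Longrightarrow> \<rho> x = x" for T \<rho>
    using that
  proof (induction "\<mu> T" arbitrary: T \<rho> rule: less_induct)
    case less
    note T = less.prems(1) and \<rho> = less.prems(2,3)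
    have fT: "fd (restr E' T)" "rmod (restr E' T)" using sub_fd[OF E'(2) T] by auto
    show ?case
    proof (cases "T = {\<zero>\<^bsub>E'\<^esub>}")
      case True
      then show ?thesis using pd_le_zero[OF fT(1)] by simp
    next
      case False
      then obtain y where y: "y \<in> T" "y \<noteq> \<zero>\<^bsub>E'\<^esub>" using smod_zero[OF T] by blast
      obtain s \<sigma> where s: "s \<in> cyclic E' y" "s \<noteq> \<zero>\<^bsub>E'\<^esub>" "e \<sigma> \<odot>\<^bsub>E'\<^esub> s = s" "\<xi> \<odot>\<^bsub>E'\<^esub> s = \<zero>\<^bsub>E'\<^esub>" "nil \<le> \<sigma>"
        using homogeneous_socle_element[of "restr E' T" y] fT y by auto
      have sT: "s \<in> T" using s(1) cyclic_sub[OF E'(1) T y(1)] by blast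
      have sE: "s \<in> carrier E'" using smod_in[OF T sT] .
      have sSS: "s \<in> S" by (rule socle_in_essential[OF E'(1) essS sE s(2-4)])
      obtain t v F where v: "t \<le> \<sigma>" "v \<in> T" "uniserial (restr E' (cyclic E' v)) (\<sigma> - t) (Suc \<sigma>) v" "s = xpow t \<odot>\<^bsub>E'\<^esub> v"
        and vmax: "\<And>t' w. w \<in> T \<Longrightarrow> s = xpow t' \<odot>\<^bsub>E'\<^esub> w \<Longrightarrow> t' \<le> t"
        and F: "F \<in> homs (restr E' T) (restr E' (cyclic E' v))" "\<And>x. x \<in> cyclic E' v \<Longrightarrow> F x = x"
        by (rule socle_summand[OF fT(1), of s \<sigma>]) (use s sT that in auto)
      have fS: "fd (restr E' S)" by (rule sub_fd[OF E'(2) sS])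
      obtain t' w F' where w: "t' \<le> \<sigma>" "w \<in> S" "uniserial (restr E' (cyclic E' w)) (\<sigma> - t') (Suc \<sigma>) w" "s = xpow t' \<odot>\<^bsub>E'\<^esub> w"
        and F': "F' \<in> homs (restr E' S) (restr E' (cyclic E' w))" "\<And>x. x \<in> cyclic E' w \<Longrightarrow> F' x = x"
        by (rule socle_summand[OF fS, of s \<sigma>]) (use s sSS that in auto)
      have wE: "w \<in> carrier E'" and vE: "v \<in> carrier E'" using smod_in[OF sS w(2)] smod_in[OF T v(2)] by auto
      \<comment> \<open>The retraction carries w into \<open>T\<close> and fixes s, so s is at least
        as divisible by \<xi> in \<open>T\<close> as in \<open>S\<close>. In the notation of the
        overview c = \<sigma> - t, a = \<sigma> - t' and b = \<sigma> + 1.\<close>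
      have "s = xpow t' \<odot>\<^bsub>E'\<^esub> \<rho> w"
        using \<rho>(2)[OF sT] w(4) homs_sm[OF \<rho>(1) xpow_cl wE] by simp
      then have t': "t' \<le> t" using vmax[of "\<rho> w" t'] homs_cl[OF \<rho>(1) wE] by simp
      have ow: "cyclic E' w \<subseteq> S" "smod (cyclic E' w) E'" using cyclic_sub[OF E'(1) sS w(2)] E' wE by auto
      \<comment> \<open>As a summand of \<open>S\<close> this interval inherits the vanishing of
        Ext, which for an interval bounds the projective dimension.\<close>
      have "interval_pd_le (2 * n) (\<sigma> - t') (Suc \<sigma>)"
      proof (rule Ext_vanishes_imp_interval_pd_le[OF w(3)])
        fix J \<delta> assume "inj_coresolution J \<delta>"
        from VS[OF this] show "Ext_vanishes J \<delta> (2 * n) (restr E' (cyclic E' w))"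
          by (rule Ext_vanishes_retract[of _ _ _ _ "\<lambda>x. x", OF _ _ F'(1)])
             (use F'(2) ow in \<open>auto intro!: homsI\<close>)
      qed
      moreover have "n > 0 \<longrightarrow> \<not> interval_pd_le (2 * n - 1) (\<sigma> - t') (Suc \<sigma>)"
        using not_interval_pd_le[OF w(3) ow(2,1)] w(1) by simp
      ultimately have "interval_pd_le (2 * n) (\<sigma> - t) (Suc \<sigma>)"
        by (rule interval_pd_le_extend) (use t' w(1) uniserial_le_proj_end[OF v(3)] in auto)
      then have Dv: "pd_le (2 * n) (restr E' (cyclic E' v))" by (rule interval_pd_le_imp_pd_le[OF v(3)])
      \<comment> \<open>The complement of the summand just found. It is again a summand of
        \<open>E'\<close>, by the old retraction followed by x - F x, and it is smaller because it
        misses v.\<close>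
      define T' where "T' = ker (restr E' T) (restr E' (cyclic E' v)) F"
      have ov: "smod (cyclic E' v) E'" "cyclic E' v \<subseteq> T" using E' vE cyclic_sub[OF E'(1) T v(2)] by auto
      have rov: "rmod (restr E' (cyclic E' v))" using E' ov by simp
      have T'T: "T' \<subseteq> T" and T'F: "x \<in> T' \<longleftrightarrow> x \<in> T \<and> F x = \<zero>\<^bsub>E'\<^esub>" for x by (auto simp: T'_def ker_def)
      have "smod T' (restr E' T)" unfolding T'_def by (rule ker_smod[OF fT(2) rov F(1)])
      then have sT': "smod T' E'" using smod_restr_iff[OF T E'(1)] by simp
      have FT: "F x \<in> cyclic E' v" "F x \<in> T" "F x \<in> carrier E'" "F (F x) = F x" if "x \<in> T" for x
        using homs_cl[OF F(1), of x] that ov F(2) smod_in[OF ov(1)] by auto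
      have F1: "F \<in> homs (restr E' T) (restr E' T)"
        by (rule homsI) (use FT homs_add[OF F(1)] homs_sm[OF F(1)] in auto)
      have TE: "x \<in> carrier E'" if "x \<in> T" for x using smod_in[OF T that] .
      have q0: "(\<lambda>x. x \<ominus>\<^bsub>restr E' T\<^esub> F x) \<in> homs (restr E' T) (restr E' T)"
        by (rule homs_diff[OF fT(2) homs_id F1])
      have qm: "x \<ominus>\<^bsub>restr E' T\<^esub> F x = x \<ominus>\<^bsub>E'\<^esub> F x" if "x \<in> T" for x
        using that FT E' T by simp
      have Fq: "F (x \<ominus>\<^bsub>E'\<^esub> F x) = \<zero>\<^bsub>E'\<^esub>" if "x \<in> T" for x
        using homs_minus[OF fT(2) rov F(1), of x "F x"] that FT[OF that] qm[OF that] E' ov by simp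
      have q: "(\<lambda>x. x \<ominus>\<^bsub>restr E' T\<^esub> F x) \<in> homs (restr E' T) (restr E' T')"
        using homs_restr_cod[OF q0, of T'] Fq qm T'F homs_cl[OF q0] by simp
      have "pd_le (2 * n) (restr E' T')"
      proof (rule less.hyps)
        have "v \<notin> T'" using F(2)[OF cyclic_self[OF E'(1) vE]] uniserial_nonzero[OF v(3)] T'F by auto
        then show "\<mu> T' < \<mu> T" using T'T v(2) by (intro \<mu> smod_ksub T sT') auto
        show "(\<lambda>x. \<rho> x \<ominus>\<^bsub>restr E' T\<^esub> F (\<rho> x)) \<in> homs E' (restr E' T')"
          using homs_comp[OF \<rho>(1) q] by simp
        show "\<rho> x \<ominus>\<^bsub>restr E' T\<^esub> F (\<rho> x) = x" if "x \<in> T'" for x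
          using that T'F[of x] \<rho>(2) qm[of x] TE E'(1) by simp
      qed (rule sT')
      moreover have "biprod (restr E' T) (restr E' (cyclic E' v)) (restr E' T') (\<lambda>x. x) (\<lambda>x. x) F (\<lambda>x. x \<ominus>\<^bsub>restr E' T\<^esub> F x)"
        unfolding biprod_def
      proof (intro conjI ballI)
        show "(\<lambda>x. x) \<in> homs (restr E' (cyclic E' v)) (restr E' T)" "(\<lambda>x. x) \<in> homs (restr E' T') (restr E' T)"
          using ov T'T by (auto intro!: homsI)
        fix x
        show "F x = x" "x \<ominus>\<^bsub>restr E' T\<^esub> F x = \<zero>\<^bsub>restr E' T'\<^esub>" if "x \<in> carrier (restr E' (cyclic E' v))"
          using that F(2)[of x] ov qm[of x] TE E'(1) by auto
        show "x \<ominus>\<^bsub>restr E' T\<^esub> F x = x" "F x = \<zero>\<^bsub>restr E' (cyclic E' v)\<^esub>" if "x \<in> carrier (restr E' T')"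
          using that T'F[of x] qm[of x] TE E'(1) by auto
        show "F x \<oplus>\<^bsub>restr E' T\<^esub> (x \<ominus>\<^bsub>restr E' T\<^esub> F x) = x" if "x \<in> carrier (restr E' T)"
          using that qm[of x] TE FT E'(1) by simp
      qed (rule F(1), rule q)
      ultimately show ?thesis using pd_le_biprod[OF Dv _ fT(1)] by blast
    qed
  qed
  have "pd_le (2 * n) (restr E' (carrier E'))"
    by (rule main[of "carrier E'" "\<lambda>x. x"]) (use E' in auto)
  then show ?thesis by (simp add: E'_def)
qed

lemma gorenstein_even_imp_odd:
  assumes n: "n \<ge> 1" and G: "gorenstein (2 * n) A"
  shows "gorenstein (2 * n + 1) A"
proof -
  obtain E \<epsilon> d where res: "minimal_injective_resolution A (regular_module A) E \<epsilon> d"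
    and pd: "\<And>i. i < 2 * n \<Longrightarrow> proj_dim A (E i) \<le> enat i"
    using G by (auto simp: gorenstein_def)
  have fE: "fd (E i)" for i using res by (simp add: minimal_injective_resolution_def)
  have "pd_le (2 * n) (E (2 * n))"
    by (rule resolution_pd_le_even[OF res _ n]) (use pd fE proj_dim_le_iff in blast)
  then have "proj_dim A (E i) \<le> enat i" if "i < 2 * n + 1" for i
    using that pd fE proj_dim_le_iff by (cases "i = 2 * n") auto
  then show ?thesis using res unfolding gorenstein_def by blast
qed

end

section \<open>Path algebras of linear and cyclic quivers\<close>

lemma sum_single:
  assumes "finite S" "\<And>y. y \<in> S \<Longrightarrow> y \<noteq> a \<Longrightarrow> h y = (0 :: 'c :: comm_monoid_add)"
  shows "sum h S = (if a \<in> S then h a else 0)"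
proof -
  have "sum h S = sum h (S \<inter> {a})"
    by (rule sum.mono_neutral_right) (use assms in auto)
  then show ?thesis by auto
qed

text \<open>Arrows are named by their sources, so at most one leaves each vertex. Allowing any
  subset of {1..N} as set of arrows covers both shapes: the linear quiver lacks the arrow
  \<open>N\<close>.\<close>

locale nakayama_quiver =
  fixes Q :: "(nat, nat) pre_digraph" and N :: nat
  assumes N: "N \<ge> 1" and verts: "verts Q = {1..N}" and arcs: "arcs Q \<subseteq> {1..N}"
    and tail: "tail Q i = i" and head: "i \<in> arcs Q \<Longrightarrow> head Q i = (if i = N then 1 else Suc i)"
begin

abbreviation R :: "('k::field, (nat, nat) path \<Rightarrow> 'k) module" where "R \<equiv> path_algebra Q"

lemma path_iff: "(u, p, v) \<in> paths Q \<longleftrightarrow> u \<in> verts Q \<and> set p \<subseteq> arcs Q \<and> pre_digraph.cas Q u p v"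
  by (simp add: paths_def pre_digraph.awalk_def)

lemma cas_simps [simp]: "pre_digraph.cas Q u [] v \<longleftrightarrow> u = v"
    "pre_digraph.cas Q u (a # p) v \<longleftrightarrow> u = a \<and> pre_digraph.cas Q (head Q a) p v"
  by (auto simp: pre_digraph.cas.simps tail)

lemma cas_snoc [simp]: "pre_digraph.cas Q u (p @ [a]) w \<longleftrightarrow> pre_digraph.cas Q u p a \<and> w = head Q a"
  by (induction p arbitrary: u) auto

lemma R_simps:
  "carrier (R :: ('k::field, _) module) = {f. finite {p. f p \<noteq> 0} \<and> {p. f p \<noteq> 0} \<subseteq> paths Q}"
  "\<zero>\<^bsub>R\<^esub> = (\<lambda>p. 0 :: 'k)"
  "f \<oplus>\<^bsub>R\<^esub> g = (\<lambda>p. f p + g p :: 'k)"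
  "c \<odot>\<^bsub>R\<^esub> f = (\<lambda>p. c * f p)"
  by (simp_all add: path_algebra_def)

definition splits where
  "splits u r w = {(v, p, q). (u, p, v) \<in> paths Q \<and> (v, q, w) \<in> paths Q \<and> r = p @ q}"

lemma R_mult: "(f \<otimes>\<^bsub>R\<^esub> g) (u, r, w) = (\<Sum>(v, p, q)\<in>splits u r w. f (u, p, v) * g (v, q, w))"
  by (simp add: path_algebra_def splits_def)

lemma finite_splits: "finite (splits u r w)"
proof (rule finite_subset)
  show "splits u r w \<subseteq> {1..N} \<times> (\<lambda>k. take k r) ` {..length r} \<times> (\<lambda>k. drop k r) ` {..length r}"
  proof
    fix y assume "y \<in> splits u r w"
    then obtain v p q where y: "y = (v, p, q)" "(v, q, w) \<in> paths Q" "r = p @ q"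
      by (auto simp: splits_def)
    then have "v \<in> {1..N}" by (simp add: path_iff verts)
    moreover have "p = take (length p) r" "q = drop (length p) r" "length p \<le> length r" using y by auto
    ultimately show "y \<in> {1..N} \<times> (\<lambda>k. take k r) ` {..length r} \<times> (\<lambda>k. drop k r) ` {..length r}"
      unfolding y(1) by blast
  qed
qed auto

text \<open>
  Both the vertex idempotents and the scalar multiples of \<open>1\<close> are of this form.
\<close>

definition diag :: "(nat \<Rightarrow> 'k::field) \<Rightarrow> (nat, nat) path \<Rightarrow> 'k" where
  "diag g = (\<lambda>(u, p, v). if p = [] \<and> u = v \<and> u \<in> verts Q then g u else 0)"

lemma diag_carrier [simp]: "diag g \<in> carrier R"
proof -
  have "{p. diag g p \<noteq> 0} \<subseteq> (\<lambda>u. (u, [], u)) ` {1..N}"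
    by (auto simp: diag_def verts split: if_splits)
  moreover have "finite ((\<lambda>u. (u, [], u)) ` {1..N})" by simp
  ultimately have "finite {p. diag g p \<noteq> 0}" by (rule finite_subset)
  moreover have "{p. diag g p \<noteq> 0} \<subseteq> paths Q"
    by (auto simp: diag_def path_iff split: if_splits)
  ultimately show ?thesis by (simp add: R_simps)
qed

lemma carrier_zero: "f \<in> carrier R \<Longrightarrow> p \<notin> paths Q \<Longrightarrow> f p = 0"
  by (auto simp: R_simps)

lemma diag_mult:
  assumes "f \<in> carrier R" shows "diag g \<otimes>\<^bsub>R\<^esub> f = (\<lambda>(u, r, w). g u * f (u, r, w))"
proof (rule ext, clarify)
  fix u r w
  have "(diag g \<otimes>\<^bsub>R\<^esub> f) (u, r, w) = (if (u, [], r) \<in> splits u r w then diag g (u, [], u) * f (u, r, w) else 0)"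
    unfolding R_mult by (subst sum_single[OF finite_splits, of _ _ _ "(u, [], r)"])
      (auto simp: splits_def diag_def split: if_splits)
  then show "(diag g \<otimes>\<^bsub>R\<^esub> f) (u, r, w) = g u * f (u, r, w)"
    using carrier_zero[OF assms, of "(u, r, w)"] by (auto simp: splits_def diag_def path_iff)
qed

lemma cas_target_vert: "set p \<subseteq> arcs Q \<Longrightarrow> u \<in> verts Q \<Longrightarrow> pre_digraph.cas Q u p v \<Longrightarrow> v \<in> verts Q"
proof (induction p arbitrary: u)
  case (Cons a p)
  have "a \<in> arcs Q" using Cons.prems by simp
  then have "head Q a \<in> verts Q" using head[of a] arcs N by (auto simp: verts subset_iff)
  then show ?case using Cons.IH[of "head Q a"] Cons.prems by simp
qed simp

lemma mult_diag:
  assumes "f \<in> carrier R" shows "f \<otimes>\<^bsub>R\<^esub> diag g = (\<lambda>(u, r, w). f (u, r, w) * g w)"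
proof (rule ext, clarify)
  fix u r w
  have "(f \<otimes>\<^bsub>R\<^esub> diag g) (u, r, w) = (if (w, r, []) \<in> splits u r w then f (u, r, w) * diag g (w, [], w) else 0)"
    unfolding R_mult by (subst sum_single[OF finite_splits, of _ _ _ "(w, r, [])"])
      (auto simp: splits_def diag_def split: if_splits)
  then show "(f \<otimes>\<^bsub>R\<^esub> diag g) (u, r, w) = f (u, r, w) * g w"
    using carrier_zero[OF assms, of "(u, r, w)"] cas_target_vert[of r u w]
    by (auto simp: splits_def diag_def path_iff)
qed

lemma one_diag: "\<one>\<^bsub>R\<^esub> = diag (\<lambda>_. 1)"
  by (auto simp: path_algebra_def diag_def fun_eq_iff)

lemma smult_diag: "f \<in> carrier R \<Longrightarrow> c \<odot>\<^bsub>R\<^esub> f = diag (\<lambda>_. c) \<otimes>\<^bsub>R\<^esub> f"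
  by (auto simp: diag_mult R_simps)

text \<open>The full sum \<open>arrows (arcs Q)\<close> becomes \<xi>. The set is a parameter so
  that membership in the arrow ideal can be shown by induction on it.\<close>

definition arrows :: "nat set \<Rightarrow> (nat, nat) path \<Rightarrow> 'k::field" where
  "arrows S = (\<lambda>(u, p, w). if u \<in> S \<and> p = [u] \<and> w = head Q u then 1 else 0)"

lemma finite_arcs: "finite (arcs Q)"
  using arcs finite_subset by blast

lemma arrows_carrier: "arrows (arcs Q) \<in> carrier R"
proof -
  have "{p. arrows (arcs Q) p \<noteq> (0 :: 'a)} \<subseteq> (\<lambda>u. (u, [u], head Q u)) ` arcs Q"
    by (auto simp: arrows_def split: if_splits)
  then have "finite {p. arrows (arcs Q) p \<noteq> (0 :: 'a)}" using finite_arcs finite_surj by blast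
  moreover have "{p. arrows (arcs Q) p \<noteq> (0 :: 'a)} \<subseteq> paths Q"
    using arcs by (auto simp: arrows_def path_iff verts split: if_splits)
  ultimately show ?thesis by (simp add: R_simps)
qed

lemma path_elem_arrows:
  assumes "(u, p, v) \<in> paths Q"
  shows "path_elem (u, p, v) \<otimes>\<^bsub>R\<^esub> arrows (arcs Q) =
    (if v \<in> arcs Q then path_elem (u, p @ [v], head Q v) else \<zero>\<^bsub>R\<^esub> :: _ \<Rightarrow> 'k::field)"
proof (rule ext, clarify)
  fix u' r w
  have eq: "(path_elem (u, p, v) \<otimes>\<^bsub>R\<^esub> arrows (arcs Q)) (u', r, w) =
    (if (v, p, [v]) \<in> splits u' r w then path_elem (u, p, v) (u', p, v) * arrows (arcs Q) (v, [v], w) else 0 :: 'k)"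
    unfolding R_mult by (subst sum_single[OF finite_splits, of _ _ _ "(v, p, [v])"])
      (auto simp: splits_def path_elem_def arrows_def split: if_splits)
  have "v \<in> verts Q" using assms cas_target_vert by (auto simp: path_iff)
  then have "(if (v, p, [v]) \<in> splits u' r w then path_elem (u, p, v) (u', p, v) * arrows (arcs Q) (v, [v], w) else 0 :: 'k) =
    (if v \<in> arcs Q then path_elem (u, p @ [v], head Q v) else \<zero>\<^bsub>R\<^esub>) (u', r, w)"
    using assms by (auto simp: splits_def path_elem_def arrows_def R_simps path_iff)
  with eq show "(path_elem (u, p, v) \<otimes>\<^bsub>R\<^esub> arrows (arcs Q)) (u', r, w) =
    (if v \<in> arcs Q then path_elem (u, p @ [v], head Q v) else \<zero>\<^bsub>R\<^esub> :: _ \<Rightarrow> 'k) (u', r, w)"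
    by (rule trans)
qed

definition vertex :: "nat \<Rightarrow> (nat, nat) path \<Rightarrow> 'k::field" where
  "vertex i = diag (\<lambda>j. if j = i then 1 else 0)"

lemma vertex_path_elem: "i \<in> verts Q \<Longrightarrow> vertex i = path_elem (i, [], i)"
  by (auto simp: vertex_def diag_def path_elem_def fun_eq_iff)

text \<open>At most one arrow leaves each vertex, so a path is determined by its source and its
  length. This is where the shape of the quiver enters \<open>A_induct\<close>.\<close>

lemma path_elem_power:
  assumes "ring (R :: ('k::field, _) module)" "(u, p, v) \<in> paths Q"
  shows "path_elem (u, p, v) = vertex u \<otimes>\<^bsub>R\<^esub> (arrows (arcs Q) [^]\<^bsub>R\<^esub> length p :: _ \<Rightarrow> 'k)"
  using assms(2)
proof (induction p arbitrary: v rule: rev_induct)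
  case Nil
  interpret ring "R :: ('k, _) module" by fact
  have "(vertex u :: _ \<Rightarrow> 'k) \<in> carrier R" by (simp add: vertex_def)
  moreover have "(path_elem (u, [], u) :: _ \<Rightarrow> 'k) = vertex u" "u = v"
    using Nil by (auto simp: path_iff vertex_path_elem)
  ultimately show ?case by simp
next
  case (snoc a p)
  interpret ring "R :: ('k, _) module" by fact
  have p: "(u, p, a) \<in> paths Q" "a \<in> arcs Q" "v = head Q a" using snoc.prems by (auto simp: path_iff)
  have c: "(vertex u :: _ \<Rightarrow> 'k) \<in> carrier R" "(arrows (arcs Q) :: _ \<Rightarrow> 'k) \<in> carrier R"
    using arrows_carrier by (auto simp: vertex_def)
  have "path_elem (u, p @ [a], v) = path_elem (u, p, a) \<otimes>\<^bsub>R\<^esub> (arrows (arcs Q) :: _ \<Rightarrow> 'k)"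
    using p by (simp add: path_elem_arrows)
  also have "\<dots> = (vertex u \<otimes>\<^bsub>R\<^esub> arrows (arcs Q) [^]\<^bsub>R\<^esub> length p) \<otimes>\<^bsub>R\<^esub> arrows (arcs Q)"
    using snoc.IH[OF p(1)] by simp
  finally show ?case using c by (simp add: m_assoc)
qed

lemma R_induct:
  assumes R: "ring (R :: ('k::field, _) module)" and f: "f \<in> carrier R" and zero: "P \<zero>\<^bsub>R\<^esub>"
    and add: "\<And>f g. f \<in> carrier R \<Longrightarrow> g \<in> carrier R \<Longrightarrow> P f \<Longrightarrow> P g \<Longrightarrow> P (f \<oplus>\<^bsub>R\<^esub> g)"
    and basis: "\<And>c i t. i \<in> {1..N} \<Longrightarrow>
      P (diag (\<lambda>_. c) \<otimes>\<^bsub>R\<^esub> (vertex i \<otimes>\<^bsub>R\<^esub> (arrows (arcs Q) [^]\<^bsub>R\<^esub> (t::nat) :: _ \<Rightarrow> 'k)))"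
  shows "P f"
proof -
  have "\<forall>f. {p. f p \<noteq> 0} \<subseteq> S \<longrightarrow> P f" if "finite S" "S \<subseteq> paths Q" for S
    using that
  proof (induction S rule: finite_induct)
    case empty
    have "f = \<zero>\<^bsub>R\<^esub>" if "{p. f p \<noteq> 0} \<subseteq> {}" for f :: "_ \<Rightarrow> 'k" using that by (auto simp: R_simps)
    then show ?case using zero by metis
  next
    case (insert s S)
    show ?case
    proof (intro allI impI)
      fix f :: "(nat, nat) path \<Rightarrow> 'k" assume f: "{p. f p \<noteq> 0} \<subseteq> insert s S"
      obtain u p v where s: "s = (u, p, v)" by (cases s)
      have sp: "(u, p, v) \<in> paths Q" using insert s by simp
      \<comment> \<open>One path is removed from the support; it returns as a scalar multiple of its
        path element.\<close>
      define g where "g = f(s := 0)"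
      have gS: "{p. g p \<noteq> 0} \<subseteq> S" using f by (auto simp: g_def)
      then have "P g" using insert by blast
      have gc: "g \<in> carrier R" using gS insert finite_subset by (auto simp: R_simps)
      have pc: "path_elem s \<in> carrier R"
        using sp s by (auto simp: R_simps path_elem_def)
      have "diag (\<lambda>_. f s) \<otimes>\<^bsub>R\<^esub> path_elem s = diag (\<lambda>_. f s) \<otimes>\<^bsub>R\<^esub> (vertex u \<otimes>\<^bsub>R\<^esub> arrows (arcs Q) [^]\<^bsub>R\<^esub> length p)"
        using path_elem_power[OF R sp] s by simp
      moreover have "u \<in> {1..N}" using sp by (simp add: path_iff verts)
      ultimately have "P (diag (\<lambda>_. f s) \<otimes>\<^bsub>R\<^esub> path_elem s)" using basis by simp
      moreover have "f = g \<oplus>\<^bsub>R\<^esub> diag (\<lambda>_. f s) \<otimes>\<^bsub>R\<^esub> path_elem s"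
        unfolding diag_mult[OF pc] by (auto simp: R_simps g_def path_elem_def)
      moreover have "diag (\<lambda>_. f s) \<otimes>\<^bsub>R\<^esub> path_elem s \<in> carrier R"
        using pc by (intro monoid.m_closed[OF ring.is_monoid[OF R]]) auto
      ultimately show "P f" using add[OF gc] \<open>P g\<close> by metis
    qed
  qed
  then show ?thesis using f by (auto simp: R_simps)
qed

lemma vertex_mult: "vertex i \<otimes>\<^bsub>R\<^esub> vertex j = (if i = j then vertex i else \<zero>\<^bsub>R\<^esub> :: _ \<Rightarrow> 'k::field)"
  unfolding vertex_def diag_mult[OF diag_carrier] by (auto simp: diag_def R_simps fun_eq_iff)

text \<open>For the linear quiver and i = N both sides vanish: no arrow leaves \<open>N\<close> and
  none ends at 1.\<close>

lemma vertex_arrows: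
  assumes "i \<in> {1..N}"
  shows "vertex i \<otimes>\<^bsub>R\<^esub> arrows (arcs Q) = (arrows (arcs Q) \<otimes>\<^bsub>R\<^esub> vertex (if i = N then 1 else Suc i) :: _ \<Rightarrow> 'k::field)"
proof -
  have *: "(u = i) = (head Q u = (if i = N then 1 else Suc i))" if "u \<in> arcs Q" for u
    using head[OF that] that arcs assms by (auto split: if_splits)
  show ?thesis
    unfolding vertex_def diag_mult[OF arrows_carrier] mult_diag[OF arrows_carrier]
  proof (rule ext, clarify)
    fix u p w
    show "(if u = i then 1 else 0) * arrows (arcs Q) (u, p, w) =
      (arrows (arcs Q) (u, p, w) * (if w = (if i = N then 1 else Suc i) then 1 else 0) :: 'k)"
    proof (cases "u \<in> arcs Q \<and> p = [u] \<and> w = head Q u")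
      case True
      then show ?thesis using *[of u] by simp
    next
      case False
      then have "arrows (arcs Q) (u, p, w) = (0 :: 'k)" by (auto simp: arrows_def)
      then show ?thesis by simp
    qed
  qed
qed

section \<open>The arrow ideal and quotients by admissible ideals\<close>

lemma arrows_in_arrow_ideal:
  assumes R: "ring (R :: ('k::field, _) module)"
  shows "(arrows (arcs Q) :: _ \<Rightarrow> 'k) \<in> arrow_ideal Q"
proof -
  interpret ring "R :: ('k, _) module" by fact
  let ?G = "{path_elem (tail Q e, [e], head Q e) | e. e \<in> arcs Q} :: (_ \<Rightarrow> 'k) set"
  have G: "?G \<subseteq> carrier R"
    using arcs by (auto simp: R_simps path_elem_def path_iff verts tail split: if_splits)
  have id: "ideal (arrow_ideal Q :: (_ \<Rightarrow> 'k) set) R" unfolding arrow_ideal_def by (rule genideal_ideal[OF G])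
  have sub: "?G \<subseteq> arrow_ideal Q" unfolding arrow_ideal_def by (rule genideal_self[OF G])
  have "(arrows S :: _ \<Rightarrow> 'k) \<in> arrow_ideal Q" if "finite S" "S \<subseteq> arcs Q" for S
    using that
  proof (induction S rule: finite_induct)
    case empty
    have "(arrows {} :: _ \<Rightarrow> 'k) = \<zero>\<^bsub>R\<^esub>" by (auto simp: arrows_def R_simps)
    then show ?case using additive_subgroup.zero_closed[OF ideal.axioms(1)[OF id]] by simp
  next
    case (insert a S)
    have "(arrows (insert a S) :: _ \<Rightarrow> 'k) = arrows S \<oplus>\<^bsub>R\<^esub> path_elem (tail Q a, [a], head Q a)"
      using insert by (auto simp: arrows_def R_simps path_elem_def tail fun_eq_iff)
    moreover have "path_elem (tail Q a, [a], head Q a) \<in> (arrow_ideal Q :: (_ \<Rightarrow> 'k) set)"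
      using sub insert by blast
    ultimately show ?case
      using insert additive_subgroup.a_closed[OF ideal.axioms(1)[OF id]] by simp
  qed
  then show ?thesis using finite_arcs by blast
qed

lemma power_in_arrow_ideal:
  assumes R: "ring (R :: ('k::field, _) module)"
  shows "(arrows (arcs Q) [^]\<^bsub>R\<^esub> (m::nat) :: _ \<Rightarrow> 'k) \<in> arrow_ideal Q [^]\<^bsub>ideals_set R\<^esub> m"
proof (induction m)
  case 0
  interpret ring "R :: ('k, _) module" by fact
  show ?case by (simp add: nat_pow_def ideals_set_def)
next
  case (Suc m)
  interpret ring "R :: ('k, _) module" by fact
  have "(arrow_ideal Q :: (_ \<Rightarrow> 'k) set) [^]\<^bsub>ideals_set R\<^esub> Suc m =
      ideal_prod R (arrow_ideal Q [^]\<^bsub>ideals_set R\<^esub> m) (arrow_ideal Q)"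
    by (simp add: nat_pow_def ideals_set_def)
  then show ?case
    using ideal_prod.prod[OF Suc arrows_in_arrow_ideal[OF R]] by simp
qed

text \<open>Admissibility supplies the exponent: \<xi>^m is the coset of an element of the m-th
  power of the arrow ideal, which lies in \<open>I\<close>. The relations between idempotents and
  \<xi> hold already in the path algebra.\<close>

lemma quotient_nakayama:
  assumes adm: "admissible_ideal Q (I :: (_ \<Rightarrow> 'k::field) set)"
    and A: "A = quotient_algebra R I" and fd: "fd_module A (regular_module A)"
  shows "\<exists>nil e \<xi>. nakayama A N nil e \<xi>"
proof -
  have id: "ideal I R" using adm by (simp add: admissible_ideal_def)
  interpret I: ideal I "R :: ('k, _) module" by (rule id)
  have R: "ring (R :: ('k, _) module)" by (rule ideal.axioms(2)[OF id])
  obtain m :: nat where m: "(arrow_ideal Q :: (_ \<Rightarrow> 'k) set) [^]\<^bsub>ideals_set R\<^esub> m \<subseteq> I"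
    using adm by (auto simp: admissible_ideal_def)
  define h where "h f = I +>\<^bsub>R\<^esub> f" for f
  have hh: "h \<in> ring_hom R (R Quot I)" unfolding h_def by (rule I.rcos_ring_hom)
  have As: "carrier A = carrier (R Quot I)" "mult A = mult (R Quot I)" "add A = add (R Quot I)"
    "one A = one (R Quot I)" "zero A = zero (R Quot I)"
    "smult A = (\<lambda>c X. \<Union>x\<in>X. I +>\<^bsub>R\<^esub> (c \<odot>\<^bsub>R\<^esub> x))"
    by (simp_all add: A quotient_algebra_def ring.extend_def module.fields_def)
  have carA: "carrier A = h ` carrier R"
    by (auto simp: As FactRing_def A_RCOSETS_def' h_def)
  have h_add: "h (f \<oplus>\<^bsub>R\<^esub> g) = h f \<oplus>\<^bsub>A\<^esub> h g" if "f \<in> carrier R" "g \<in> carrier R" for f g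
    using ring_hom_add[OF hh that] by (simp add: As)
  have h_mult: "h (f \<otimes>\<^bsub>R\<^esub> g) = h f \<otimes>\<^bsub>A\<^esub> h g" if "f \<in> carrier R" "g \<in> carrier R" for f g
    using ring_hom_mult[OF hh that] by (simp add: As)
  have h_one: "h \<one>\<^bsub>R\<^esub> = \<one>\<^bsub>A\<^esub>" using ring_hom_one[OF hh] by (simp add: As)
  have h_I: "h f = \<zero>\<^bsub>A\<^esub>" if "f \<in> I" for f
    using I.a_rcos_const[OF that] by (simp add: h_def As FactRing_def)
  have h_zero: "h \<zero>\<^bsub>R\<^esub> = \<zero>\<^bsub>A\<^esub>" by (rule h_I[OF additive_subgroup.zero_closed[OF ideal.axioms(1)[OF id]]])
  have rA: "ring A" using fd by (simp add: fd_module_def right_module_def)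
  have h_pow: "h (f [^]\<^bsub>R\<^esub> (t::nat)) = h f [^]\<^bsub>A\<^esub> t" if f: "f \<in> carrier R" for f t
  proof (induction t)
    case 0
    show ?case by (simp add: nat_pow_def h_one)
  next
    case (Suc t)
    have "f [^]\<^bsub>R\<^esub> t \<in> carrier R" using f by simp
    then show ?case using Suc h_mult f by (simp add: nat_pow_def)
  qed
  have h_eq: "h f = h y" if y: "y \<in> carrier R" and f: "f \<in> h y" for f y
    using I.a_repr_independence'[of f y] y f by (simp add: h_def)
  have h_car: "h y \<subseteq> carrier R" if "y \<in> carrier R" for y
    using I.a_r_coset_subset_G[OF I.a_subset that] by (simp add: h_def)
  \<comment> \<open>The scalar action on a coset is a union over its representatives; since c acts
    as multiplication by a diagonal element, all of them give the same coset.\<close>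
  have sc: "c \<odot>\<^bsub>A\<^esub> \<one>\<^bsub>A\<^esub> = h (diag (\<lambda>_. c))" for c
  proof -
    have 1: "h (c \<odot>\<^bsub>R\<^esub> f) = h (diag (\<lambda>_. c))" if "f \<in> h \<one>\<^bsub>R\<^esub>" for f
    proof -
      have f: "f \<in> carrier R" using that h_car[of "\<one>\<^bsub>R\<^esub>"] by auto
      have "h f = \<one>\<^bsub>A\<^esub>" using h_eq[OF _ that] h_one by simp
      then have "h (c \<odot>\<^bsub>R\<^esub> f) = h (diag (\<lambda>_. c)) \<otimes>\<^bsub>A\<^esub> \<one>\<^bsub>A\<^esub>"
        using f by (simp add: smult_diag h_mult)
      moreover have "h (diag (\<lambda>_. c)) \<in> carrier A" by (simp add: carA)
      ultimately show ?thesis using monoid.r_one[OF ring.is_monoid[OF rA]] by simp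
    qed
    have ne: "\<one>\<^bsub>R\<^esub> \<in> h \<one>\<^bsub>R\<^esub>" unfolding h_def by (rule I.a_rcos_self) simp
    have "c \<odot>\<^bsub>A\<^esub> \<one>\<^bsub>A\<^esub> = (\<Union>f\<in>h \<one>\<^bsub>R\<^esub>. h (c \<odot>\<^bsub>R\<^esub> f))"
      by (simp add: As(6) h_one[symmetric] h_def)
    also have "\<dots> = h (diag (\<lambda>_. c))" using 1 ne by blast
    finally show ?thesis .
  qed
  \<comment> \<open>The quiver numbers its vertices from 1, whereas interval indices count from 0
    modulo \<open>N\<close>.\<close>
  define e where "e i = h (vertex (i mod N + 1))" for i
  define \<xi> where "\<xi> = h (arrows (arcs Q))"
  have cX: "(arrows (arcs Q) :: _ \<Rightarrow> 'k) \<in> carrier R" by (rule arrows_carrier)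
  have cV: "(vertex i :: _ \<Rightarrow> 'k) \<in> carrier R" for i by (simp add: vertex_def)
  have Npos: "N > 0" using N by simp
  have iN: "i mod N + 1 \<in> {1..N}" for i using Npos by (simp add: Suc_leI)
  have "nakayama A N m e \<xi>"
  proof (intro nakayama.intro kalgebra.intro kalgebra_axioms.intro nakayama_axioms.intro)
    show "ring A" by (rule rA)
    show "c \<odot>\<^bsub>A\<^esub> \<one>\<^bsub>A\<^esub> \<in> carrier A" for c by (simp add: sc carA)
    show "(c + d) \<odot>\<^bsub>A\<^esub> \<one>\<^bsub>A\<^esub> = c \<odot>\<^bsub>A\<^esub> \<one>\<^bsub>A\<^esub> \<oplus>\<^bsub>A\<^esub> d \<odot>\<^bsub>A\<^esub> \<one>\<^bsub>A\<^esub>" for c d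
    proof -
      have "diag (\<lambda>_. c + d) = diag (\<lambda>_. c) \<oplus>\<^bsub>R\<^esub> diag (\<lambda>_. d)" by (auto simp: diag_def R_simps)
      then show ?thesis by (simp add: sc h_add)
    qed
    show "(c * d) \<odot>\<^bsub>A\<^esub> \<one>\<^bsub>A\<^esub> = (c \<odot>\<^bsub>A\<^esub> \<one>\<^bsub>A\<^esub>) \<otimes>\<^bsub>A\<^esub> (d \<odot>\<^bsub>A\<^esub> \<one>\<^bsub>A\<^esub>)" for c d
    proof -
      have "diag (\<lambda>_. c * d) = diag (\<lambda>_. c) \<otimes>\<^bsub>R\<^esub> diag (\<lambda>_. d)"
        unfolding diag_mult[OF diag_carrier] by (auto simp: diag_def)
      then show ?thesis by (simp add: sc h_mult)
    qed
    show "1 \<odot>\<^bsub>A\<^esub> \<one>\<^bsub>A\<^esub> = \<one>\<^bsub>A\<^esub>" by (simp add: sc one_diag[symmetric] h_one)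
    show "(c \<odot>\<^bsub>A\<^esub> \<one>\<^bsub>A\<^esub>) \<otimes>\<^bsub>A\<^esub> a = a \<otimes>\<^bsub>A\<^esub> (c \<odot>\<^bsub>A\<^esub> \<one>\<^bsub>A\<^esub>)" if a: "a \<in> carrier A" for a c
    proof -
      obtain f where f: "f \<in> carrier R" "a = h f" using a carA by blast
      have "diag (\<lambda>_. c) \<otimes>\<^bsub>R\<^esub> f = f \<otimes>\<^bsub>R\<^esub> diag (\<lambda>_. c)"
        using f by (auto simp: diag_mult mult_diag)
      then show ?thesis using f by (simp add: sc h_mult[symmetric])
    qed
    show "fd_module A (regular_module A)" by (rule fd)
    show "0 < N" by (rule Npos)
    show "e i \<in> carrier A" for i using cV by (simp add: e_def carA)
    show "e i \<otimes>\<^bsub>A\<^esub> e j = (if i mod N = j mod N then e i else \<zero>\<^bsub>A\<^esub>)" for i j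
      by (simp add: e_def h_mult[OF cV cV, symmetric] vertex_mult h_zero)
    show "e (i mod N) = e i" for i by (simp add: e_def)
    show "\<xi> \<in> carrier A" using cX by (simp add: \<xi>_def carA)
    show "e i \<otimes>\<^bsub>A\<^esub> \<xi> = \<xi> \<otimes>\<^bsub>A\<^esub> e (Suc i)" for i
    proof -
      have eq: "Suc i mod N + 1 = (if i mod N + 1 = N then 1 else Suc (i mod N + 1))"
        by (simp add: mod_Suc)
      have "vertex (i mod N + 1) \<otimes>\<^bsub>R\<^esub> arrows (arcs Q) = (arrows (arcs Q) \<otimes>\<^bsub>R\<^esub> vertex (Suc i mod N + 1) :: _ \<Rightarrow> 'k)"
        unfolding eq by (rule vertex_arrows[OF iN])
      then show ?thesis by (simp add: e_def \<xi>_def h_mult[OF _ cX, OF cV, symmetric] h_mult[OF cX cV, symmetric])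
    qed
    have "arrows (arcs Q) [^]\<^bsub>R\<^esub> m \<in> I" using power_in_arrow_ideal[OF R] m by blast
    then show "\<xi> [^]\<^bsub>A\<^esub> m = \<zero>\<^bsub>A\<^esub>" by (simp add: \<xi>_def h_pow[OF cX, symmetric] h_I)
    fix a and P :: "_ \<Rightarrow> bool"
    assume a: "a \<in> carrier A" and zero: "P \<zero>\<^bsub>A\<^esub>"
      and add: "\<And>a b. a \<in> carrier A \<Longrightarrow> b \<in> carrier A \<Longrightarrow> P a \<Longrightarrow> P b \<Longrightarrow> P (a \<oplus>\<^bsub>A\<^esub> b)"
      and basis: "\<And>c i t. P ((c \<odot>\<^bsub>A\<^esub> \<one>\<^bsub>A\<^esub>) \<otimes>\<^bsub>A\<^esub> (e i \<otimes>\<^bsub>A\<^esub> \<xi> [^]\<^bsub>A\<^esub> (t::nat)))"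
    obtain f where f: "f \<in> carrier R" "a = h f" using a carA by blast
    have "P (h f)"
    proof (rule R_induct[OF R f(1), of "\<lambda>f. P (h f)"])
      show "P (h \<zero>\<^bsub>R\<^esub>)" using zero by (simp add: h_zero)
      show "P (h (f \<oplus>\<^bsub>R\<^esub> g))" if "f \<in> carrier R" "g \<in> carrier R" "P (h f)" "P (h g)" for f g
        using that add by (simp add: h_add carA)
      fix c :: 'k and i t :: nat assume i: "i \<in> {1..N}"
      then have "(i - Suc 0) mod N + 1 = i" by (cases i) auto
      then have ei: "e (i - Suc 0) = h (vertex i)" by (simp add: e_def)
      have cp: "(arrows (arcs Q) [^]\<^bsub>R\<^esub> t :: _ \<Rightarrow> 'k) \<in> carrier R"
        by (rule monoid.nat_pow_closed[OF ring.is_monoid[OF R] cX])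
      show "P (h (diag (\<lambda>_. c) \<otimes>\<^bsub>R\<^esub> (vertex i \<otimes>\<^bsub>R\<^esub> arrows (arcs Q) [^]\<^bsub>R\<^esub> t)))"
        using basis[of c "i - Suc 0" t] cV cp
        by (simp add: sc ei \<xi>_def h_pow[OF cX, symmetric] h_mult)
    qed
    then show "P a" using f by simp
  qed
  then show ?thesis by blast
qed

end

lemma linear_nakayama_quiver: "N \<ge> 1 \<Longrightarrow> nakayama_quiver (linear_quiver N) N"
  by unfold_locales (auto simp: linear_quiver_def)

lemma cyclic_nakayama_quiver: "N \<ge> 1 \<Longrightarrow> nakayama_quiver (cyclic_quiver N) N"
  by unfold_locales (auto simp: cyclic_quiver_def)

lemma nakayama_algebra_nakayama:
  assumes "nakayama_algebra A"
  shows "\<exists>N nil e \<xi>. nakayama A N nil e \<xi>"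
proof -
  obtain N Q I where N: "N \<ge> 1" and Q: "Q \<in> {linear_quiver N, cyclic_quiver N}"
    and adm: "admissible_ideal Q I" and A: "A = quotient_algebra (path_algebra Q) I"
    and fd: "fd_module A (regular_module A)"
    using assms by (auto simp: nakayama_algebra_def)
  have "nakayama_quiver Q N"
    using Q linear_nakayama_quiver[OF N] cyclic_nakayama_quiver[OF N] by blast
  from nakayama_quiver.quotient_nakayama[OF this adm A fd] show ?thesis by blast
qed

theorem theorem6p2:
  fixes A :: "('k::field, ((nat, nat) path \<Rightarrow> 'k) set) module"
    and n :: nat
  assumes "nakayama_algebra A"
    and "n \<ge> 1"
    and "gorenstein (2 * n) A"
  shows "gorenstein (2 * n + 1) A"
proof -
  obtain N nil e \<xi> where "nakayama A N nil e \<xi>"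
    using nakayama_algebra_nakayama[OF assms(1)] by blast
  then show ?thesis using assms(2,3) by (rule nakayama.gorenstein_even_imp_odd)
qed

end
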